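(* Let $k\ge 1$, and assume that the first-order linear convection problem (CP): $\boldsymbol{\beta}\cdot\nabla\lambda-c\lambda=f$ in $\Omega$, $\lambda=g$ on $\Gamma_-$, has a unique solution. Then for any parameters $\tau_1>0$ and $\tau_2>0$ the primal-dual weak Galerkin (PD-WG) scheme has a unique solution $(\lambda_h,u_h)\in W_h\times M_h$.
   Context: Continuous problem. Let $d\in\{2,3\}$, $\Omega\subset\mathbb R^d$ an open bounded connected domain with Lipschitz boundary and unit outward normal $\mathbf n$; $\boldsymbol{\beta}\in[L^\infty(\Omega)]^d$, $c\in L^\infty(\Omega)$, $f\in L^2(\Omega)$, $g\in L^2(\Gamma_-)$, where $\Gamma_-$ is the inflow part of $\partial\Omega$, on which $\boldsymbol{\beta}\cdot\mathbf n<0$. A solution of (CP) is $\lambda\in H^1_{\boldsymbol\beta}(\Omega)=\{w\in L^2(\Omega):\boldsymbol{\beta}\cdot\nabla w\in L^2(\Omega)\}$ with $\lambda=g$ on $\Gamma_-$ and $(\boldsymbol{\beta}\cdot\nabla\lambda-c\lambda,v)=(f,v)$ for all $v\in L^2(\Omega)$. Mesh. $\mathcal T_h$ is a partition of $\Omega$ into polygons ($d=2$) or polyhedra ($d=3$), $h_T$ is the diameter of $T$, $h=\max_T h_T$; $e$ denotes edges ($d=2$) or flat faces ($d=3$) of elements, $h_e$ the diameter of $e$. $\Gamma_-$ is a union of mesh edges/faces. $\mathcal T_h$ is shape regular in the following sense, with constants independent of $h$: (A1) $\varrho_v h_T^d\le |T|$ and $\varrho_e h_e^{d-1}\le |e|$;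 (A2) $\kappa h_T\le h_e$ for every $e\subset\partial T$; (A3) for every $T$ and $e\subset\partial T$ there is a pyramid contained in $T$ with base $e$, apex $A_e$ and height $\sigma_e h_T$ with $\sigma_e\ge\sigma^*>0$, such that for all $x_e\in e$ the angle between $x_e-A_e$ and the outward normal of $e$ is at most $\theta_0<\pi/2$; (A4) every $T$ has a circumscribed shape regular simplex $S(T)$ of diameter at most $\gamma_* h_T$, and each $S(T)$ meets only a fixed bounded number of the other such simplices. The functions $\boldsymbol\beta$ and $c$ are piecewise smooth with respect to $\mathcal T_h$. Spaces. $P_r(T)$ denotes polynomials of degree at most $r$. For fixed $k\ge1$, $W_h$ is the space of $\sigma=\{\sigma_0,\sigma_b\}$ with $\sigma_0|_T\in P_k(T)$ for each $T$ and $\sigma_b|_e\in P_k(e)$ for each edge/face $e$ ($\sigma_b$ single-valued on interior edges/faces; $\sigma_b$ need not be the trace of $\sigma_0$). $W_h^0=\{\sigma\in W_h:\sigma_b=0 \text{ on each } e\subset\Gamma_-\}$. $M_h=\{v: v|_T\in P_{k-1}(T)\ \forall T\in\mathcal T_h\}$. The discrete weak gradient $\nabla_w\sigma$ is defined on each $T$ as the unique element of $[P_{k-1}(T)]^d$ with $(\nabla_w\sigma,\boldsymbol\psi)_T=-(\sigma_0,\nabla\cdot\boldsymbol\psi)_T+\langle\sigma_b,\boldsymbol\psi\cdot\mathbf n\rangle_{\partial T}$ for all $\boldsymbol\psi\in[P_{k-1}(T)]^d$. Scheme. For $\rho,\sigma\in W_h$, $v\in M_h$, put $$s(\rho,\sigma)=\sum_{T}\Big(h_T^{-1}\langle\rho_0-\rho_b,\sigma_0-\sigma_b\rangle_{\partial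 T}+\tau_1(\boldsymbol\beta\cdot\nabla\rho_0-c\rho_0,\boldsymbol\beta\cdot\nabla\sigma_0-c\sigma_0)_T\Big),\qquad b(\sigma,v)=\sum_T(\boldsymbol\beta\cdot\nabla_w\sigma-c\sigma_0,v)_T .$$ The PD-WG scheme with parameters $\tau_1\ge0$, $\tau_2>0$: find $(\lambda_h,u_h)\in W_h\times M_h$, $\lambda_h=\{\lambda_0,\lambda_b\}$, with $\lambda_b|_e=Q_b(g|_e)$ for all $e\subset\Gamma_-$ ($Q_b$ the $L^2(e)$-projection onto $P_k(e)$), such that $$s(\lambda_h,\sigma)+b(\sigma,u_h)=\sum_T\tau_1(f,\boldsymbol\beta\cdot\nabla\sigma_0-c\sigma_0)_T\ \ \forall\sigma\in W_h^0,\qquad -\tau_2\sum_T h_T^2(u_h,v)_T+b(\lambda_h,v)=(f,v)\ \ \forall v\in M_h .$$ *)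

theory Defs
  imports "HOL-Analysis.Analysis"
begin

section \<open>Function spaces\<close>

definition L2 :: "'a measure \<Rightarrow> ('a \<Rightarrow> real) set" where
  "L2 M = {f \<in> borel_measurable M. integrable M (\<lambda>x. (f x)\<^sup>2)}"

definition Linf :: "'a measure \<Rightarrow> ('a \<Rightarrow> 'b::real_normed_vector) set" where
  "Linf M = {f \<in> borel_measurable M. \<exists>C. AE x in M. norm (f x) \<le> C}"

definition ip :: "'a measure \<Rightarrow> ('a \<Rightarrow> real) \<Rightarrow> ('a \<Rightarrow> real) \<Rightarrow> real" where
  "ip M f g = (\<integral>x. f x * g x \<partial>M)"

definition grad :: "('a::euclidean_space \<Rightarrow> real) \<Rightarrow> 'a \<Rightarrow> 'a" where
  "grad f x = (\<Sum>i\<in>Basis. frechet_derivative f (at x) i *\<^sub>R i)"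

definition divergence :: "('a::euclidean_space \<Rightarrow> 'a) \<Rightarrow> 'a \<Rightarrow> real" where
  "divergence \<psi> x = (\<Sum>i\<in>Basis. frechet_derivative \<psi> (at x) i \<bullet> i)"

text \<open>\<open>Ck_on n f U\<close>: all partial derivatives of \<open>f\<close> of order at most \<open>n\<close> exist and are
  continuous on the open set \<open>U\<close>.\<close>

primrec Ck_on :: "nat \<Rightarrow> ('a::euclidean_space \<Rightarrow> 'b::real_normed_vector) \<Rightarrow> 'a set \<Rightarrow> bool" where
  "Ck_on 0 f U \<longleftrightarrow> continuous_on U f"
| "Ck_on (Suc n) f U \<longleftrightarrow> (\<forall>x\<in>U. f differentiable (at x)) \<and>
     (\<forall>i\<in>Basis. Ck_on n (\<lambda>x. frechet_derivative f (at x) i) U)"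

definition compactly_supported_in ::
    "'a::topological_space set \<Rightarrow> ('a \<Rightarrow> 'b::zero) \<Rightarrow> bool" where
  "compactly_supported_in \<Omega> \<phi> \<longleftrightarrow> (\<exists>K. compact K \<and> K \<subseteq> \<Omega> \<and> (\<forall>x. x \<notin> K \<longrightarrow> \<phi> x = 0))"


section \<open>Lipschitz boundary, surface measure, normals\<close>

text \<open>Near each boundary point, \<open>\<Omega>\<close> is the part lying above the graph of a Lipschitz function
  over the hyperplane orthogonal to some direction \<open>\<nu>\<close>.\<close>

definition lipschitz_boundary :: "'a::euclidean_space set \<Rightarrow> bool" where
  "lipschitz_boundary \<Omega> \<longleftrightarrow>
     (\<forall>x\<in>frontier \<Omega>. \<exists>r>0. \<exists>\<nu> L. \<exists>\<phi>::'a \<Rightarrow> real. norm \<nu> = 1 \<and>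
        L-lipschitz_on {z. z \<bullet> \<nu> = 0} \<phi> \<and>
        (\<forall>y\<in>ball x r. y \<in> \<Omega> \<longleftrightarrow> \<phi> (y - (y \<bullet> \<nu>) *\<^sub>R \<nu>) < y \<bullet> \<nu>))"

text \<open>The \<open>(d-1)\<close>-dimensional Lebesgue measure on a flat set \<open>e\<close> spanning a hyperplane \<open>H\<close>: the
  surface measure of \<open>A \<subseteq> H\<close> is the volume of the slab of thickness 1 over \<open>A\<close>, that is, of
  \<open>{x + t n |x t. x \<in> A \<and> \<bar>t\<bar> \<le> 1/2}\<close> with \<open>n\<close> a unit normal of \<open>H\<close>.\<close>

definition face_measure :: "'a::euclidean_space set \<Rightarrow> 'a measure" where
  "face_measure e =
     restrict_space
       (distr (restrict_space lborel {x. infdist x (affine hull e) \<le> 1/2}) borel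
          (closest_point (affine hull e))) e"

text \<open>The unit normal on the flat boundary piece \<open>e\<close> of \<open>S\<close> that points out of \<open>S\<close>. Outwardness is
  only required at almost every point of \<open>e\<close>, because a nonconvex \<open>S\<close> may touch its own boundary
  piece from outside along a lower-dimensional set.\<close>

definition outward_normal :: "'a::euclidean_space set \<Rightarrow> 'a set \<Rightarrow> 'a" where
  "outward_normal S e = (THE n. norm n = 1 \<and> (\<forall>x\<in>e. \<forall>y\<in>e. (x - y) \<bullet> n = 0) \<and>
     (AE x in face_measure e. \<exists>\<epsilon>>0. \<forall>t\<in>{0<..<\<epsilon>}. x + t *\<^sub>R n \<notin> S))"

definition angle :: "'a::real_inner \<Rightarrow> 'a \<Rightarrow> real" where
  "angle u v = arccos ((u \<bullet> v) / (norm u * norm v))"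


section \<open>Polygonal and polyhedral meshes\<close>

text \<open>A possibly nonconvex polygon or polyhedron of dimension \<open>n\<close>, as a compact set. For
  \<open>n = DIM('a)\<close> the relative interior is the interior. A mesh face is such a cell of dimension
  \<open>DIM('a) - 1\<close>; in the plane these are exactly the nondegenerate closed segments.\<close>

definition polyhedral_cell :: "int \<Rightarrow> 'a::euclidean_space set \<Rightarrow> bool" where
  "polyhedral_cell n S \<longleftrightarrow> aff_dim S = n \<and> connected (rel_interior S) \<and>
     closure (rel_interior S) = S \<and> (\<exists>F. finite F \<and> (\<forall>P\<in>F. polytope P) \<and> S = \<Union>F)"

definition faces_of :: "'a::topological_space set set \<Rightarrow> 'a set \<Rightarrow> 'a set set" where
  "faces_of \<E> T = {e\<in>\<E>. e \<subseteq> frontier T}"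

text \<open>A mesh is given by its elements \<open>\<T>\<close> together with its edges/faces \<open>\<E>\<close>. An edge of an
  element may consist of several collinear mesh edges (hanging nodes), and likewise for faces; the
  boundary of each element is tiled by mesh faces, so that a face between two elements is a face
  of both.\<close>

definition polyhedral_mesh :: "'a::euclidean_space set \<Rightarrow> 'a set set \<Rightarrow> 'a set set \<Rightarrow> bool" where
  "polyhedral_mesh \<Omega> \<T> \<E> \<longleftrightarrow>
     finite \<T> \<and> (\<forall>T\<in>\<T>. polyhedral_cell (int DIM('a)) T) \<and>
     \<Union>\<T> = closure \<Omega> \<and> pairwise (\<lambda>S T. interior S \<inter> interior T = {}) \<T> \<and>
     finite \<E> \<and> (\<forall>e\<in>\<E>. polyhedral_cell (int DIM('a) - 1) e \<and> (\<exists>T\<in>\<T>. e \<subseteq> frontier T)) \<and>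
     pairwise (\<lambda>d e. rel_interior d \<inter> rel_interior e = {}) \<E> \<and>
     (\<forall>T\<in>\<T>. frontier T = \<Union>(faces_of \<E> T))"

text \<open>The cone condition: the pyramid with base \<open>e\<close> and apex \<open>A\<close> is the union of the segments
  from \<open>A\<close> to points of \<open>e\<close> (\<open>e\<close> need not be convex). In the last clause \<open>S T\<close> is the circumscribed
  simplex, whose shape regularity means that it contains a ball of radius comparable to its diameter.\<close>

definition shape_regular ::
    "real \<Rightarrow> real \<Rightarrow> real \<Rightarrow> real \<Rightarrow> real \<Rightarrow> real \<Rightarrow> real \<Rightarrow> nat \<Rightarrow>
     'a::euclidean_space set set \<Rightarrow> 'a set set \<Rightarrow> bool" where
  "shape_regular \<rho>\<^sub>v \<rho>\<^sub>e \<kappa> \<sigma>\<^sub>s \<theta>\<^sub>0 \<gamma>\<^sub>s \<rho>\<^sub>S N \<T> \<E> \<longleftrightarrow>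
     (\<forall>T\<in>\<T>. \<rho>\<^sub>v * diameter T ^ DIM('a) \<le> measure lebesgue T) \<and>
     (\<forall>e\<in>\<E>. \<rho>\<^sub>e * diameter e ^ (DIM('a) - 1) \<le> measure (face_measure e) e) \<and>
     (\<forall>T\<in>\<T>. \<forall>e\<in>faces_of \<E> T. \<kappa> * diameter T \<le> diameter e) \<and>
     (\<forall>T\<in>\<T>. \<forall>e\<in>faces_of \<E> T. \<exists>A. \<exists>\<sigma>\<ge>\<sigma>\<^sub>s.
        (\<Union>x\<in>e. closed_segment A x) \<subseteq> T \<and> infdist A (affine hull e) = \<sigma> * diameter T \<and>
        (\<forall>x\<in>e. angle (x - A) (outward_normal T e) \<le> \<theta>\<^sub>0)) \<and>
     (\<exists>S. (\<forall>T\<in>\<T>. int DIM('a) simplex S T \<and> T \<subseteq> S T \<and> diameter (S T) \<le> \<gamma>\<^sub>s * diameter T \<and>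
               (\<exists>z. cball z (\<rho>\<^sub>S * diameter (S T)) \<subseteq> S T) \<and>
               card {T'\<in>\<T>. T' \<noteq> T \<and> S T \<inter> S T' \<noteq> {}} \<le> N))"

text \<open>Smoothness on each element is understood up to the boundary of the element.\<close>

definition piecewise_smooth ::
    "'a::euclidean_space set set \<Rightarrow> ('a \<Rightarrow> 'b::real_normed_vector) \<Rightarrow> bool" where
  "piecewise_smooth \<T> b \<longleftrightarrow> (\<forall>T\<in>\<T>. \<exists>U B. open U \<and> T \<subseteq> U \<and> (\<forall>n. Ck_on n B U) \<and>
     (\<forall>x\<in>interior T. b x = B x))"


section \<open>The continuous problem\<close>

text \<open>The normal component of \<open>\<beta>\<close> on a boundary face uses the one-sided limits of \<open>\<beta>\<close> from inside
  \<open>\<Omega>\<close>, which exist almost everywhere on the boundary when \<open>\<beta>\<close> is piecewise smooth.\<close>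

definition normal_flux :: "'a::euclidean_space set \<Rightarrow> ('a \<Rightarrow> 'a) \<Rightarrow> 'a set \<Rightarrow> 'a \<Rightarrow> real" where
  "normal_flux \<Omega> \<beta> e x = Lim (at x within \<Omega>) \<beta> \<bullet> outward_normal \<Omega> e"

text \<open>The faces making up the inflow boundary, and the requirement that (up to null sets) the inflow
  boundary is a union of mesh faces.\<close>

definition inflow_faces ::
    "'a::euclidean_space set \<Rightarrow> ('a \<Rightarrow> 'a) \<Rightarrow> 'a set set \<Rightarrow> 'a set set" where
  "inflow_faces \<Omega> \<beta> \<E> =
     {e\<in>faces_of \<E> \<Omega>. AE x in face_measure e. normal_flux \<Omega> \<beta> e x < 0}"

definition inflow_resolved ::
    "'a::euclidean_space set \<Rightarrow> ('a \<Rightarrow> 'a) \<Rightarrow> 'a set set \<Rightarrow> bool" where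
  "inflow_resolved \<Omega> \<beta> \<E> \<longleftrightarrow>
     (\<forall>e\<in>faces_of \<E> \<Omega> - inflow_faces \<Omega> \<beta> \<E>. AE x in face_measure e. normal_flux \<Omega> \<beta> e x \<ge> 0)"

definition has_weak_divergence ::
    "'a::euclidean_space set \<Rightarrow> ('a \<Rightarrow> 'a) \<Rightarrow> ('a \<Rightarrow> real) \<Rightarrow> bool" where
  "has_weak_divergence \<Omega> \<psi> q \<longleftrightarrow>
     (\<forall>\<eta>. Ck_on 1 \<eta> UNIV \<and> compactly_supported_in \<Omega> \<eta> \<longrightarrow>
        (\<integral>x. \<psi> x \<bullet> grad \<eta> x \<partial>lebesgue_on \<Omega>) = - ip (lebesgue_on \<Omega>) q \<eta>)"

text \<open>The weak form of \<open>r = \<beta> \<cdot> \<nabla>w\<close>, that is, \<open>(r, \<phi>) = - (w, div (\<phi> \<beta>))\<close>. Since \<open>\<beta>\<close> may be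
  discontinuous between elements, \<open>div (\<phi> \<beta>)\<close> is not a function for every smooth \<open>\<phi>\<close>; the test
  functions are all bounded compactly supported \<open>\<phi>\<close> for which it is square integrable. These include
  the smooth functions compactly supported inside an element, so \<open>r\<close> is unique almost
  everywhere, and those whose flux \<open>\<phi> \<beta> \<cdot> n\<close> is single-valued across faces, which rule out jumps of
  \<open>w\<close> across noncharacteristic interfaces.\<close>

definition has_directional_deriv ::
    "'a::euclidean_space set \<Rightarrow> ('a \<Rightarrow> 'a) \<Rightarrow> ('a \<Rightarrow> real) \<Rightarrow> ('a \<Rightarrow> real) \<Rightarrow> bool" where
  "has_directional_deriv \<Omega> \<beta> w r \<longleftrightarrow>
     (\<forall>\<phi> q. \<phi> \<in> Linf (lebesgue_on \<Omega>) \<and> compactly_supported_in \<Omega> \<phi> \<and> q \<in> L2 (lebesgue_on \<Omega>) \<and>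
        has_weak_divergence \<Omega> (\<lambda>x. \<phi> x *\<^sub>R \<beta> x) q \<longrightarrow>
        ip (lebesgue_on \<Omega>) r \<phi> = - ip (lebesgue_on \<Omega>) w q)"

definition H1_beta :: "'a::euclidean_space set \<Rightarrow> ('a \<Rightarrow> 'a) \<Rightarrow> ('a \<Rightarrow> real) set" where
  "H1_beta \<Omega> \<beta> = {w \<in> L2 (lebesgue_on \<Omega>). \<exists>r \<in> L2 (lebesgue_on \<Omega>). has_directional_deriv \<Omega> \<beta> w r}"

text \<open>\<open>w = g\<close> on \<open>e\<close> in the sense of traces: at almost every point of \<open>e\<close>, \<open>g x\<close> is the limit of
  means of \<open>w\<close> over small half-balls. For a function in \<open>H1_beta\<close> such a trace exists on faces where
  \<open>\<beta> \<cdot> n < 0\<close>.\<close>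

definition has_trace ::
    "'a::euclidean_space set \<Rightarrow> ('a \<Rightarrow> real) \<Rightarrow> ('a \<Rightarrow> real) \<Rightarrow> 'a set \<Rightarrow> bool" where
  "has_trace \<Omega> w g e \<longleftrightarrow> (AE x in face_measure e.
     ((\<lambda>r. (\<integral>y. \<bar>w y - g x\<bar> \<partial>lebesgue_on (\<Omega> \<inter> ball x r)) / measure lebesgue (\<Omega> \<inter> ball x r))
        \<longlongrightarrow> 0) (at_right 0))"

definition cp_solution ::
    "'a::euclidean_space set \<Rightarrow> ('a \<Rightarrow> 'a) \<Rightarrow> ('a \<Rightarrow> real) \<Rightarrow> ('a \<Rightarrow> real) \<Rightarrow> ('a \<Rightarrow> real) \<Rightarrow>
     'a set set \<Rightarrow> ('a \<Rightarrow> real) \<Rightarrow> bool" where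
  "cp_solution \<Omega> \<beta> c f g \<E> w \<longleftrightarrow>
     w \<in> H1_beta \<Omega> \<beta> \<and> (\<forall>e\<in>inflow_faces \<Omega> \<beta> \<E>. has_trace \<Omega> w g e) \<and>
     (\<exists>r \<in> L2 (lebesgue_on \<Omega>). has_directional_deriv \<Omega> \<beta> w r \<and>
        (\<forall>v \<in> L2 (lebesgue_on \<Omega>).
           ip (lebesgue_on \<Omega>) (\<lambda>x. r x - c x * w x) v = ip (lebesgue_on \<Omega>) f v))"

definition cp_uniquely_solvable ::
    "'a::euclidean_space set \<Rightarrow> ('a \<Rightarrow> 'a) \<Rightarrow> ('a \<Rightarrow> real) \<Rightarrow> ('a \<Rightarrow> real) \<Rightarrow> ('a \<Rightarrow> real) \<Rightarrow>
     'a set set \<Rightarrow> bool" where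
  "cp_uniquely_solvable \<Omega> \<beta> c f g \<E> \<longleftrightarrow>
     (\<exists>w. cp_solution \<Omega> \<beta> c f g \<E> w) \<and>
     (\<forall>w w'. cp_solution \<Omega> \<beta> c f g \<E> w \<and> cp_solution \<Omega> \<beta> c f g \<E> w' \<longrightarrow>
        (AE x in lebesgue_on \<Omega>. w x = w' x))"


section \<open>Discrete spaces and the weak gradient\<close>

definition multi_indices :: "nat \<Rightarrow> ('a::euclidean_space \<Rightarrow> nat) set" where
  "multi_indices r = {\<alpha>. (\<forall>i. i \<notin> Basis \<longrightarrow> \<alpha> i = 0) \<and> (\<Sum>i\<in>Basis. \<alpha> i) \<le> r}"

definition polys :: "nat \<Rightarrow> ('a::euclidean_space \<Rightarrow> real) set" where
  "polys r = {p. \<exists>a. p = (\<lambda>x. \<Sum>\<alpha>\<in>multi_indices r. a \<alpha> * (\<Prod>i\<in>Basis. (x \<bullet> i) ^ \<alpha> i))}"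

definition vec_polys :: "nat \<Rightarrow> ('a::euclidean_space \<Rightarrow> 'a) set" where
  "vec_polys r = {\<psi>. \<forall>i\<in>Basis. (\<lambda>x. \<psi> x \<bullet> i) \<in> polys r}"

definition face_polys :: "nat \<Rightarrow> 'a::euclidean_space set \<Rightarrow> ('a \<Rightarrow> real) set" where
  "face_polys r e = (\<lambda>p. restrict p e) ` polys r"

text \<open>A polynomial on an element is identified with its unique extension to the whole space. A polynomial
  on a face is a function on that face only, since there the extension is not unique.
  All families are extensional, so that equality is equality of finite element functions.\<close>

type_synonym 'a weak_fun = "('a set \<Rightarrow> 'a \<Rightarrow> real) \<times> ('a set \<Rightarrow> 'a \<Rightarrow> real)"

definition W_space :: "nat \<Rightarrow> 'a::euclidean_space set set \<Rightarrow> 'a set set \<Rightarrow> 'a weak_fun set" where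
  "W_space k \<T> \<E> = (\<T> \<rightarrow>\<^sub>E polys k) \<times> (\<Pi>\<^sub>E e\<in>\<E>. face_polys k e)"

definition W0_space ::
    "nat \<Rightarrow> 'a::euclidean_space set set \<Rightarrow> 'a set set \<Rightarrow> 'a set set \<Rightarrow> 'a weak_fun set" where
  "W0_space k \<T> \<E> \<I> = {\<sigma> \<in> W_space k \<T> \<E>. \<forall>e\<in>\<I>. \<forall>x\<in>e. snd \<sigma> e x = 0}"

definition M_space :: "nat \<Rightarrow> 'a::euclidean_space set set \<Rightarrow> ('a set \<Rightarrow> 'a \<Rightarrow> real) set" where
  "M_space k \<T> = (\<T> \<rightarrow>\<^sub>E polys (k - 1))"

definition weak_grad ::
    "nat \<Rightarrow> 'a::euclidean_space set set \<Rightarrow> 'a weak_fun \<Rightarrow> 'a set \<Rightarrow> 'a \<Rightarrow> 'a" where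
  "weak_grad k \<E> \<sigma> T = (THE q. q \<in> vec_polys (k - 1) \<and>
     (\<forall>\<psi>\<in>vec_polys (k - 1).
        (\<integral>x. q x \<bullet> \<psi> x \<partial>lebesgue_on T) =
          - ip (lebesgue_on T) (fst \<sigma> T) (divergence \<psi>) +
          (\<Sum>e\<in>faces_of \<E> T. ip (face_measure e) (snd \<sigma> e) (\<lambda>x. \<psi> x \<bullet> outward_normal T e))))"

definition face_projection ::
    "nat \<Rightarrow> 'a::euclidean_space set \<Rightarrow> ('a \<Rightarrow> real) \<Rightarrow> 'a \<Rightarrow> real" where
  "face_projection k e g = (THE q. q \<in> face_polys k e \<and>
     (\<forall>p\<in>face_polys k e. ip (face_measure e) q p = ip (face_measure e) g p))"


section \<open>The primal-dual weak Galerkin scheme\<close>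

definition conv_op ::
    "('a::euclidean_space \<Rightarrow> 'a) \<Rightarrow> ('a \<Rightarrow> real) \<Rightarrow> ('a \<Rightarrow> real) \<Rightarrow> 'a \<Rightarrow> real" where
  "conv_op \<beta> c p x = \<beta> x \<bullet> grad p x - c x * p x"

definition s_form ::
    "'a::euclidean_space set set \<Rightarrow> 'a set set \<Rightarrow> ('a \<Rightarrow> 'a) \<Rightarrow> ('a \<Rightarrow> real) \<Rightarrow> real \<Rightarrow>
     'a weak_fun \<Rightarrow> 'a weak_fun \<Rightarrow> real" where
  "s_form \<T> \<E> \<beta> c \<tau>\<^sub>1 \<rho> \<sigma> = (\<Sum>T\<in>\<T>.
     inverse (diameter T) * (\<Sum>e\<in>faces_of \<E> T.
       ip (face_measure e) (\<lambda>x. fst \<rho> T x - snd \<rho> e x) (\<lambda>x. fst \<sigma> T x - snd \<sigma> e x)) +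
     \<tau>\<^sub>1 * ip (lebesgue_on T) (conv_op \<beta> c (fst \<rho> T)) (conv_op \<beta> c (fst \<sigma> T)))"

definition b_form ::
    "nat \<Rightarrow> 'a::euclidean_space set set \<Rightarrow> 'a set set \<Rightarrow> ('a \<Rightarrow> 'a) \<Rightarrow> ('a \<Rightarrow> real) \<Rightarrow>
     'a weak_fun \<Rightarrow> ('a set \<Rightarrow> 'a \<Rightarrow> real) \<Rightarrow> real" where
  "b_form k \<T> \<E> \<beta> c \<sigma> v = (\<Sum>T\<in>\<T>.
     ip (lebesgue_on T) (\<lambda>x. \<beta> x \<bullet> weak_grad k \<E> \<sigma> T x - c x * fst \<sigma> T x) (v T))"

definition pdwg_solution ::
    "'a::euclidean_space set \<Rightarrow> 'a set set \<Rightarrow> 'a set set \<Rightarrow> nat \<Rightarrow> ('a \<Rightarrow> 'a) \<Rightarrow> ('a \<Rightarrow> real) \<Rightarrow>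
     ('a \<Rightarrow> real) \<Rightarrow> ('a \<Rightarrow> real) \<Rightarrow> real \<Rightarrow> real \<Rightarrow>
     'a weak_fun \<Rightarrow> ('a set \<Rightarrow> 'a \<Rightarrow> real) \<Rightarrow> bool" where
  "pdwg_solution \<Omega> \<T> \<E> k \<beta> c f g \<tau>\<^sub>1 \<tau>\<^sub>2 lam u \<longleftrightarrow>
     lam \<in> W_space k \<T> \<E> \<and> u \<in> M_space k \<T> \<and>
     (\<forall>e\<in>inflow_faces \<Omega> \<beta> \<E>. snd lam e = face_projection k e g) \<and>
     (\<forall>\<sigma>\<in>W0_space k \<T> \<E> (inflow_faces \<Omega> \<beta> \<E>).
        s_form \<T> \<E> \<beta> c \<tau>\<^sub>1 lam \<sigma> + b_form k \<T> \<E> \<beta> c \<sigma> u =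
          (\<Sum>T\<in>\<T>. \<tau>\<^sub>1 * ip (lebesgue_on T) f (conv_op \<beta> c (fst \<sigma> T)))) \<and>
     (\<forall>v\<in>M_space k \<T>.
        - \<tau>\<^sub>2 * (\<Sum>T\<in>\<T>. (diameter T)\<^sup>2 * ip (lebesgue_on T) (u T) (v T)) +
          b_form k \<T> \<E> \<beta> c lam v =
          (\<Sum>T\<in>\<T>. ip (lebesgue_on T) f (v T)))"

end

theory Submission
  imports Defs
begin

text \<open>The scheme is a square linear system on finite-dimensional spaces, so existence follows from
  uniqueness, and uniqueness is an energy argument. If \<open>(\<sigma>, v)\<close> solves the homogeneous scheme, testing the first
  equation with \<open>\<sigma>\<close> and the second with \<open>v\<close> and eliminating \<open>b(\<sigma>, v)\<close> gives
  \<open>s(\<sigma>, \<sigma>) + \<tau>\<^sub>2 \<Sum>\<^sub>T h\<^sub>T\<^sup>2 (v, v)\<^sub>T = 0\<close>. Hence \<open>v = 0\<close>, \<open>\<sigma>\<^sub>0 = \<sigma>\<^sub>b\<close> on every face, and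
  \<open>\<beta> \<cdot> \<nabla>\<sigma>\<^sub>0 - c \<sigma>\<^sub>0 = 0\<close> in every element. So \<open>\<sigma>\<^sub>0\<close> has no jumps, vanishes on the inflow faces, and solves the
  continuous problem with zero data. Adding it to the solution of (CP) gives another solution; by uniqueness
  \<open>\<sigma>\<^sub>0 = 0\<close> almost everywhere, so its polynomials vanish, and with them \<open>\<sigma>\<^sub>b\<close>.

  Most of the work is to show that a piecewise polynomial without jumps on faces solves the continuous problem
  in the required weak sense. There are three points.

  First, \<open>\<sigma>\<^sub>0\<close> must be single-valued at all points of \<open>\<Omega>\<close>, also where many elements meet (lemma
  \<open>single_valued\<close>). Two elements at such a point are joined by a short segment in general position, which avoids the
  codimension-two skeleton of the mesh.

  Second, the weak directional derivative is defined through a weak divergence that may be tested with \<open>C\<^sup>1\<close>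
  functions of compact support only, and \<open>\<sigma>\<^sub>0\<close> is merely Lipschitz. The larger
  class of test functions is reached by approximation: a Lipschitz function that is \<open>C\<^sup>1\<close> off a closed null set becomes \<open>C\<^sup>1\<close> when averaged over small
  cubes (locale \<open>lipschitz_ae_C1\<close>), and the averages converge together with their gradients. After
  multiplication by \<open>C\<^sup>1\<close> cutoffs, \<open>\<sigma>\<^sub>0\<close> is therefore an admissible test function (lemma
  \<open>w_directional_deriv\<close>).

  Third, the trace on an inflow face is a limit of means over half-balls; it is controlled because almost every
  point of the face lies only in elements that have this face (lemma \<open>AE_boundary_face\<close>).

  On the discrete side, the weak gradient and the projection onto face polynomials are defined by unique
  description. They exist because the Gram forms on polynomials are definite, for which the surface
  measure of a face must charge all relatively open subsets (lemma \<open>face_measure_AE_continuous_eq\<close>). The existence of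
  the weak gradient, of the face projection and of the discrete solution are three instances of
  \<open>fredholm_alternative\<close>, applied in coefficient coordinates.\<close>

section \<open>Finite-dimensional linear problems in coordinates\<close>

definition lin :: "(('i \<Rightarrow> real) \<Rightarrow> real) \<Rightarrow> bool" where
  "lin G \<longleftrightarrow> (\<forall>s y z. G (\<lambda>i. s * y i + z i) = s * G y + G z)"

lemma linD: "lin G \<Longrightarrow> G (\<lambda>i. s * y i + z i) = s * G y + G z"
  unfolding lin_def by blast

lemma lin_zero: assumes "lin G" shows "G (\<lambda>i. 0) = 0"
  using linD[OF assms, of 1 "\<lambda>i. 0" "\<lambda>i. 0"] by simp

lemma lin_diff: assumes "lin F" "lin G" shows "lin (\<lambda>y. F y - t * G y)"
  using assms unfolding lin_def by (simp add: algebra_simps)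

text \<open>Induction on the number of functionals. If the new functional \<open>ell j0\<close> is nonzero at some \<open>y0\<close> in the
  common kernel of the others, then \<open>y0\<close> spans a complement of the smaller kernel in the larger one, and
  \<open>L\<close> minus a suitable multiple of \<open>ell j0\<close> vanishes on the larger one.\<close>

lemma lin_combination_of_kernel:
  assumes "finite J" "\<And>j. j \<in> J \<Longrightarrow> lin (ell j)" "lin L"
    and "\<And>y. (\<And>j. j \<in> J \<Longrightarrow> ell j y = 0) \<Longrightarrow> L y = 0"
  shows "\<exists>x. \<forall>y. L y = (\<Sum>j\<in>J. x j * ell j y)"
  using assms
proof (induction J arbitrary: L rule: finite_induct)
  case empty
  then show ?case by simp
next
  case (insert j0 J)
  show ?case
  proof (cases "\<exists>y0. (\<forall>j\<in>J. ell j y0 = 0) \<and> ell j0 y0 \<noteq> 0")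
    case False
    have "L y = 0" if "\<And>j. j \<in> J \<Longrightarrow> ell j y = 0" for y
      by (rule insert.prems(3)) (use that False in auto)
    then obtain x where x: "\<And>y. L y = (\<Sum>j\<in>J. x j * ell j y)"
      using insert.IH[OF insert.prems(1) insert.prems(2)] by blast
    show ?thesis
      by (rule exI[of _ "x(j0 := 0)"]) (use insert.hyps x in \<open>auto intro!: sum.cong\<close>)
  next
    case True
    then obtain y0 where y0: "\<And>j. j \<in> J \<Longrightarrow> ell j y0 = 0" "ell j0 y0 \<noteq> 0" by blast
    define t where "t = L y0 / ell j0 y0"
    have "L y - t * ell j0 y = 0" if y: "\<And>j. j \<in> J \<Longrightarrow> ell j y = 0" for y
    proof -
      define s where "s = - (ell j0 y / ell j0 y0)"
      \<comment> \<open>subtracting a multiple of \<open>y0\<close> from \<open>y\<close> lands in the common kernel\<close>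
      define z where "z = (\<lambda>i. s * y0 i + y i)"
      have zj: "ell j z = s * ell j y0 + ell j y" if "j \<in> insert j0 J" for j
        unfolding z_def by (rule linD[OF insert.prems(1)[OF that]])
      have "L z = s * L y0 + L y" unfolding z_def by (rule linD[OF insert.prems(2)])
      moreover have "ell j z = 0" if "j \<in> insert j0 J" for j
        using zj[OF that] that y0 y by (auto simp: s_def)
      ultimately have "s * L y0 + L y = 0" using insert.prems(3)[of z] by simp
      then show ?thesis by (simp add: s_def t_def)
    qed
    moreover have "lin (\<lambda>y. L y - t * ell j0 y)"
      by (intro lin_diff insert.prems) simp_all
    ultimately obtain x where x: "\<And>y. L y - t * ell j0 y = (\<Sum>j\<in>J. x j * ell j y)"
      using insert.IH[OF insert.prems(1), of "\<lambda>y. L y - t * ell j0 y"] by blast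
    have "L y = (\<Sum>j\<in>insert j0 J. (x(j0 := t)) j * ell j y)" for y
    proof -
      have "(\<Sum>j\<in>J. (x(j0 := t)) j * ell j y) = (\<Sum>j\<in>J. x j * ell j y)"
        using insert.hyps by (intro sum.cong) auto
      then show ?thesis using x[of y] insert.hyps by simp
    qed
    then show ?thesis by blast
  qed
qed

lemma lin_expand:
  assumes "finite I" "lin G" "\<And>y. (\<And>i. i \<in> I \<Longrightarrow> y i = 0) \<Longrightarrow> G y = 0"
  shows "G y = (\<Sum>i\<in>I. y i * G (\<lambda>j. of_bool (j = i)))"
proof -
  have "G (\<lambda>j. y j * of_bool (j \<in> A)) = (\<Sum>i\<in>A. y i * G (\<lambda>j. of_bool (j = i)))"
    if "finite A" for A
    using that
  proof (induction A rule: finite_induct)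
    case empty
    then show ?case using lin_zero[OF assms(2)] by simp
  next
    case (insert a A)
    have "(\<lambda>j. y j * of_bool (j \<in> insert a A)) =
          (\<lambda>j. y a * of_bool (j = a) + y j * of_bool (j \<in> A))"
      using insert.hyps by auto
    then show ?case using insert linD[OF assms(2)] by simp
  qed
  from this[OF assms(1)]
  have *: "G (\<lambda>j. y j * of_bool (j \<in> I)) = (\<Sum>i\<in>I. y i * G (\<lambda>j. of_bool (j = i)))" .
  have "y = (\<lambda>j. 1 * (y j * of_bool (j \<in> I)) + y j * of_bool (j \<notin> I))" by auto
  then have "G y = 1 * G (\<lambda>j. y j * of_bool (j \<in> I)) + G (\<lambda>j. y j * of_bool (j \<notin> I))"
    using linD[OF assms(2), of 1 "\<lambda>j. y j * of_bool (j \<in> I)" "\<lambda>j. y j * of_bool (j \<notin> I)"] by simp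
  also have "G (\<lambda>j. y j * of_bool (j \<notin> I)) = 0" by (rule assms(3)) simp
  finally show ?thesis using * by simp
qed

text \<open>Existence from uniqueness. The kernel hypothesis asks for \<open>F y = 0\<close> instead of \<open>y = 0\<close>, so the
  coordinates may be redundant: \<open>B\<close> and \<open>F\<close> can be pulled back from a space along a generating family that is
  not known to be a basis, such as monomials restricted to a face.\<close>

lemma fredholm_alternative:
  fixes B :: "('i \<Rightarrow> real) \<Rightarrow> ('i \<Rightarrow> real) \<Rightarrow> real"
  assumes I: "finite I"
    and B1: "\<And>z. lin (\<lambda>y. B y z)" and B2: "\<And>y. lin (B y)" and F: "lin F"
    and loc: "\<And>y z. (\<And>i. i \<in> I \<Longrightarrow> z i = 0) \<Longrightarrow> B y z = 0"
    and ker: "\<And>y. (\<And>z. B y z = 0) \<Longrightarrow> F y = 0"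
  shows "\<exists>x. \<forall>y. B y x = F y"
proof -
  define \<delta> :: "'i \<Rightarrow> 'i \<Rightarrow> real" where "\<delta> i j = of_bool (j = i)" for i j
  have exp: "B y z = (\<Sum>i\<in>I. z i * B y (\<delta> i))" for y z
    unfolding \<delta>_def by (rule lin_expand[OF I B2]) (rule loc)
  have "F y = 0" if "\<And>i. i \<in> I \<Longrightarrow> B y (\<delta> i) = 0" for y
    by (rule ker, subst exp) (simp add: that)
  then obtain x where x: "\<And>y. F y = (\<Sum>i\<in>I. x i * B y (\<delta> i))"
    using lin_combination_of_kernel[OF I B1 F, of \<delta>] by blast
  have "B y x = F y" for y using exp[of y x] x[of y] by simp
  then show ?thesis by blast
qed

section \<open>Continuously differentiable functions\<close>

definition C1 :: "('a::euclidean_space \<Rightarrow> real) \<Rightarrow> bool" where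
  "C1 f \<longleftrightarrow> (\<forall>x. f differentiable (at x)) \<and> continuous_on UNIV (grad f)"

lemma has_derivative_grad:
  assumes "f differentiable (at x)"
  shows "(f has_derivative (\<lambda>v. v \<bullet> grad f x)) (at x)"
proof -
  have D: "(f has_derivative frechet_derivative f (at x)) (at x)"
    using assms frechet_derivative_works by blast
  then have lin: "linear (frechet_derivative f (at x))" by (rule has_derivative_linear)
  have "frechet_derivative f (at x) v = v \<bullet> grad f x" for v
  proof -
    have "frechet_derivative f (at x) v = frechet_derivative f (at x) (\<Sum>i\<in>Basis. (v \<bullet> i) *\<^sub>R i)"
      by (simp add: euclidean_representation)
    also have "\<dots> = (\<Sum>i\<in>Basis. (v \<bullet> i) * frechet_derivative f (at x) i)"
      by (simp add: linear_sum[OF lin] linear_scale[OF lin])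
    also have "\<dots> = v \<bullet> grad f x" by (simp add: grad_def inner_sum_right mult.commute)
    finally show ?thesis .
  qed
  then have "frechet_derivative f (at x) = (\<lambda>v. v \<bullet> grad f x)" by blast
  with D show ?thesis by simp
qed

lemma grad_eqI:
  assumes "(f has_derivative (\<lambda>v. v \<bullet> G)) (at x)"
  shows "grad f x = G"
  using frechet_derivative_at[OF assms, symmetric]
  using euclidean_representation[of G] by (simp add: grad_def inner_commute[of _ G])

lemma C1I:
  assumes "\<And>x. (f has_derivative (\<lambda>v. v \<bullet> G x)) (at x)" "continuous_on UNIV G"
  shows "C1 f"
proof -
  have "grad f = G" using grad_eqI[OF assms(1)] by blast
  with assms show ?thesis unfolding C1_def by (auto simp: differentiable_def)
qed

lemma C1_has_derivative: "C1 f \<Longrightarrow> (f has_derivative (\<lambda>v. v \<bullet> grad f x)) (at x)"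
  unfolding C1_def by (blast intro: has_derivative_grad)

lemma C1_continuous_grad: "C1 f \<Longrightarrow> continuous_on S (grad f)"
  unfolding C1_def using continuous_on_subset by blast

lemma C1_continuous: "C1 f \<Longrightarrow> continuous_on S f"
  by (meson C1_has_derivative continuous_at_imp_continuous_on has_derivative_continuous)

lemma C1_const: "C1 (\<lambda>x. a)"
  by (rule C1I[where G = "\<lambda>x. 0"]) auto

lemma C1_inner: "C1 (\<lambda>x. x \<bullet> a)"
  by (rule C1I[where G = "\<lambda>x. a"]) (auto intro!: derivative_eq_intros)

lemma has_derivative_grad_add:
  "C1 f \<Longrightarrow> C1 h \<Longrightarrow> ((\<lambda>x. f x + h x) has_derivative (\<lambda>v. v \<bullet> (grad f x + grad h x))) (at x)"
  by (auto intro!: derivative_eq_intros C1_has_derivative simp: inner_add_right)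

lemma C1_add: assumes "C1 f" "C1 h" shows "C1 (\<lambda>x. f x + h x)"
  by (rule C1I[OF has_derivative_grad_add[OF assms]])
    (intro continuous_intros C1_continuous_grad assms)

lemma has_derivative_grad_mult:
  "C1 f \<Longrightarrow> C1 h \<Longrightarrow>
    ((\<lambda>x. f x * h x) has_derivative (\<lambda>v. v \<bullet> (f x *\<^sub>R grad h x + h x *\<^sub>R grad f x))) (at x)"
  by (auto intro!: derivative_eq_intros C1_has_derivative simp: inner_add_right)

lemma C1_mult: assumes "C1 f" "C1 h" shows "C1 (\<lambda>x. f x * h x)"
  by (rule C1I[OF has_derivative_grad_mult[OF assms]])
    (intro continuous_intros C1_continuous_grad C1_continuous assms)

lemma grad_mult: "C1 f \<Longrightarrow> C1 h \<Longrightarrow> grad (\<lambda>x. f x * h x) x = f x *\<^sub>R grad h x + h x *\<^sub>R grad f x"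
  by (rule grad_eqI[OF has_derivative_grad_mult])

lemma grad_combination:
  assumes "C1 f" "C1 h"
  shows "grad (\<lambda>x. s * f x + h x) x = s *\<^sub>R grad f x + grad h x"
  by (rule grad_eqI)
    (auto intro!: derivative_eq_intros C1_has_derivative assms simp: inner_add_right)

lemma C1_sum: "(\<And>i. i \<in> I \<Longrightarrow> C1 (f i)) \<Longrightarrow> C1 (\<lambda>x. \<Sum>i\<in>I. f i x)"
  by (induction I rule: infinite_finite_induct) (auto intro: C1_const C1_add)

lemma C1_prod: "(\<And>i. i \<in> I \<Longrightarrow> C1 (f i)) \<Longrightarrow> C1 (\<lambda>x. \<Prod>i\<in>I. f i x)"
  by (induction I rule: infinite_finite_induct) (auto intro: C1_const C1_mult)

lemma C1_power: "C1 f \<Longrightarrow> C1 (\<lambda>x. f x ^ n)"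
  by (induction n) (auto intro: C1_const C1_mult)

section \<open>Polynomials\<close>

definition poly_fun :: "nat \<Rightarrow> (('a::euclidean_space \<Rightarrow> nat) \<Rightarrow> real) \<Rightarrow> 'a \<Rightarrow> real" where
  "poly_fun r a x = (\<Sum>\<alpha>\<in>multi_indices r. a \<alpha> * (\<Prod>i\<in>Basis. (x \<bullet> i) ^ \<alpha> i))"

lemma polys_eq_range: "polys r = range (poly_fun r)"
  unfolding polys_def poly_fun_def by auto

lemma poly_fun_in_polys: "poly_fun r a \<in> polys r"
  by (simp add: polys_eq_range)

lemma poly_fun_combination: "poly_fun r (\<lambda>\<alpha>. s * a \<alpha> + b \<alpha>) x = s * poly_fun r a x + poly_fun r b x"
  unfolding poly_fun_def by (simp add: sum.distrib sum_distrib_left algebra_simps)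

lemma poly_fun_cong: "(\<And>\<alpha>. \<alpha> \<in> multi_indices r \<Longrightarrow> a \<alpha> = b \<alpha>) \<Longrightarrow> poly_fun r a = poly_fun r b"
  unfolding poly_fun_def by (intro ext sum.cong) auto

lemma poly_fun_zero: "poly_fun r (\<lambda>\<alpha>. 0) = (\<lambda>x. 0)"
  unfolding poly_fun_def by simp

lemma polys_combination:
  assumes "p \<in> polys r" "q \<in> polys r" shows "(\<lambda>x. s * p x + q x) \<in> polys r"
proof -
  obtain a b where "p = poly_fun r a" "q = poly_fun r b" using assms by (auto simp: polys_eq_range)
  then have "(\<lambda>x. s * p x + q x) = poly_fun r (\<lambda>\<alpha>. s * a \<alpha> + b \<alpha>)"
    by (simp add: poly_fun_combination fun_eq_iff)
  then show ?thesis by (simp add: poly_fun_in_polys)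
qed

lemma polys_zero: "(\<lambda>x. 0) \<in> polys r"
  using poly_fun_in_polys[of r "\<lambda>\<alpha>. 0"] by (simp add: poly_fun_zero)

lemma finite_multi_indices: "finite (multi_indices r :: ('a::euclidean_space \<Rightarrow> nat) set)"
proof -
  have "\<alpha> i \<le> r" if "\<alpha> \<in> multi_indices r" "i \<in> Basis" for \<alpha> :: "'a \<Rightarrow> nat" and i
    using that member_le_sum[of i Basis \<alpha>] by (simp add: multi_indices_def)
  then have "(multi_indices r :: ('a \<Rightarrow> nat) set) \<subseteq>
    {\<alpha>. \<forall>i. (i \<in> Basis \<longrightarrow> \<alpha> i \<in> {..r}) \<and> (i \<notin> Basis \<longrightarrow> \<alpha> i = 0)}"
    by (auto simp: multi_indices_def)
  then show ?thesis
    by (rule finite_subset) (rule finite_set_of_finite_funs, auto)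
qed

lemma multi_indices_mono: "r \<le> s \<Longrightarrow> multi_indices r \<subseteq> multi_indices s"
  unfolding multi_indices_def by auto

lemma polys_C1: "p \<in> polys r \<Longrightarrow> C1 p"
  unfolding polys_def by (auto intro!: C1_sum C1_mult C1_const C1_prod C1_power C1_inner)

text \<open>Along every line through a point of \<open>U\<close>, the polynomial is a univariate polynomial with
  infinitely many zeros.\<close>

lemma polys_eq_0_if_0_on_open:
  assumes p: "p \<in> polys r" and U: "open U" "U \<noteq> {}" and 0: "\<And>x. x \<in> U \<Longrightarrow> p x = 0"
  shows "p = (\<lambda>x. 0)"
proof
  fix x
  obtain u where u: "u \<in> U" using U by blast
  define \<gamma> where "\<gamma> t = u + t *\<^sub>R (x - u)" for t
  obtain a where a: "p = poly_fun r a" using p by (auto simp: polys_eq_range)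
  define P where
    "P = (\<Sum>\<alpha>\<in>multi_indices r. Polynomial.smult (a \<alpha>) (\<Prod>i\<in>Basis. [:u \<bullet> i, (x - u) \<bullet> i:] ^ \<alpha> i))"
  have P: "poly P t = p (\<gamma> t)" for t
    by (simp add: P_def a poly_fun_def \<gamma>_def poly_sum poly_prod inner_add_left algebra_simps)
  have "continuous_on UNIV \<gamma>" unfolding \<gamma>_def by (intro continuous_intros)
  then have "open (\<gamma> -` U)" using U(1) by (rule open_vimage[rotated])
  moreover have "0 \<in> \<gamma> -` U" by (simp add: \<gamma>_def u)
  ultimately have "infinite (\<gamma> -` U)" using finite_imp_not_open by blast
  moreover have "\<gamma> -` U \<subseteq> {t. poly P t = 0}" using 0 P by auto
  ultimately have "P = 0" using poly_roots_finite finite_subset by blast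
  then have "p (\<gamma> 1) = 0" using P[of 1] by simp
  then show "p x = 0" by (simp add: \<gamma>_def)
qed

section \<open>Polyhedral cells and the measures on them\<close>

lemma polyhedral_cell_compact: "polyhedral_cell n S \<Longrightarrow> compact S"
  unfolding polyhedral_cell_def by (metis compact_Union polytope_imp_compact)

lemma negligible_aff_dim_less:
  fixes S :: "'a::euclidean_space set"
  assumes "aff_dim S < int DIM('a)" shows "negligible S"
proof -
  have "aff_dim (affine hull S) \<noteq> int DIM('a)" using assms by simp
  then have "negligible (affine hull S)"
    by (subst negligible_convex_interior) (auto simp: low_dim_interior affine_imp_convex)
  then show ?thesis by (rule negligible_subset) (rule hull_subset)
qed

lemma full_cell:
  fixes T :: "'a::euclidean_space set"
  assumes "polyhedral_cell (int DIM('a)) T"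
  shows "closure (interior T) = T" "interior T \<noteq> {}"
proof -
  have "affine hull T = UNIV" using assms aff_dim_eq_full by (auto simp: polyhedral_cell_def)
  then have "rel_interior T = interior T" by (rule rel_interior_interior)
  moreover have "T \<noteq> {}" using assms by (auto simp: polyhedral_cell_def)
  ultimately show "closure (interior T) = T" "interior T \<noteq> {}"
    using assms by (auto simp: polyhedral_cell_def)
qed

text \<open>A relative boundary point of a cell is a relative boundary point of one of the polytopes that
  make up the cell, or lies in one of lower dimension: a polytope of full dimension has the same affine hull
  as the cell, so its relative interior lies in that of the cell.\<close>

lemma rel_frontier_cell_cover:
  fixes e :: "'a::euclidean_space set"
  assumes "polyhedral_cell n e"
  shows "\<exists>\<A>. finite \<A> \<and> rel_frontier e \<subseteq> \<Union>\<A> \<and> (\<forall>A\<in>\<A>. affine A \<and> aff_dim A < n)"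
proof -
  obtain F where F: "finite F" "\<And>P. P \<in> F \<Longrightarrow> polytope P" "e = \<Union>F" and n: "aff_dim e = n"
    using assms by (auto simp: polyhedral_cell_def)
  have cl: "closure e = e" using polyhedral_cell_compact[OF assms] by (simp add: compact_imp_closed)
  define \<A> where "\<A> = (\<lambda>A. affine hull A) ` ({P\<in>F. aff_dim P < n} \<union> (\<Union>P\<in>F. {A. A facet_of P}))"
  have "finite \<A>"
    unfolding \<A>_def by (intro finite_imageI finite_UnI finite_UN_I finite_polytope_facets) (use F in auto)
  moreover have "affine A \<and> aff_dim A < n" if "A \<in> \<A>" for A
  proof -
    have "aff_dim P \<le> n" if "P \<in> F" for P using F(3) that n aff_dim_subset by blast
    then show ?thesis using that by (force simp: \<A>_def facet_of_def)
  qed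
  moreover have "rel_frontier e \<subseteq> \<Union>\<A>"
  proof
    fix z assume z: "z \<in> rel_frontier e"
    then obtain P where P: "P \<in> F" "z \<in> P" using F(3) cl by (auto simp: rel_frontier_def)
    show "z \<in> \<Union>\<A>"
    proof (cases "aff_dim P < n")
      case True
      then have "affine hull P \<in> \<A>" using P by (auto simp: \<A>_def)
      then show ?thesis using P hull_inc by fast
    next
      case False
      have "P \<subseteq> e" using P F(3) by blast
      moreover from this have "aff_dim P = aff_dim e" using False n aff_dim_subset[of P e] by simp
      ultimately have "affine hull P = affine hull e"
        using P(2) hull_mono[of P e affine]
        by (intro affine_dim_equal) auto
      then have "rel_interior P \<subseteq> rel_interior e" using \<open>P \<subseteq> e\<close> by (intro rel_interior_mono) auto
      then have "z \<in> rel_frontier P"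
        using z P closure_subset[of P] by (auto simp: rel_frontier_def)
      then obtain A where A: "A facet_of P" "z \<in> A"
        using F(2)[OF P(1)] by (auto simp: rel_frontier_of_polyhedron polytope_imp_polyhedron)
      then have "affine hull A \<in> \<A>" using P(1) unfolding \<A>_def by blast
      then show ?thesis using A(2) hull_inc by fast
    qed
  qed
  ultimately show ?thesis by blast
qed

abbreviation face_cell :: "'a::euclidean_space set \<Rightarrow> bool" where
  "face_cell e \<equiv> polyhedral_cell (int DIM('a) - 1) e"

lemma face_cell_facts:
  fixes e :: "'a::euclidean_space set"
  assumes "face_cell e"
  shows "compact e" "e \<noteq> {}" "closure (rel_interior e) = e"
    "convex (affine hull e)" "closed (affine hull e)" "affine hull e \<noteq> {}"
    "negligible e"
proof -
  show "compact e" using assms by (rule polyhedral_cell_compact)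
  have "aff_dim e = int DIM('a) - 1" using assms by (simp add: polyhedral_cell_def)
  then show "e \<noteq> {}" by (auto simp: polyhedral_cell_def)
  then show "affine hull e \<noteq> {}" by simp
  show "closure (rel_interior e) = e" using assms by (simp add: polyhedral_cell_def)
  show "convex (affine hull e)" "closed (affine hull e)"
    by (simp_all add: affine_imp_convex)
  show "negligible e" using \<open>aff_dim e = _\<close> by (intro negligible_aff_dim_less) simp
qed

lemma space_face_measure: "space (face_measure e) = e"
  by (simp add: face_measure_def space_restrict_space)

lemma sets_face_measure: "sets (face_measure e) = sets (restrict_space borel e)"
  unfolding face_measure_def by (intro sets_restrict_space_cong) simp

lemma face_measure_measurable:
  assumes "continuous_on e h" shows "h \<in> borel_measurable (face_measure e)"
  using borel_measurable_continuous_on_restrict[OF assms] sets_face_measure measurable_cong_sets by blast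

abbreviation slab_over :: "'a::euclidean_space set \<Rightarrow> 'a set \<Rightarrow> 'a set" where
  "slab_over e A \<equiv> {x. infdist x (affine hull e) \<le> 1/2 \<and> closest_point (affine hull e) x \<in> A}"

lemma slab_over_measurable:
  fixes e :: "'a::euclidean_space set"
  assumes e: "face_cell e" and A: "A \<in> sets borel"
  shows "slab_over e A \<in> sets borel"
proof -
  have "closest_point (affine hull e) \<in> borel_measurable borel"
    by (intro borel_measurable_continuous_onI continuous_on_closest_point face_cell_facts[OF e])
  moreover have "(\<lambda>x. infdist x (affine hull e)) \<in> borel_measurable borel"
    by (intro borel_measurable_continuous_onI continuous_intros)
  ultimately have "{x \<in> space borel. infdist x (affine hull e) \<le> 1/2 \<and> closest_point (affine hull e) x \<in> A} \<in> sets borel"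
    using A by measurable
  then show ?thesis by simp
qed

lemma emeasure_face_measure:
  fixes e :: "'a::euclidean_space set"
  assumes e: "face_cell e" and A: "A \<in> sets borel" "A \<subseteq> e"
  shows "emeasure (face_measure e) A = emeasure lborel (slab_over e A)"
proof -
  let ?H = "affine hull e"
  note E = face_cell_facts[OF e]
  have eb: "e \<in> sets borel" using E(1) by (simp add: borel_compact)
  have slab: "{x. infdist x ?H \<le> 1/2} \<in> sets lborel"
    by (simp, rule borel_closed, rule closed_Collect_le) (auto intro!: continuous_intros)
  have cp: "closest_point ?H \<in> borel_measurable borel"
    by (rule borel_measurable_continuous_onI) (rule continuous_on_closest_point[OF E(4-6)])
  have m: "closest_point ?H \<in> measurable (restrict_space lborel {x. infdist x ?H \<le> 1/2}) borel"
    by (rule measurable_restrict_space1) (use cp in simp)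
  have "emeasure (face_measure e) A = emeasure (distr (restrict_space lborel {x. infdist x ?H \<le> 1/2}) borel
          (closest_point ?H)) A"
    unfolding face_measure_def by (rule emeasure_restrict_space) (use eb A in auto)
  also have "\<dots> = emeasure (restrict_space lborel {x. infdist x ?H \<le> 1/2})
      (closest_point ?H -` A \<inter> {x. infdist x ?H \<le> 1/2})"
    by (subst emeasure_distr[OF m A(1)]) (simp add: space_restrict_space)
  also have "\<dots> = emeasure lborel (closest_point ?H -` A \<inter> {x. infdist x ?H \<le> 1/2})"
    by (rule emeasure_restrict_space) (use slab in auto)
  also have "closest_point ?H -` A \<inter> {x. infdist x ?H \<le> 1/2} = slab_over e A"
    by auto
  finally show ?thesis .
qed

lemma finite_measure_face_measure:
  fixes e :: "'a::euclidean_space set"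
  assumes e: "face_cell e"
  shows "finite_measure (face_measure e)"
proof
  let ?H = "affine hull e"
  note E = face_cell_facts[OF e]
  have eb: "e \<in> sets borel" using E(1) by (simp add: borel_compact)
  obtain R where R: "\<And>x. x \<in> e \<Longrightarrow> norm x \<le> R"
    using E(1) compact_imp_bounded bounded_iff by metis
  have "norm x \<le> R + 1/2" if "infdist x ?H \<le> 1/2" "closest_point ?H x \<in> e" for x
  proof -
    have "dist x (closest_point ?H x) \<le> 1/2"
      using that E by (simp add: infdist_eq_setdist setdist_closest_point[symmetric])
    moreover have "norm x \<le> norm (closest_point ?H x) + dist x (closest_point ?H x)"
      by (simp add: dist_norm norm_triangle_sub)
    ultimately show ?thesis using R[OF that(2)] by simp
  qed
  then have "slab_over e e \<subseteq> cball 0 (R + 1/2)"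
    by (auto simp: dist_norm)
  then have "emeasure lborel (slab_over e e)
      \<le> emeasure lborel (cball 0 (R + 1/2) :: 'a set)"
    by (rule emeasure_mono) simp
  also have "\<dots> < \<infinity>" by (rule emeasure_lborel_cball_finite)
  finally show "emeasure (face_measure e) (space (face_measure e)) \<noteq> \<infinity>"
    using emeasure_face_measure[OF e eb] by (simp add: space_face_measure)
qed

lemma face_measure_integrable:
  fixes h :: "'a::euclidean_space \<Rightarrow> real"
  assumes e: "face_cell e" and h: "continuous_on e h"
  shows "integrable (face_measure e) h"
proof -
  interpret finite_measure "face_measure e" by (rule finite_measure_face_measure[OF e])
  obtain B where "\<And>x. x \<in> e \<Longrightarrow> \<bar>h x\<bar> \<le> B"
    using compact_continuous_image[OF h face_cell_facts(1)[OF e]] compact_imp_bounded bounded_real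
    by (metis image_eqI)
  then show ?thesis
    by (intro integrable_const_bound[where B = B] face_measure_measurable h) (auto simp: space_face_measure)
qed

text \<open>A small ball around a point of the relative interior projects into any given relative
  neighbourhood of that point, so relatively open sets have positive surface measure.\<close>

lemma face_measure_AE_continuous_eq:
  fixes h :: "'a::euclidean_space \<Rightarrow> real"
  assumes e: "face_cell e" and h: "continuous_on e h" and ae: "AE x in face_measure e. h x = 0"
    and x: "x \<in> e"
  shows "h x = 0"
proof -
  let ?H = "affine hull e"
  note E = face_cell_facts[OF e]
  have eb: "e \<in> sets borel" using E(1) by (simp add: borel_compact)
  have "h z = 0" if z: "z \<in> rel_interior e" for z
  proof (rule ccontr)
    assume nz: "h z \<noteq> 0"
    have ze: "z \<in> e" using z rel_interior_subset by blast
    obtain d1 where d1: "d1 > 0" "\<And>y. y \<in> ball z d1 \<Longrightarrow> y \<in> ?H \<Longrightarrow> y \<in> e"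
      using z by (auto simp: mem_rel_interior_ball subset_eq)
    obtain d2 where d2: "d2 > 0" "\<And>y. y \<in> e \<Longrightarrow> dist y z < d2 \<Longrightarrow> dist (h y) (h z) < \<bar>h z\<bar>"
      using h ze nz unfolding continuous_on_iff by (metis zero_less_abs_iff)
    define \<delta> where "\<delta> = min (min d1 d2) (1/2)"
    have \<delta>: "\<delta> > 0" using d1 d2 by (simp add: \<delta>_def)
    define A where "A = {x\<in>e. h x \<noteq> 0}"
    have "A = {x \<in> space (face_measure e). h x \<noteq> 0}" by (simp add: A_def space_face_measure)
    moreover have "{x \<in> space (face_measure e). h x \<noteq> 0} \<in> sets (face_measure e)"
      using face_measure_measurable[OF h] by measurable
    ultimately have Af: "A \<in> sets (face_measure e)" by simp
    then have A0: "emeasure (face_measure e) A = 0"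
      using ae AE_iff_measurable[OF Af, of "\<lambda>x. h x = 0"] by (simp add: A_def space_face_measure)
    have Ab: "A \<in> sets borel" "A \<subseteq> e"
      using Af eb by (auto simp: sets_face_measure sets_restrict_space A_def)
    have "ball z \<delta> \<subseteq> slab_over e A"
    proof clarify
      fix y assume y: "y \<in> ball z \<delta>"
      have zH: "z \<in> ?H" using ze hull_inc by fast
      let ?y = "closest_point ?H y"
      have "infdist y ?H \<le> dist y z" by (rule infdist_le[OF zH])
      moreover have "dist ?y z \<le> dist y z"
        using closest_point_lipschitz[OF E(4-6), of y z] closest_point_self[OF zH] by simp
      moreover have "?y \<in> ?H" using closest_point_in_set[OF E(5,6)] .
      moreover have "dist y z < \<delta>" using y by (simp add: dist_commute)
      ultimately have "?y \<in> e" "dist ?y z < d2" "infdist y ?H \<le> 1/2"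
        using d1(2)[of ?y] by (auto simp: \<delta>_def dist_commute)
      moreover from this have "h ?y \<noteq> 0" using d2(2)[of ?y] by (auto simp: dist_real_def)
      ultimately show "infdist y ?H \<le> 1/2 \<and> ?y \<in> A" by (simp add: A_def)
    qed
    moreover have "slab_over e A \<in> sets lborel" using slab_over_measurable[OF e Ab(1)] by simp
    ultimately have "emeasure lborel (ball z \<delta>) \<le>
        emeasure lborel (slab_over e A)"
      by (rule emeasure_mono)
    then have "emeasure lborel (ball z \<delta>) = 0"
      using A0 emeasure_face_measure[OF e Ab] by simp
    then have "negligible (ball z \<delta>)"
      by (simp add: negligible_iff_emeasure0 emeasure_completion)
    then show False using open_not_negligible[of "ball z \<delta>"] \<delta> by auto
  qed
  then show ?thesis
    by (intro continuous_constant_on_closure[of "rel_interior e" h 0 x]) (use h x in \<open>simp_all add: E(3)\<close>)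
qed

text \<open>The preimage of a set of codimension two under the orthogonal projection onto the hyperplane of
  \<open>e\<close> is contained in a hyperplane.\<close>

lemma face_measure_codim_2:
  fixes e :: "'a::euclidean_space set"
  assumes e: "face_cell e" and A: "affine A" "aff_dim A < int DIM('a) - 1"
  shows "AE x in face_measure e. x \<notin> A"
proof -
  let ?H = "affine hull e"
  note E = face_cell_facts[OF e]
  have eb: "e \<in> sets borel" using E(1) by (simp add: borel_compact)
  have "closed A" using A(1) affine_closed by blast
  then have b: "A \<inter> e \<in> sets borel" using eb by auto
  have "aff_dim e = int DIM('a) - 1" using e by (simp add: polyhedral_cell_def)
  then obtain n c where n: "n \<noteq> 0" and H: "?H = {x. n \<bullet> x = c}"
    using aff_dim_eq_hyperplane[of e] by auto
  have proj: "closest_point ?H x = x - ((n \<bullet> x - c) / (n \<bullet> n)) *\<^sub>R n" (is "_ = ?p") for x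
  proof (rule closest_point_unique[symmetric, OF E(4,5)])
    show p: "?p \<in> ?H" using n by (simp add: H inner_diff_right)
    show "\<forall>z\<in>?H. dist x ?p \<le> dist x z"
    proof
      fix z assume z: "z \<in> ?H"
      have "\<bar>n \<bullet> x - c\<bar> = \<bar>n \<bullet> (x - z)\<bar>" using z by (simp add: H inner_diff_right)
      also have "\<dots> \<le> norm n * norm (x - z)" by (rule Cauchy_Schwarz_ineq2)
      finally have "\<bar>n \<bullet> x - c\<bar> / norm n \<le> norm (x - z)" using n by (simp add: divide_le_eq mult.commute)
      moreover have "norm (x - ?p) = \<bar>n \<bullet> x - c\<bar> / norm n"
        using n by (simp add: dot_square_norm power2_eq_square)
      ultimately show "dist x ?p \<le> dist x z" by (simp add: dist_norm)
    qed
  qed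
  have "negligible (slab_over e (A \<inter> e))"
  proof (cases "A = {}")
    case False
    then obtain a where a: "a \<in> A" by blast
    have "x \<in> affine hull (insert (a + n) A)" if "closest_point ?H x \<in> A" for x
    proof -
      define t where "t = (n \<bullet> x - c) / (n \<bullet> n)"
      have "x = 1 *\<^sub>R closest_point ?H x + t *\<^sub>R (a + n) + (- t) *\<^sub>R a"
        unfolding proj t_def by (simp add: algebra_simps)
      moreover have "1 *\<^sub>R closest_point ?H x + t *\<^sub>R (a + n) + (- t) *\<^sub>R a \<in> affine hull (insert (a + n) A)"
        by (rule mem_affine_3[OF affine_affine_hull]) (use that a in \<open>auto intro: hull_inc\<close>)
      ultimately show ?thesis by simp
    qed
    then have sub: "slab_over e (A \<inter> e) \<subseteq> affine hull (insert (a + n) A)"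
      by auto
    have "aff_dim (affine hull (insert (a + n) A)) < int DIM('a)"
      using A(2) by (simp add: aff_dim_insert)
    then show ?thesis using sub negligible_aff_dim_less negligible_subset by blast
  qed simp
  then have z: "slab_over e (A \<inter> e) \<in> null_sets lebesgue"
    by (simp add: negligible_iff_null_sets)
  have "slab_over e (A \<inter> e) \<in> sets lborel" using slab_over_measurable[OF e b] by simp
  then have "emeasure (face_measure e) (A \<inter> e) = 0"
    using z emeasure_face_measure[OF e b] by (simp only: null_sets_completion_iff null_setsD1 Int_lower2)
  moreover have "A \<inter> e \<in> sets (face_measure e)"
    using b by (auto simp: sets_face_measure sets_restrict_space)
  ultimately have "A \<inter> e \<in> null_sets (face_measure e)" by blast
  then show ?thesis by (rule AE_I') (auto simp: space_face_measure)
qed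

section \<open>Integration over elements\<close>

lemma ip_commute: "ip M f g = ip M g f"
  unfolding ip_def by (simp add: mult.commute)

lemma ip_combination:
  assumes "integrable M (\<lambda>x. f x * h x)" "integrable M (\<lambda>x. g x * h x)"
    and "\<And>x. x \<in> space M \<Longrightarrow> t x = s * f x + g x"
  shows "ip M t h = s * ip M f h + ip M g h"
proof -
  have "ip M t h = (\<integral>x. s * (f x * h x) + g x * h x \<partial>M)"
    unfolding ip_def by (intro Bochner_Integration.integral_cong) (auto simp: assms(3) algebra_simps)
  also have "\<dots> = s * ip M f h + ip M g h"
    using assms(1,2) by (simp add: ip_def)
  finally show ?thesis .
qed

lemma integrable_mult_bounded:
  fixes f g :: "'a \<Rightarrow> real"
  assumes "integrable M f" "g \<in> borel_measurable M" "AE x in M. \<bar>g x\<bar> \<le> B"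
  shows "integrable M (\<lambda>x. f x * g x)"
proof (rule Bochner_Integration.integrable_bound)
  show "integrable M (\<lambda>x. B * f x)" using assms(1) by simp
  show "AE x in M. norm (f x * g x) \<le> norm (B * f x)"
    using assms(3)
  proof eventually_elim
    case (elim x)
    then have "\<bar>g x\<bar> \<le> \<bar>B\<bar>" by linarith
    then show ?case by (simp add: abs_mult mult.commute[of "\<bar>f x\<bar>"] mult_right_mono)
  qed
qed (use assms in measurable)

lemma L2_integrable:
  assumes "finite_measure M" "f \<in> L2 M" shows "integrable M f"
proof (rule Bochner_Integration.integrable_bound)
  interpret finite_measure M by fact
  show "integrable M (\<lambda>x. 1 + (f x)\<^sup>2)" using assms(2) by (simp add: L2_def)
  have "\<bar>y\<bar> \<le> 1 + y\<^sup>2" for y :: real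
    using zero_le_power2[of "\<bar>y\<bar> - 1"] by (simp add: power2_diff)
  then show "AE x in M. norm (f x) \<le> norm (1 + (f x)\<^sup>2)" by simp
qed (use assms in \<open>simp add: L2_def\<close>)

lemma L2_mult_integrable:
  assumes "f \<in> L2 M" "g \<in> L2 M" shows "integrable M (\<lambda>x. f x * g x)"
proof (rule Bochner_Integration.integrable_bound)
  show "integrable M (\<lambda>x. (f x)\<^sup>2 + (g x)\<^sup>2)" using assms by (simp add: L2_def)
  have "\<bar>y * z\<bar> \<le> y\<^sup>2 + z\<^sup>2" for y z :: real
  proof -
    have "2 * \<bar>y * z\<bar> \<le> y\<^sup>2 + z\<^sup>2"
      using sum_squares_bound[of "\<bar>y\<bar>" "\<bar>z\<bar>"] by (simp add: abs_mult)
    then show ?thesis by simp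
  qed
  then show "AE x in M. norm (f x * g x) \<le> norm ((f x)\<^sup>2 + (g x)\<^sup>2)" by simp
qed (use assms in \<open>auto simp: L2_def\<close>)

lemma L2_add:
  assumes "f \<in> L2 M" "g \<in> L2 M" shows "(\<lambda>x. f x + g x) \<in> L2 M"
proof -
  have "integrable M (\<lambda>x. (f x)\<^sup>2 + 2 * (f x * g x) + (g x)\<^sup>2)"
    using assms L2_mult_integrable[OF assms] by (simp add: L2_def)
  then have "integrable M (\<lambda>x. (f x + g x)\<^sup>2)" by (simp add: power2_sum algebra_simps)
  moreover have "(\<lambda>x. f x + g x) \<in> borel_measurable M"
    using assms by (intro borel_measurable_add) (simp_all add: L2_def)
  ultimately show ?thesis by (simp add: L2_def)
qed

lemma Linf_L2:
  fixes f :: "'a \<Rightarrow> real"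
  assumes "finite_measure M" "f \<in> Linf M" shows "f \<in> L2 M"
proof -
  interpret finite_measure M by fact
  obtain C where C: "AE x in M. norm (f x) \<le> C" and m: "f \<in> borel_measurable M"
    using assms(2) by (auto simp: Linf_def)
  have "AE x in M. norm ((f x)\<^sup>2) \<le> C\<^sup>2"
    using C by eventually_elim (simp add: abs_le_square_iff[symmetric])
  then have "integrable M (\<lambda>x. (f x)\<^sup>2)"
    using m by (intro integrable_const_bound) auto
  then show ?thesis using m by (simp add: L2_def)
qed

lemma measurable_lebesgue_on_AE:
  fixes f g :: "'a::euclidean_space \<Rightarrow> 'b::euclidean_space"
  assumes S: "S \<in> sets lebesgue" and "f \<in> borel_measurable (lebesgue_on S)"
    and "AE x in lebesgue_on S. f x = g x"
  shows "g \<in> borel_measurable (lebesgue_on S)"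
proof -
  have "(\<lambda>x. if x \<in> S then f x else 0) \<in> borel_measurable lebesgue"
    using assms(2) S by (simp add: borel_measurable_if)
  moreover have "AE x in lebesgue. (if x \<in> S then f x else 0) = (if x \<in> S then g x else 0)"
    using assms(3) S by (auto simp: AE_restrict_space_iff)
  ultimately have "(\<lambda>x. if x \<in> S then g x else 0) \<in> borel_measurable lebesgue"
    by (rule borel_measurable_AE)
  then show ?thesis using S by (simp add: borel_measurable_if)
qed

text \<open>On an element the data \<open>\<beta>\<close> and \<open>c\<close> are smooth up to the boundary only after a modification on
  the boundary, a null set. All integrands of the scheme are therefore of the following kind.\<close>

definition ae_continuous ::
    "'a::euclidean_space set \<Rightarrow> ('a \<Rightarrow> 'b::euclidean_space) \<Rightarrow> bool" where
  "ae_continuous T f \<longleftrightarrow> (\<exists>F. continuous_on T F \<and> (AE x in lebesgue_on T. F x = f x))"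

lemma ae_continuousI: "continuous_on T f \<Longrightarrow> ae_continuous T f"
  unfolding ae_continuous_def by auto

lemma ae_continuous_binary:
  assumes "ae_continuous T f" "ae_continuous T g"
    and "\<And>F G. continuous_on T F \<Longrightarrow> continuous_on T G \<Longrightarrow> continuous_on T (\<lambda>x. h (F x) (G x))"
  shows "ae_continuous T (\<lambda>x. h (f x) (g x))"
proof -
  obtain F G where "continuous_on T F" "AE x in lebesgue_on T. F x = f x"
    "continuous_on T G" "AE x in lebesgue_on T. G x = g x"
    using assms(1,2) by (auto simp: ae_continuous_def)
  then show ?thesis unfolding ae_continuous_def
    by (intro exI[of _ "\<lambda>x. h (F x) (G x)"] conjI assms(3)) auto
qed

lemma ae_continuous_mult:
  fixes f g :: "'a::euclidean_space \<Rightarrow> real"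
  shows "ae_continuous T f \<Longrightarrow> ae_continuous T g \<Longrightarrow> ae_continuous T (\<lambda>x. f x * g x)"
  by (rule ae_continuous_binary) (auto intro: continuous_on_mult)

lemma ae_continuous_diff:
  "ae_continuous T f \<Longrightarrow> ae_continuous T g \<Longrightarrow> ae_continuous T (\<lambda>x. f x - g x)"
  by (rule ae_continuous_binary) (auto intro: continuous_on_diff)

lemma ae_continuous_inner:
  "ae_continuous T f \<Longrightarrow> ae_continuous T g \<Longrightarrow> ae_continuous T (\<lambda>x. f x \<bullet> g x)"
  by (rule ae_continuous_binary) (auto intro: continuous_on_inner)

lemma ae_continuous_measurable:
  assumes "compact T" "ae_continuous T f" shows "f \<in> borel_measurable (lebesgue_on T)"
proof -
  obtain F where "continuous_on T F" "AE x in lebesgue_on T. F x = f x"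
    using assms(2) by (auto simp: ae_continuous_def)
  moreover have "T \<in> sets lebesgue" using assms(1) lmeasurable_compact by blast
  ultimately show ?thesis
    using measurable_lebesgue_on_AE continuous_imp_measurable_on_sets_lebesgue by blast
qed

lemma ae_continuous_AE_bounded:
  assumes "compact T" "ae_continuous T f" shows "\<exists>B. AE x in lebesgue_on T. norm (f x) \<le> B"
proof -
  obtain F where F: "continuous_on T F" "AE x in lebesgue_on T. F x = f x"
    using assms(2) by (auto simp: ae_continuous_def)
  obtain B where B: "\<And>x. x \<in> T \<Longrightarrow> norm (F x) \<le> B"
    using compact_imp_bounded[OF compact_continuous_image[OF F(1) assms(1)]]
    by (auto simp: bounded_iff)
  have "AE x in lebesgue_on T. norm (f x) \<le> B"
    using F(2) AE_space by eventually_elim (use B in \<open>metis space_lebesgue_on\<close>)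
  then show ?thesis by blast
qed

lemma ae_continuous_integrable:
  assumes T: "compact T" and f: "ae_continuous T f" shows "integrable (lebesgue_on T) f"
proof -
  interpret finite_measure "lebesgue_on T"
    using T by (intro finite_measure_lebesgue_on lmeasurable_compact)
  show ?thesis using ae_continuous_AE_bounded[OF T f] ae_continuous_measurable[OF T f]
    by (blast intro: integrable_const_bound)
qed

lemma integrable_mult_ae_continuous:
  fixes f h :: "'a::euclidean_space \<Rightarrow> real"
  assumes T: "compact T" and f: "integrable (lebesgue_on T) f" and h: "ae_continuous T h"
  shows "integrable (lebesgue_on T) (\<lambda>x. f x * h x)"
  using ae_continuous_AE_bounded[OF T h] ae_continuous_measurable[OF T h]
  by (auto intro: integrable_mult_bounded[OF f])

lemma ae_continuous_sq_zero:
  assumes T: "compact T" and f: "ae_continuous T f" and 0: "ip (lebesgue_on T) f f = 0"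
  shows "AE x in lebesgue_on T. f x = 0"
proof -
  have i: "integrable (lebesgue_on T) (\<lambda>x. f x * f x)"
    by (intro ae_continuous_integrable[OF T] ae_continuous_mult f)
  have "AE x in lebesgue_on T. f x * f x = 0"
    using 0 integral_nonneg_eq_0_iff_AE[OF i] by (simp add: ip_def)
  then show ?thesis by simp
qed

lemma AE_lebesgue_on_interior:
  assumes "closed T" "negligible (frontier T)"
  shows "AE x in lebesgue_on T. x \<in> interior T"
proof -
  have "AE x in lebesgue. x \<notin> frontier T"
    using assms(2) by (simp add: negligible_iff_null_sets AE_not_in)
  then show ?thesis
    using assms(1) by (subst AE_restrict_space_iff) (auto simp: frontier_def lebesgue_closedin)
qed

lemma AE_continuous_eq_interior:
  fixes f :: "'a::euclidean_space \<Rightarrow> 'b::real_normed_vector"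
  assumes T: "closed T" and f: "continuous_on (interior T) f" and ae: "AE x in lebesgue_on T. f x = 0"
    and x: "x \<in> interior T"
  shows "f x = 0"
proof (rule ccontr)
  assume nz: "f x \<noteq> 0"
  define U where "U = {y\<in>interior T. f y \<noteq> 0}"
  have "open U"
    using continuous_open_preimage[OF f open_interior, of "- {0}"]
    by (simp add: U_def vimage_def Int_def open_Compl)
  moreover have "x \<in> U" using x nz by (simp add: U_def)
  moreover have "negligible U"
  proof -
    have "T \<in> sets lebesgue" using T lebesgue_closedin by auto
    then have "AE y in lebesgue. y \<in> T \<longrightarrow> f y = 0" using ae by (simp add: AE_restrict_space_iff)
    then have "AE y in lebesgue. y \<notin> U"
      by eventually_elim (use interior_subset[of T] in \<open>auto simp: U_def\<close>)
    moreover have "U \<in> sets lebesgue" using \<open>open U\<close> by auto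
    ultimately show ?thesis
      by (simp add: negligible_iff_null_sets AE_iff_null_sets)
  qed
  ultimately show False using open_not_negligible by blast
qed

section \<open>Vector polynomials\<close>

definition vec_poly_fun ::
    "nat \<Rightarrow> ('a::euclidean_space \<times> ('a \<Rightarrow> nat) \<Rightarrow> real) \<Rightarrow> 'a \<Rightarrow> 'a" where
  "vec_poly_fun r a x = (\<Sum>i\<in>Basis. poly_fun r (\<lambda>\<alpha>. a (i, \<alpha>)) x *\<^sub>R i)"

lemma vec_poly_fun_inner:
  "i \<in> Basis \<Longrightarrow> vec_poly_fun r a x \<bullet> i = poly_fun r (\<lambda>\<alpha>. a (i, \<alpha>)) x"
  unfolding vec_poly_fun_def by simp

lemma vec_polys_eq_range: "vec_polys r = range (vec_poly_fun r)"
proof (intro equalityI subsetI)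
  fix \<psi> :: "'a \<Rightarrow> 'a" assume "\<psi> \<in> vec_polys r"
  then have "\<forall>i\<in>Basis. \<exists>a. (\<lambda>x. \<psi> x \<bullet> i) = poly_fun r a"
    by (auto simp: vec_polys_def polys_eq_range)
  then obtain a where a: "\<And>i x. i \<in> Basis \<Longrightarrow> \<psi> x \<bullet> i = poly_fun r (a i) x" by metis
  have "\<psi> = vec_poly_fun r (\<lambda>(i, \<alpha>). a i \<alpha>)"
    by (rule ext, rule euclidean_eqI) (simp add: vec_poly_fun_inner a)
  then show "\<psi> \<in> range (vec_poly_fun r)" by blast
next
  fix \<psi> :: "'a \<Rightarrow> 'a" assume "\<psi> \<in> range (vec_poly_fun r)"
  then show "\<psi> \<in> vec_polys r"
    by (auto simp: vec_polys_def vec_poly_fun_inner poly_fun_in_polys)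
qed

lemma vec_poly_fun_combination:
  "vec_poly_fun r (\<lambda>i. s * a i + b i) x = s *\<^sub>R vec_poly_fun r a x + vec_poly_fun r b x"
  by (rule euclidean_eqI) (simp add: vec_poly_fun_inner poly_fun_combination inner_add_left)

lemma vec_polys_component: "\<psi> \<in> vec_polys r \<Longrightarrow> i \<in> Basis \<Longrightarrow> (\<lambda>x. \<psi> x \<bullet> i) \<in> polys r"
  by (simp add: vec_polys_def)

lemma vec_polys_combination:
  assumes "\<phi> \<in> vec_polys r" "\<psi> \<in> vec_polys r" shows "(\<lambda>x. s *\<^sub>R \<phi> x + \<psi> x) \<in> vec_polys r"
  using assms unfolding vec_polys_def by (auto simp: inner_add_left intro: polys_combination)

lemma vec_polys_continuous: "\<psi> \<in> vec_polys r \<Longrightarrow> continuous_on S \<psi>"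
  by (subst continuous_on_componentwise) (auto intro: C1_continuous polys_C1 vec_polys_component)

lemma divergence_eq_grad:
  assumes "\<psi> \<in> vec_polys r"
  shows "divergence \<psi> x = (\<Sum>i\<in>Basis. grad (\<lambda>y. \<psi> y \<bullet> i) x \<bullet> i)"
proof -
  have "((\<lambda>y. \<Sum>i\<in>Basis. (\<psi> y \<bullet> i) *\<^sub>R i) has_derivative
      (\<lambda>v. \<Sum>i\<in>Basis. (v \<bullet> grad (\<lambda>y. \<psi> y \<bullet> i) x) *\<^sub>R i)) (at x)"
    using assms
    by (intro has_derivative_sum has_derivative_scaleR_left C1_has_derivative polys_C1[of _ r] vec_polys_component)
  then have "(\<psi> has_derivative (\<lambda>v. \<Sum>i\<in>Basis. (v \<bullet> grad (\<lambda>y. \<psi> y \<bullet> i) x) *\<^sub>R i)) (at x)"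
    by (simp add: euclidean_representation)
  from frechet_derivative_at[OF this, symmetric]
  show ?thesis by (simp add: divergence_def inner_commute[of "grad f x" for f])
qed

lemma divergence_continuous:
  assumes "\<psi> \<in> vec_polys r" shows "continuous_on S (divergence \<psi>)"
proof -
  have "divergence \<psi> = (\<lambda>x. \<Sum>i\<in>Basis. grad (\<lambda>y. \<psi> y \<bullet> i) x \<bullet> i)"
    using divergence_eq_grad[OF assms] by blast
  then show ?thesis
    using assms by (auto intro!: continuous_intros C1_continuous_grad polys_C1 vec_polys_component)
qed

lemma divergence_combination:
  assumes "\<phi> \<in> vec_polys r" "\<psi> \<in> vec_polys r"
  shows "divergence (\<lambda>x. s *\<^sub>R \<phi> x + \<psi> x) x = s * divergence \<phi> x + divergence \<psi> x"
proof -
  have "grad (\<lambda>y. (s *\<^sub>R \<phi> y + \<psi> y) \<bullet> i) x = s *\<^sub>R grad (\<lambda>y. \<phi> y \<bullet> i) x + grad (\<lambda>y. \<psi> y \<bullet> i) x"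
    if "i \<in> Basis" for i
    using grad_combination[of "\<lambda>y. \<phi> y \<bullet> i" "\<lambda>y. \<psi> y \<bullet> i"] assms that polys_C1 vec_polys_component
    by (simp add: inner_add_left) blast
  then show ?thesis
    using divergence_eq_grad[OF vec_polys_combination[OF assms, of s]] assms
    by (simp add: divergence_eq_grad inner_add_left sum.distrib sum_distrib_left)
qed

lemma face_polys_continuous: assumes "q \<in> face_polys r e" shows "continuous_on e q"
proof -
  obtain p where p: "p \<in> polys r" "q = restrict p e" using assms by (auto simp: face_polys_def)
  then show ?thesis using continuous_on_eq[OF C1_continuous[OF polys_C1[OF p(1)]], of e q] by simp
qed

section \<open>Well-posedness of the weak gradient and the forms of the scheme\<close>

locale wg_mesh =
  fixes \<Omega> :: "'a::euclidean_space set" and \<T> \<E> :: "'a set set"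
    and \<beta> :: "'a \<Rightarrow> 'a" and c :: "'a \<Rightarrow> real" and k :: nat
  assumes open_domain: "open \<Omega>" and bounded_domain: "bounded \<Omega>"
    and lipschitz: "lipschitz_boundary \<Omega>"
    and mesh: "polyhedral_mesh \<Omega> \<T> \<E>"
    and smooth_\<beta>: "piecewise_smooth \<T> \<beta>" and smooth_c: "piecewise_smooth \<T> c"
    and bounded_\<beta>: "\<beta> \<in> Linf (lebesgue_on \<Omega>)" and bounded_c: "c \<in> Linf (lebesgue_on \<Omega>)"
begin

lemma finite_mesh: "finite \<T>" "finite \<E>"
  using mesh by (auto simp: polyhedral_mesh_def)

lemma face: "e \<in> \<E> \<Longrightarrow> face_cell e"
  using mesh by (auto simp: polyhedral_mesh_def)

lemma faces_of_mesh: "e \<in> faces_of \<E> T \<Longrightarrow> e \<in> \<E>"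
  by (simp add: faces_of_def)

lemma face_of_element: "e \<in> \<E> \<Longrightarrow> \<exists>T\<in>\<T>. e \<in> faces_of \<E> T"
proof -
  assume e: "e \<in> \<E>"
  have "\<forall>e\<in>\<E>. face_cell e \<and> (\<exists>T\<in>\<T>. e \<subseteq> frontier T)"
    using mesh unfolding polyhedral_mesh_def by (elim conjE)
  then show ?thesis using e by (auto simp: faces_of_def)
qed

lemma element:
  assumes "T \<in> \<T>"
  shows "compact T" "closed T" "closure (interior T) = T" "interior T \<noteq> {}"
    "frontier T = \<Union>(faces_of \<E> T)" "negligible (frontier T)" "T \<in> sets lebesgue" "diameter T > 0"
proof -
  have T: "polyhedral_cell (int DIM('a)) T" using mesh assms by (auto simp: polyhedral_mesh_def)
  show c: "compact T" using T by (rule polyhedral_cell_compact)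
  then show "closed T" "T \<in> sets lebesgue" using compact_imp_closed lmeasurable_compact by blast+
  show "closure (interior T) = T" and i: "interior T \<noteq> {}" using full_cell[OF T] by auto
  show f: "frontier T = \<Union>(faces_of \<E> T)" using mesh assms by (auto simp: polyhedral_mesh_def)
  show "negligible (frontier T)"
    unfolding f
  proof (rule negligible_Union)
    show "finite (faces_of \<E> T)" using finite_mesh by (simp add: faces_of_def)
    show "negligible e" if "e \<in> faces_of \<E> T" for e
      by (rule face_cell_facts(7)[OF face[OF faces_of_mesh[OF that]]])
  qed
  obtain x where "x \<in> interior T" using i by blast
  then obtain r where r: "r > 0" "cball x r \<subseteq> T" using mem_interior_cball by blast
  have "r \<le> diameter (cball x r)" using r by simp
  also have "\<dots> \<le> diameter T" by (rule diameter_subset[OF r(2) compact_imp_bounded[OF c]])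
  finally show "diameter T > 0" using r by simp
qed

lemma elements_cover: "\<Union>\<T> = closure \<Omega>"
  using mesh by (auto simp: polyhedral_mesh_def)

lemma piecewise_smooth_ae_continuous:
  fixes b :: "'a \<Rightarrow> 'b::euclidean_space"
  assumes "piecewise_smooth \<T> b" "T \<in> \<T>" shows "ae_continuous T b"
proof -
  obtain U B where B: "T \<subseteq> U" "\<And>n. Ck_on n B U" "\<And>x. x \<in> interior T \<Longrightarrow> b x = B x"
    using bspec[OF assms(1)[unfolded piecewise_smooth_def] assms(2)] by (elim exE conjE) (rule that, auto)
  have "continuous_on T B" using B(1) B(2)[of 0] continuous_on_subset by auto
  moreover have "AE x in lebesgue_on T. B x = b x"
    using AE_lebesgue_on_interior[OF element(2,6)[OF assms(2)]]
    by eventually_elim (simp add: B(3))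
  ultimately show ?thesis unfolding ae_continuous_def by blast
qed

lemma conv_op_ae_continuous:
  assumes "T \<in> \<T>" "p \<in> polys r" shows "ae_continuous T (conv_op \<beta> c p)"
  unfolding conv_op_def
  by (rule ae_continuous_diff[OF
        ae_continuous_inner[OF piecewise_smooth_ae_continuous[OF smooth_\<beta> assms(1)]
          ae_continuousI[OF C1_continuous_grad[OF polys_C1[OF assms(2)]]]]
        ae_continuous_mult[OF piecewise_smooth_ae_continuous[OF smooth_c assms(1)]
          ae_continuousI[OF C1_continuous[OF polys_C1[OF assms(2)]]]]])

text \<open>The elements only cover the closure of \<open>\<Omega>\<close>. A Lipschitz boundary has no slits: next to each boundary
  point there are open sets below the graph, outside the closure of \<open>\<Omega>\<close>, so boundary points are
  not interior to elements.\<close>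

lemma interior_element_subset:
  assumes "T \<in> \<T>" shows "interior T \<subseteq> \<Omega>"
proof
  fix x assume x: "x \<in> interior T"
  show "x \<in> \<Omega>"
  proof (rule ccontr)
    assume nx: "x \<notin> \<Omega>"
    have "x \<in> closure \<Omega>" using x interior_subset elements_cover assms by blast
    with nx have "x \<in> frontier \<Omega>" using open_domain by (simp add: frontier_def interior_open)
    then obtain r \<nu> L \<phi> where r: "r > 0" and \<nu>: "norm \<nu> = 1"
      and L: "L-lipschitz_on {z. z \<bullet> \<nu> = 0} \<phi>"
      and gr: "\<And>y. y \<in> ball x r \<Longrightarrow> y \<in> \<Omega> \<longleftrightarrow> \<phi> (y - (y \<bullet> \<nu>) *\<^sub>R \<nu>) < y \<bullet> \<nu>"
      using lipschitz unfolding lipschitz_boundary_def by metis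
    have \<nu>\<nu>: "\<nu> \<bullet> \<nu> = 1" using \<nu> by (simp add: norm_eq_1)
    define \<psi> where "\<psi> y = \<phi> (y - (y \<bullet> \<nu>) *\<^sub>R \<nu>) - y \<bullet> \<nu>" for y
    have cont: "continuous_on UNIV \<psi>"
      unfolding \<psi>_def
      by (intro continuous_intros continuous_on_compose2[OF lipschitz_on_continuous_on[OF L]])
        (auto simp: inner_diff_left \<nu>\<nu>)
    \<comment> \<open>moving from \<open>x\<close> in direction \<open>- \<nu>\<close> leads strictly below the graph\<close>
    obtain d where d: "d > 0" "ball x d \<subseteq> interior T"
      using x open_interior open_contains_ball by metis
    define t where "t = min r d / 2"
    have t: "t > 0" "t < r" "t < d" using r d by (auto simp: t_def)
    define y where "y = x - t *\<^sub>R \<nu>"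
    define V where "V = ball x r \<inter> interior T \<inter> {y. \<psi> y > 0}"
    have "open V" unfolding V_def by (intro open_Int open_ball open_interior open_Collect_less cont) auto
    have "y - (y \<bullet> \<nu>) *\<^sub>R \<nu> = x - (x \<bullet> \<nu>) *\<^sub>R \<nu>" "y \<bullet> \<nu> = x \<bullet> \<nu> - t"
      by (simp_all add: y_def inner_diff_left \<nu>\<nu> algebra_simps)
    moreover have "\<not> \<phi> (x - (x \<bullet> \<nu>) *\<^sub>R \<nu>) < x \<bullet> \<nu>" using gr[of x] nx r by simp
    ultimately have "\<psi> y > 0" using t by (simp add: \<psi>_def)
    moreover have "dist x y = t" using \<nu> t by (simp add: y_def dist_norm)
    ultimately have "y \<in> V" using t d(2) by (auto simp: V_def)
    moreover have "V \<inter> \<Omega> = {}" using gr by (fastforce simp: V_def \<psi>_def)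
    moreover have "V \<subseteq> closure \<Omega>"
      using interior_subset[of T] elements_cover assms by (auto simp: V_def)
    ultimately show False using \<open>open V\<close> open_Int_closure_eq_empty[of V \<Omega>] by blast
  qed
qed

lemma interiors_disjoint: "S \<in> \<T> \<Longrightarrow> T \<in> \<T> \<Longrightarrow> S \<noteq> T \<Longrightarrow> interior S \<inter> T = {}"
proof -
  assume ST: "S \<in> \<T>" "T \<in> \<T>" "S \<noteq> T"
  then have "interior S \<inter> interior T = {}"
    using mesh by (auto simp: polyhedral_mesh_def pairwise_def)
  then have "interior S \<inter> closure (interior T) = {}"
    by (simp add: open_Int_closure_eq_empty)
  then show ?thesis using element(3)[OF ST(2)] by simp
qed

lemma L2_integrable_element:
  assumes f: "f \<in> L2 (lebesgue_on \<Omega>)" and T: "T \<in> \<T>"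
  shows "integrable (lebesgue_on T) f"
proof -
  have \<Omega>: "\<Omega> \<in> lmeasurable" using open_domain bounded_domain lmeasurable_open by blast
  have "integrable (lebesgue_on \<Omega>) f"
    using finite_measure_lebesgue_on[OF \<Omega>] f by (rule L2_integrable)
  then have "set_integrable lebesgue \<Omega> f"
    using \<Omega> by (simp add: integrable_restrict_space set_integrable_def)
  then have "set_integrable lebesgue (interior T) f"
    by (rule set_integrable_subset) (use interior_element_subset[OF T] in auto)
  then have i: "integrable lebesgue (\<lambda>x. indicator (interior T) x *\<^sub>R f x)"
    by (simp add: set_integrable_def)
  have ae: "AE x in lebesgue. indicator (interior T) x *\<^sub>R f x = indicator T x *\<^sub>R f x"
  proof -
    have "AE x in lebesgue. x \<notin> frontier T"
      using element(6)[OF T] by (simp add: negligible_iff_null_sets AE_not_in)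
    then show ?thesis
      by eventually_elim (use element(2)[OF T] interior_subset[of T] in
          \<open>auto simp: frontier_def indicator_def split: if_splits\<close>)
  qed
  have "integrable lebesgue (\<lambda>x. indicator T x *\<^sub>R f x)"
    using i integrable_cong_AE[OF borel_measurable_integrable[OF i]
        borel_measurable_AE[OF borel_measurable_integrable[OF i] ae] ae] by blast
  then show ?thesis using element(7)[OF T] by (simp add: integrable_restrict_space set_integrable_def)
qed

abbreviation "W \<equiv> W_space k \<T> \<E>"
abbreviation "M \<equiv> M_space k \<T>"
abbreviation "wg \<equiv> weak_grad k \<E>"
abbreviation "sf \<equiv> s_form \<T> \<E> \<beta> c"
abbreviation "bf \<equiv> b_form k \<T> \<E> \<beta> c"

lemma W_element: "\<sigma> \<in> W \<Longrightarrow> T \<in> \<T> \<Longrightarrow> fst \<sigma> T \<in> polys k"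
  unfolding W_space_def by (auto simp: mem_Times_iff)

lemma W_face: "\<sigma> \<in> W \<Longrightarrow> e \<in> \<E> \<Longrightarrow> snd \<sigma> e \<in> face_polys k e"
  unfolding W_space_def by (auto simp: mem_Times_iff)

lemma W_face_continuous: "\<sigma> \<in> W \<Longrightarrow> e \<in> \<E> \<Longrightarrow> continuous_on e (snd \<sigma> e)"
  by (rule face_polys_continuous[OF W_face])

lemma W_element_continuous: "\<sigma> \<in> W \<Longrightarrow> T \<in> \<T> \<Longrightarrow> continuous_on S (fst \<sigma> T)"
  by (rule C1_continuous[OF polys_C1[OF W_element]])

text \<open>Linear structure of \<open>W\<close>: \<open>\<tau> = s \<rho> + \<sigma>\<close>. A relation is used because the families are
  extensional and thus not closed under pointwise operations.\<close>

definition W_combination :: "real \<Rightarrow> 'a weak_fun \<Rightarrow> 'a weak_fun \<Rightarrow> 'a weak_fun \<Rightarrow> bool" where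
  "W_combination s \<rho> \<sigma> \<tau> \<longleftrightarrow> \<rho> \<in> W \<and> \<sigma> \<in> W \<and> \<tau> \<in> W \<and>
     (\<forall>T\<in>\<T>. \<forall>x. fst \<tau> T x = s * fst \<rho> T x + fst \<sigma> T x) \<and>
     (\<forall>e\<in>\<E>. \<forall>x\<in>e. snd \<tau> e x = s * snd \<rho> e x + snd \<sigma> e x)"

definition weak_grad_rhs :: "'a weak_fun \<Rightarrow> 'a set \<Rightarrow> ('a \<Rightarrow> 'a) \<Rightarrow> real" where
  "weak_grad_rhs \<sigma> T \<psi> = - ip (lebesgue_on T) (fst \<sigma> T) (divergence \<psi>) +
     (\<Sum>e\<in>faces_of \<E> T. ip (face_measure e) (snd \<sigma> e) (\<lambda>x. \<psi> x \<bullet> outward_normal T e))"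

lemma weak_grad_rhs_test_combination:
  assumes \<sigma>: "\<sigma> \<in> W" and T: "T \<in> \<T>" and \<psi>: "\<phi> \<in> vec_polys r" "\<psi> \<in> vec_polys r"
  shows "weak_grad_rhs \<sigma> T (\<lambda>x. s *\<^sub>R \<phi> x + \<psi> x) = s * weak_grad_rhs \<sigma> T \<phi> + weak_grad_rhs \<sigma> T \<psi>"
proof -
  have "ip (lebesgue_on T) (divergence (\<lambda>x. s *\<^sub>R \<phi> x + \<psi> x)) (fst \<sigma> T) =
      s * ip (lebesgue_on T) (divergence \<phi>) (fst \<sigma> T) + ip (lebesgue_on T) (divergence \<psi>) (fst \<sigma> T)"
    by (intro ip_combination ae_continuous_integrable[OF element(1)[OF T] ae_continuousI]
        continuous_on_mult divergence_continuous[OF \<psi>(1)] divergence_continuous[OF \<psi>(2)]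
        W_element_continuous[OF \<sigma> T] divergence_combination[OF \<psi>])
  moreover have "ip (face_measure e) (\<lambda>x. (s *\<^sub>R \<phi> x + \<psi> x) \<bullet> n) (snd \<sigma> e) =
      s * ip (face_measure e) (\<lambda>x. \<phi> x \<bullet> n) (snd \<sigma> e) + ip (face_measure e) (\<lambda>x. \<psi> x \<bullet> n) (snd \<sigma> e)"
    if "e \<in> faces_of \<E> T" for e n
    using faces_of_mesh[OF that]
    by (intro ip_combination face_measure_integrable face continuous_intros W_face_continuous[OF \<sigma>]
        vec_polys_continuous[OF \<psi>(1)] vec_polys_continuous[OF \<psi>(2)]) (auto simp: inner_add_left)
  ultimately show ?thesis
    unfolding weak_grad_rhs_def
    by (simp add: ip_commute[of _ "fst \<sigma> T"] ip_commute[of _ "snd \<sigma> e" for e]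
        sum.distrib sum_distrib_left algebra_simps)
qed

lemma weak_grad_rhs_combination:
  assumes c: "W_combination s \<rho> \<sigma> \<tau>" and T: "T \<in> \<T>" and \<psi>: "\<psi> \<in> vec_polys r"
  shows "weak_grad_rhs \<tau> T \<psi> = s * weak_grad_rhs \<rho> T \<psi> + weak_grad_rhs \<sigma> T \<psi>"
proof -
  have W: "\<rho> \<in> W" "\<sigma> \<in> W" using c by (auto simp: W_combination_def)
  have "ip (lebesgue_on T) (fst \<tau> T) (divergence \<psi>) =
      s * ip (lebesgue_on T) (fst \<rho> T) (divergence \<psi>) + ip (lebesgue_on T) (fst \<sigma> T) (divergence \<psi>)"
    by (intro ip_combination ae_continuous_integrable element(1)[OF T] ae_continuousI
        continuous_on_mult divergence_continuous[OF \<psi>] W_element_continuous[OF _ T] W)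
      (use c T in \<open>auto simp: W_combination_def\<close>)
  moreover have "ip (face_measure e) (snd \<tau> e) (\<lambda>x. \<psi> x \<bullet> n) =
      s * ip (face_measure e) (snd \<rho> e) (\<lambda>x. \<psi> x \<bullet> n) + ip (face_measure e) (snd \<sigma> e) (\<lambda>x. \<psi> x \<bullet> n)"
    if "e \<in> faces_of \<E> T" for e n
    using faces_of_mesh[OF that] c
    by (intro ip_combination face_measure_integrable face continuous_intros W_face_continuous W
        vec_polys_continuous[OF \<psi>]) (auto simp: W_combination_def space_face_measure)
  ultimately show ?thesis
    unfolding weak_grad_rhs_def by (simp add: sum.distrib sum_distrib_left algebra_simps)
qed

lemma polys_zero_if_AE:
  assumes "T \<in> \<T>" "p \<in> polys r" "AE x in lebesgue_on T. p x = 0"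
  shows "p = (\<lambda>x. 0)"
  using polys_eq_0_if_0_on_open[OF assms(2) open_interior element(4)[OF assms(1)]]
    AE_continuous_eq_interior[OF element(2)[OF assms(1)] C1_continuous[OF polys_C1[OF assms(2)]] assms(3)]
  by blast

lemma vec_polys_zero_if_sq_zero:
  assumes T: "T \<in> \<T>" and \<psi>: "\<psi> \<in> vec_polys r" and 0: "(\<integral>x. \<psi> x \<bullet> \<psi> x \<partial>lebesgue_on T) = 0"
  shows "\<psi> = (\<lambda>x. 0)"
proof
  fix x
  have i: "integrable (lebesgue_on T) (\<lambda>x. \<psi> x \<bullet> \<psi> x)"
    by (intro ae_continuous_integrable element(1)[OF T] ae_continuousI continuous_on_inner
        vec_polys_continuous[OF \<psi>])
  have "AE x in lebesgue_on T. \<psi> x \<bullet> \<psi> x = 0"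
    using 0 integral_nonneg_eq_0_iff_AE[OF i] by simp
  then have "AE x in lebesgue_on T. \<psi> x \<bullet> i = 0" for i by eventually_elim simp
  then have "\<psi> x \<bullet> i = 0" if "i \<in> Basis" for i
    using fun_cong[OF polys_zero_if_AE[OF T vec_polys_component[OF \<psi> that]], of x] by blast
  then show "\<psi> x = 0" by (intro euclidean_eqI[of "\<psi> x" 0]) simp
qed

lemma vec_polys_inner_integrable:
  assumes "T \<in> \<T>" "\<phi> \<in> vec_polys r" "\<psi> \<in> vec_polys r"
  shows "integrable (lebesgue_on T) (\<lambda>x. \<phi> x \<bullet> \<psi> x)"
  by (intro ae_continuous_integrable element(1) ae_continuousI continuous_on_inner
        vec_polys_continuous[where r = r] assms)

text \<open>The Gram form on vector polynomials is definite because an element has nonempty interior.\<close>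

lemma weak_grad_ex1:
  assumes \<sigma>: "\<sigma> \<in> W" and T: "T \<in> \<T>"
  shows "\<exists>!q. q \<in> vec_polys r \<and>
    (\<forall>\<psi>\<in>vec_polys r. (\<integral>x. q x \<bullet> \<psi> x \<partial>lebesgue_on T) = weak_grad_rhs \<sigma> T \<psi>)"
proof (rule ex_ex1I)
  let ?\<Phi> = "vec_poly_fun r :: _ \<Rightarrow> 'a \<Rightarrow> 'a"
  have \<Phi>: "?\<Phi> y \<in> vec_polys r" for y by (simp add: vec_polys_eq_range)
  have comb: "?\<Phi> (\<lambda>i. s * y i + z i) = (\<lambda>x. s *\<^sub>R ?\<Phi> y x + ?\<Phi> z x)" for s y z
    by (rule ext) (rule vec_poly_fun_combination)
  note int = vec_polys_inner_integrable[OF T \<Phi> \<Phi>]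
  have F: "lin (\<lambda>y. weak_grad_rhs \<sigma> T (?\<Phi> y))"
    unfolding lin_def comb using weak_grad_rhs_test_combination[OF \<sigma> T \<Phi> \<Phi>] by blast
  have "\<exists>x. \<forall>y. (\<integral>u. ?\<Phi> x u \<bullet> ?\<Phi> y u \<partial>lebesgue_on T) = weak_grad_rhs \<sigma> T (?\<Phi> y)"
  proof (rule fredholm_alternative[where I = "Basis \<times> multi_indices r"])
    show "finite (Basis \<times> multi_indices r :: ('a \<times> ('a \<Rightarrow> nat)) set)"
      by (simp add: finite_multi_indices)
    show "lin (\<lambda>y. \<integral>u. ?\<Phi> z u \<bullet> ?\<Phi> y u \<partial>lebesgue_on T)"
      "lin (\<lambda>y. \<integral>u. ?\<Phi> y u \<bullet> ?\<Phi> z u \<partial>lebesgue_on T)" for z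
      unfolding lin_def comb by (simp_all add: inner_add_left inner_add_right int)
    show "lin (\<lambda>y. weak_grad_rhs \<sigma> T (?\<Phi> y))" by (rule F)
    show "(\<integral>u. ?\<Phi> z u \<bullet> ?\<Phi> y u \<partial>lebesgue_on T) = 0"
      if "\<And>i. i \<in> Basis \<times> multi_indices r \<Longrightarrow> z i = 0" for y z
    proof -
      have "?\<Phi> z u = 0" for u
        using that by (auto simp: vec_poly_fun_def poly_fun_def intro!: sum.neutral)
      then show ?thesis by simp
    qed
    show "weak_grad_rhs \<sigma> T (?\<Phi> y) = 0"
      if "\<And>z. (\<integral>u. ?\<Phi> z u \<bullet> ?\<Phi> y u \<partial>lebesgue_on T) = 0" for y
    proof -
      have "?\<Phi> y = (\<lambda>x. 0)" using vec_polys_zero_if_sq_zero[OF T \<Phi> that] .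
      also have "\<dots> = ?\<Phi> (\<lambda>i. 0)" by (simp add: vec_poly_fun_def poly_fun_zero fun_eq_iff)
      finally show ?thesis using lin_zero[OF F] by simp
    qed
  qed
  then obtain x where "\<And>y. (\<integral>u. ?\<Phi> x u \<bullet> ?\<Phi> y u \<partial>lebesgue_on T) = weak_grad_rhs \<sigma> T (?\<Phi> y)" by blast
  then show "\<exists>q. q \<in> vec_polys r \<and>
    (\<forall>\<psi>\<in>vec_polys r. (\<integral>x. q x \<bullet> \<psi> x \<partial>lebesgue_on T) = weak_grad_rhs \<sigma> T \<psi>)"
    by (intro exI[of _ "?\<Phi> x"] conjI \<Phi>) (auto simp: vec_polys_eq_range)
next
  fix q q' :: "'a \<Rightarrow> 'a"
  assume q: "q \<in> vec_polys r \<and>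
      (\<forall>\<psi>\<in>vec_polys r. (\<integral>x. q x \<bullet> \<psi> x \<partial>lebesgue_on T) = weak_grad_rhs \<sigma> T \<psi>)"
    and q': "q' \<in> vec_polys r \<and>
      (\<forall>\<psi>\<in>vec_polys r. (\<integral>x. q' x \<bullet> \<psi> x \<partial>lebesgue_on T) = weak_grad_rhs \<sigma> T \<psi>)"
  define d where "d x = (-1) *\<^sub>R q' x + q x" for x
  have d: "d \<in> vec_polys r" unfolding d_def using q q' by (intro vec_polys_combination) auto
  have "(\<integral>x. d x \<bullet> d x \<partial>lebesgue_on T) = (\<integral>x. q x \<bullet> d x - q' x \<bullet> d x \<partial>lebesgue_on T)"
    by (rule Bochner_Integration.integral_cong) (auto simp: d_def inner_add_left inner_diff_left)
  also have "\<dots> = 0"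
    using q q' d vec_polys_inner_integrable[OF T _ d] by simp
  finally have "d = (\<lambda>x. 0)" by (rule vec_polys_zero_if_sq_zero[OF T d])
  then show "q = q'" by (simp add: d_def fun_eq_iff)
qed

lemma weak_grad_spec:
  assumes "\<sigma> \<in> W" "T \<in> \<T>"
  shows "wg \<sigma> T \<in> vec_polys (k - 1)"
    and "\<psi> \<in> vec_polys (k - 1) \<Longrightarrow>
      (\<integral>x. wg \<sigma> T x \<bullet> \<psi> x \<partial>lebesgue_on T) = weak_grad_rhs \<sigma> T \<psi>"
  using theI'[OF weak_grad_ex1[OF assms, of "k - 1"]]
  unfolding weak_grad_def weak_grad_rhs_def by blast+

lemma weak_grad_combination:
  assumes c: "W_combination s \<rho> \<sigma> \<tau>" and T: "T \<in> \<T>"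
  shows "wg \<tau> T x = s *\<^sub>R wg \<rho> T x + wg \<sigma> T x"
proof -
  have W: "\<rho> \<in> W" "\<sigma> \<in> W" "\<tau> \<in> W" using c by (auto simp: W_combination_def)
  let ?q = "\<lambda>x. s *\<^sub>R wg \<rho> T x + wg \<sigma> T x"
  have q: "?q \<in> vec_polys (k - 1)"
    by (intro vec_polys_combination weak_grad_spec W T)
  have "(\<integral>x. ?q x \<bullet> \<psi> x \<partial>lebesgue_on T) = weak_grad_rhs \<tau> T \<psi>" if \<psi>: "\<psi> \<in> vec_polys (k - 1)" for \<psi>
    using vec_polys_inner_integrable[OF T weak_grad_spec(1)[OF _ T] \<psi>] W
    by (simp add: inner_add_left weak_grad_spec(2)[OF _ T \<psi>] weak_grad_rhs_combination[OF c T \<psi>])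
  then have "wg \<tau> T = ?q"
    using weak_grad_ex1[OF W(3) T, of "k - 1"] weak_grad_spec[OF W(3) T] q by blast
  then show ?thesis by simp
qed

lemma jump_integrable:
  assumes "\<rho> \<in> W" "\<sigma> \<in> W" "T \<in> \<T>" "e \<in> faces_of \<E> T"
  shows "integrable (face_measure e) (\<lambda>x. (fst \<rho> T x - snd \<rho> e x) * (fst \<sigma> T x - snd \<sigma> e x))"
  by (intro face_measure_integrable face continuous_intros W_element_continuous W_face_continuous
      assms faces_of_mesh[OF assms(4)])

lemma conv_integrable:
  assumes "\<rho> \<in> W" "\<sigma> \<in> W" "T \<in> \<T>"
  shows "integrable (lebesgue_on T) (\<lambda>x. conv_op \<beta> c (fst \<rho> T) x * conv_op \<beta> c (fst \<sigma> T) x)"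
  by (rule ae_continuous_integrable[OF element(1)[OF assms(3)]
        ae_continuous_mult[OF conv_op_ae_continuous[OF assms(3) W_element[OF assms(1,3)]]
          conv_op_ae_continuous[OF assms(3) W_element[OF assms(2,3)]]]])

lemma conv_op_combination:
  assumes c: "W_combination s \<rho> \<sigma> \<tau>" and T: "T \<in> \<T>"
  shows "conv_op \<beta> c (fst \<tau> T) x = s * conv_op \<beta> c (fst \<rho> T) x + conv_op \<beta> c (fst \<sigma> T) x"
proof -
  have W: "\<rho> \<in> W" "\<sigma> \<in> W" using c by (auto simp: W_combination_def)
  have e: "fst \<tau> T = (\<lambda>x. s * fst \<rho> T x + fst \<sigma> T x)" using c T by (auto simp: W_combination_def)
  have "grad (fst \<tau> T) x = s *\<^sub>R grad (fst \<rho> T) x + grad (fst \<sigma> T) x"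
    unfolding e
    by (rule grad_combination[OF polys_C1[OF W_element[OF W(1) T]] polys_C1[OF W_element[OF W(2) T]]])
  then show ?thesis unfolding conv_op_def by (simp add: e inner_add_right algebra_simps)
qed

lemma s_form_commute: "sf \<tau>\<^sub>1 \<rho> \<sigma> = sf \<tau>\<^sub>1 \<sigma> \<rho>"
  unfolding s_form_def by (simp add: ip_commute)

lemma s_form_combination:
  assumes c: "W_combination s \<rho> \<sigma> \<tau>" and \<mu>: "\<mu> \<in> W"
  shows "sf \<tau>\<^sub>1 \<tau> \<mu> = s * sf \<tau>\<^sub>1 \<rho> \<mu> + sf \<tau>\<^sub>1 \<sigma> \<mu>"
proof -
  have W: "\<rho> \<in> W" "\<sigma> \<in> W" using c by (auto simp: W_combination_def)
  have 1: "ip (face_measure e) (\<lambda>x. fst \<tau> T x - snd \<tau> e x) (\<lambda>x. fst \<mu> T x - snd \<mu> e x) =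
    s * ip (face_measure e) (\<lambda>x. fst \<rho> T x - snd \<rho> e x) (\<lambda>x. fst \<mu> T x - snd \<mu> e x) +
    ip (face_measure e) (\<lambda>x. fst \<sigma> T x - snd \<sigma> e x) (\<lambda>x. fst \<mu> T x - snd \<mu> e x)"
    if "T \<in> \<T>" "e \<in> faces_of \<E> T" for T e
    using that c faces_of_mesh[OF that(2)]
    by (intro ip_combination jump_integrable W \<mu>)
      (auto simp: W_combination_def space_face_measure algebra_simps)
  have 2: "ip (lebesgue_on T) (conv_op \<beta> c (fst \<tau> T)) (conv_op \<beta> c (fst \<mu> T)) =
    s * ip (lebesgue_on T) (conv_op \<beta> c (fst \<rho> T)) (conv_op \<beta> c (fst \<mu> T)) +
    ip (lebesgue_on T) (conv_op \<beta> c (fst \<sigma> T)) (conv_op \<beta> c (fst \<mu> T))" if "T \<in> \<T>" for T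
    by (intro ip_combination conv_integrable W \<mu> that conv_op_combination[OF c])
  show ?thesis
    unfolding s_form_def sum_distrib_left sum.distrib[symmetric]
    by (rule sum.cong[OF refl])
      (simp add: 1 2 sum.distrib sum_distrib_left[symmetric] algebra_simps)
qed

lemma M_element: "v \<in> M \<Longrightarrow> T \<in> \<T> \<Longrightarrow> v T \<in> polys (k - 1)"
  unfolding M_space_def by auto

lemma M_ae_continuous: "v \<in> M \<Longrightarrow> T \<in> \<T> \<Longrightarrow> ae_continuous T (v T)"
  by (rule ae_continuousI[OF C1_continuous[OF polys_C1[OF M_element]]])

lemma weak_conv_ae_continuous:
  assumes "\<sigma> \<in> W" "T \<in> \<T>"
  shows "ae_continuous T (\<lambda>x. \<beta> x \<bullet> wg \<sigma> T x - c x * fst \<sigma> T x)"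
  by (rule ae_continuous_diff[OF
        ae_continuous_inner[OF piecewise_smooth_ae_continuous[OF smooth_\<beta> assms(2)]
          ae_continuousI[OF vec_polys_continuous[OF weak_grad_spec(1)[OF assms]]]]
        ae_continuous_mult[OF piecewise_smooth_ae_continuous[OF smooth_c assms(2)]
          ae_continuousI[OF W_element_continuous[OF assms]]]])

lemma b_form_combination:
  assumes c: "W_combination s \<rho> \<sigma> \<tau>" and v: "v \<in> M"
  shows "bf \<tau> v = s * bf \<rho> v + bf \<sigma> v"
proof -
  have W: "\<rho> \<in> W" "\<sigma> \<in> W" using c by (auto simp: W_combination_def)
  have "ip (lebesgue_on T) (\<lambda>x. \<beta> x \<bullet> wg \<tau> T x - c x * fst \<tau> T x) (v T) =
    s * ip (lebesgue_on T) (\<lambda>x. \<beta> x \<bullet> wg \<rho> T x - c x * fst \<rho> T x) (v T) +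
    ip (lebesgue_on T) (\<lambda>x. \<beta> x \<bullet> wg \<sigma> T x - c x * fst \<sigma> T x) (v T)" if T: "T \<in> \<T>" for T
    using c T
    by (intro ip_combination ae_continuous_integrable element(1) ae_continuous_mult
        weak_conv_ae_continuous W M_ae_continuous v)
      (auto simp: weak_grad_combination[OF c T] W_combination_def inner_add_right algebra_simps)
  then show ?thesis unfolding b_form_def by (simp add: sum.distrib sum_distrib_left)
qed

lemma ip_M_combination:
  assumes T: "T \<in> \<T>" and v: "v \<in> M" "w \<in> M"
    and u: "\<And>x. u T x = s * v T x + w T x" and h: "integrable (lebesgue_on T) h"
  shows "ip (lebesgue_on T) h (u T) = s * ip (lebesgue_on T) h (v T) + ip (lebesgue_on T) h (w T)"
  unfolding ip_commute[of _ h]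
  using integrable_mult_ae_continuous[OF element(1)[OF T] h M_ae_continuous[OF _ T]] v u
  by (intro ip_combination) (auto simp: mult.commute[of _ "h x" for x])

lemma b_form_test_combination:
  assumes \<sigma>: "\<sigma> \<in> W" and v: "v \<in> M" "w \<in> M"
    and u: "\<And>T x. T \<in> \<T> \<Longrightarrow> u T x = s * v T x + w T x"
  shows "bf \<sigma> u = s * bf \<sigma> v + bf \<sigma> w"
proof -
  have "ip (lebesgue_on T) (\<lambda>x. \<beta> x \<bullet> wg \<sigma> T x - c x * fst \<sigma> T x) (u T) =
    s * ip (lebesgue_on T) (\<lambda>x. \<beta> x \<bullet> wg \<sigma> T x - c x * fst \<sigma> T x) (v T) +
    ip (lebesgue_on T) (\<lambda>x. \<beta> x \<bullet> wg \<sigma> T x - c x * fst \<sigma> T x) (w T)" if T: "T \<in> \<T>" for T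
    using ae_continuous_integrable[OF element(1)[OF T] weak_conv_ae_continuous[OF \<sigma> T]]
    by (intro ip_M_combination[OF T v]) (simp_all add: u[OF T])
  then show ?thesis unfolding b_form_def by (simp add: sum.distrib sum_distrib_left)
qed

end

section \<open>Gluing across faces\<close>

context wg_mesh
begin

lemma face_interior_element_disjoint:
  assumes "e \<in> \<E>" "T \<in> \<T>" shows "e \<inter> interior T = {}"
proof -
  obtain S where S: "S \<in> \<T>" "e \<subseteq> frontier S"
    using face_of_element[OF assms(1)] by (auto simp: faces_of_def)
  show ?thesis
  proof (cases "S = T")
    case True
    then show ?thesis using S(2) by (auto simp: frontier_def)
  next
    case False
    have "interior T \<inter> S = {}" using interiors_disjoint[OF assms(2) S(1)] False by blast
    then show ?thesis using S(2) element(2)[OF S(1)] by (auto simp: frontier_def)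
  qed
qed

lemma face_eqI:
  assumes "d \<in> \<E>" "e \<in> \<E>" "z \<in> d" "z \<in> e" "z \<notin> rel_frontier d" "z \<notin> rel_frontier e"
  shows "d = e"
proof (rule ccontr)
  assume "d \<noteq> e"
  then have "rel_interior d \<inter> rel_interior e = {}"
    using mesh assms(1,2) unfolding polyhedral_mesh_def pairwise_def by blast
  moreover have "z \<in> rel_interior d" "z \<in> rel_interior e"
    using assms closure_subset[of d] closure_subset[of e] by (auto simp: rel_frontier_def)
  ultimately show False by blast
qed

text \<open>Away from the relative boundaries of the faces, a boundary point of an element lies on only one face;
  a point of two elements is a boundary point of both.\<close>

lemma shared_face:
  assumes "S \<in> \<T>" "T \<in> \<T>" "S \<noteq> T" "z \<in> S" "z \<in> T" and z: "\<And>e. e \<in> \<E> \<Longrightarrow> z \<notin> rel_frontier e"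
  shows "\<exists>e. e \<in> faces_of \<E> S \<and> e \<in> faces_of \<E> T \<and> z \<in> e"
proof -
  have "z \<in> frontier S" "z \<in> frontier T"
    using interiors_disjoint[of S T] interiors_disjoint[of T S] assms(1-5) closure_subset
    by (auto simp: frontier_def)
  then obtain d e where de: "d \<in> faces_of \<E> S" "z \<in> d" "e \<in> faces_of \<E> T" "z \<in> e"
    using element(5) assms(1,2) by auto
  then have "d = e" by (intro face_eqI[of d e z] faces_of_mesh[of d] faces_of_mesh[of e] z) auto
  with de show ?thesis by blast
qed

lemma skeleton_cover:
  "\<exists>\<A>. finite \<A> \<and> (\<forall>e\<in>\<E>. rel_frontier e \<subseteq> \<Union>\<A>) \<and>
     (\<forall>A\<in>\<A>. affine A \<and> aff_dim A < int DIM('a) - 1)"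
proof -
  have "\<forall>e\<in>\<E>. \<exists>\<A>. finite \<A> \<and> rel_frontier e \<subseteq> \<Union>\<A> \<and> (\<forall>A\<in>\<A>. affine A \<and> aff_dim A < int DIM('a) - 1)"
    using rel_frontier_cell_cover face by blast
  then obtain \<A> where \<A>: "\<And>e. e \<in> \<E> \<Longrightarrow> finite (\<A> e) \<and> rel_frontier e \<subseteq> \<Union>(\<A> e) \<and>
      (\<forall>A\<in>\<A> e. affine A \<and> aff_dim A < int DIM('a) - 1)" by metis
  show ?thesis
    by (rule exI[of _ "\<Union>(\<A> ` \<E>)"]) (use \<A> finite_mesh(2) in fastforce)
qed

text \<open>A segment from \<open>a\<close> that meets an affine set \<open>A\<close> elsewhere than in \<open>a\<close> ends in the affine hull of \<open>A\<close> and
  \<open>a\<close>. For \<open>A\<close> of codimension two this hull is a null set, and \<open>a\<close> itself is on no face, being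
  interior to an element.\<close>

lemma generic_endpoint:
  assumes T: "T \<in> \<T>" and a: "a \<in> interior T" and V: "open V" "V \<noteq> {}"
  shows "\<exists>b\<in>V. \<forall>e\<in>\<E>. closed_segment a b \<inter> rel_frontier e = {}"
proof -
  obtain \<A> where \<A>: "finite \<A>" "\<And>e. e \<in> \<E> \<Longrightarrow> rel_frontier e \<subseteq> \<Union>\<A>"
    "\<And>A. A \<in> \<A> \<Longrightarrow> aff_dim A < int DIM('a) - 1"
    using skeleton_cover by metis
  have "negligible (affine hull (insert a A))" if "A \<in> \<A>" for A
    using \<A>(3)[OF that] by (intro negligible_aff_dim_less) (simp add: aff_dim_insert)
  then have "negligible (\<Union>A\<in>\<A>. affine hull (insert a A))"
    using \<A>(1) by (intro negligible_Union) auto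
  then have "\<not> V \<subseteq> (\<Union>A\<in>\<A>. affine hull (insert a A))"
    using open_not_negligible[OF V] negligible_subset by blast
  then obtain b where b: "b \<in> V" "\<And>A. A \<in> \<A> \<Longrightarrow> b \<notin> affine hull (insert a A)" by blast
  have "z \<notin> rel_frontier e" if z: "z \<in> closed_segment a b" and e: "e \<in> \<E>" for z e
  proof
    assume ze: "z \<in> rel_frontier e"
    then obtain A where A: "A \<in> \<A>" "z \<in> A" using \<A>(2)[OF e] by blast
    have "closure e = e" using face_cell_facts(1)[OF face[OF e]] by (simp add: compact_imp_closed)
    then have "z \<noteq> a" using face_interior_element_disjoint[OF e T] a ze by (auto simp: rel_frontier_def)
    obtain u where u: "z = (1 - u) *\<^sub>R a + u *\<^sub>R b"
      using z by (auto simp: in_segment)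
    then have "u \<noteq> 0" using \<open>z \<noteq> a\<close> by auto
    have "(1 - 1 / u) *\<^sub>R a + (1 / u) *\<^sub>R z = b"
      using \<open>u \<noteq> 0\<close> by (simp add: u algebra_simps)
    moreover have "(1 - 1 / u) *\<^sub>R a + (1 / u) *\<^sub>R z \<in> affine hull (insert a A)"
      by (rule mem_affine[OF affine_affine_hull]) (use A(2) in \<open>auto intro: hull_inc\<close>)
    ultimately show False using b(2)[OF A(1)] by simp
  qed
  then show ?thesis using b(1) by blast
qed

text \<open>This is immediate where two elements share a face, but many elements may meet at a vertex or an edge. Two
  elements at \<open>x\<close> are joined by a short segment that avoids the relative boundaries of all faces. Where it leaves
  the elements with \<open>P U x = P S x\<close> it crosses a face that two elements share, and this face contains \<open>x\<close>, since
  the segment is too short to meet a face that does not contain \<open>x\<close>.\<close>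

lemma single_valued:
  assumes P: "\<And>T. T \<in> \<T> \<Longrightarrow> P T \<in> polys r"
    and glue: "\<And>S T e y. S \<in> \<T> \<Longrightarrow> T \<in> \<T> \<Longrightarrow> e \<in> faces_of \<E> S \<Longrightarrow> e \<in> faces_of \<E> T \<Longrightarrow> y \<in> e \<Longrightarrow>
      P S y = P T y"
    and x: "x \<in> \<Omega>" "S \<in> \<T>" "T \<in> \<T>" "x \<in> S" "x \<in> T"
  shows "P S x = P T x"
proof (rule ccontr)
  assume ne: "P S x \<noteq> P T x"
  define V where "V = \<Omega> \<inter> - \<Union>{e\<in>\<E>. x \<notin> e}"
  have "closed (\<Union>{e\<in>\<E>. x \<notin> e})"
    using finite_mesh face face_cell_facts(1) compact_imp_closed by (intro closed_Union) auto
  then have "open V" unfolding V_def using open_domain by (intro open_Int open_Compl)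
  moreover have "x \<in> V" using x by (simp add: V_def)
  ultimately obtain \<epsilon> where \<epsilon>: "\<epsilon> > 0" "ball x \<epsilon> \<subseteq> V" using open_contains_ball by metis
  have meets: "interior U \<inter> ball x \<epsilon> \<noteq> {}" if "U \<in> \<T>" "x \<in> U" for U
  proof -
    have "x \<in> closure (interior U) \<inter> ball x \<epsilon>" using that \<epsilon> element(3) by simp
    then show ?thesis using open_Int_closure_eq_empty[OF open_ball, of x \<epsilon> "interior U"] by blast
  qed
  obtain a where a: "a \<in> interior S" "a \<in> ball x \<epsilon>" using meets[OF x(2,4)] by blast
  obtain b where b: "b \<in> interior T" "b \<in> ball x \<epsilon>"
    and seg: "\<And>e. e \<in> \<E> \<Longrightarrow> closed_segment a b \<inter> rel_frontier e = {}"
    using generic_endpoint[OF x(2) a(1), of "interior T \<inter> ball x \<epsilon>"] meets[OF x(3,5)]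
    by (metis IntE open_Int open_ball open_interior)
  define C where "C = \<Union>{U\<in>\<T>. P U x = P S x}"
  define D where "D = \<Union>{U\<in>\<T>. P U x \<noteq> P S x}"
  have ab: "closed_segment a b \<subseteq> V" using a b \<epsilon> closed_segment_subset[OF a(2) b(2) convex_ball] by blast
  have "closed_segment a b \<subseteq> C \<union> D"
  proof
    fix z assume "z \<in> closed_segment a b"
    then have "z \<in> \<Union>\<T>" using ab elements_cover closure_subset[of \<Omega>] by (auto simp: V_def)
    then show "z \<in> C \<union> D" by (auto simp: C_def D_def)
  qed
  moreover have "closed C" "closed D"
    unfolding C_def D_def using finite_mesh element(2) by (auto intro!: closed_Union)
  moreover have "a \<in> C \<inter> closed_segment a b" "b \<in> D \<inter> closed_segment a b"
    unfolding C_def D_def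
    using x ne subsetD[OF interior_subset a(1)] subsetD[OF interior_subset b(1)] by force+
  ultimately obtain z where z: "z \<in> C" "z \<in> D" "z \<in> closed_segment a b"
    using connected_closed[of "closed_segment a b"] convex_connected[OF convex_closed_segment]
    by (smt (verit) disjoint_iff Int_iff)
  then obtain U U' where U: "U \<in> \<T>" "z \<in> U" "P U x = P S x" "U' \<in> \<T>" "z \<in> U'" "P U' x \<noteq> P S x"
    by (auto simp: C_def D_def)
  then have "U \<noteq> U'" by auto
  then obtain e where e: "e \<in> faces_of \<E> U" "e \<in> faces_of \<E> U'" "z \<in> e"
    using shared_face[OF U(1,4) _ U(2,5)] seg z(3) by blast
  have "z \<in> V" using z(3) ab by blast
  then have "x \<in> e" using e(3) faces_of_mesh[OF e(1)] by (auto simp: V_def)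
  then show False using glue[OF U(1,4) e(1,2)] U(3,6) by simp
qed

text \<open>A boundary point outside the codimension-two skeleton, which is null for the surface measure, lies on no
  other face, and every element containing the point has it on its boundary.\<close>

lemma AE_boundary_face:
  assumes e: "e \<in> faces_of \<E> \<Omega>"
  shows "AE x in face_measure e. \<forall>T\<in>\<T>. x \<in> T \<longrightarrow> e \<in> faces_of \<E> T"
proof -
  have eE: "e \<in> \<E>" by (rule faces_of_mesh[OF e])
  obtain \<A> where \<A>: "finite \<A>" "\<And>d. d \<in> \<E> \<Longrightarrow> rel_frontier d \<subseteq> \<Union>\<A>"
    "\<And>A. A \<in> \<A> \<Longrightarrow> affine A \<and> aff_dim A < int DIM('a) - 1"
    using skeleton_cover by metis
  have "AE x in face_measure e. \<forall>A\<in>\<A>. x \<notin> A"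
    using \<A>(1) face_measure_codim_2[OF face[OF eE]] \<A>(3) by (intro AE_finite_allI) auto
  then show ?thesis using AE_space
  proof eventually_elim
    case (elim x)
    then have x: "x \<in> e" by (simp add: space_face_measure)
    have "e \<in> faces_of \<E> T" if T: "T \<in> \<T>" "x \<in> T" for T
    proof -
      have "x \<in> frontier \<Omega>" using x e by (auto simp: faces_of_def)
      then have "x \<notin> interior T" using interior_element_subset[OF T(1)] open_domain
        by (auto simp: frontier_def interior_open)
      then have "x \<in> frontier T" using T(2) closure_subset by (auto simp: frontier_def)
      then obtain d where d: "d \<in> faces_of \<E> T" "x \<in> d" using element(5)[OF T(1)] by auto
      have "x \<notin> rel_frontier e" "x \<notin> rel_frontier d"
        using elim(1) \<A>(2) eE faces_of_mesh[OF d(1)] by blast+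
      then have "d = e" using face_eqI[OF faces_of_mesh[OF d(1)] eE d(2) x] by blast
      with d show ?thesis by simp
    qed
    then show ?case by blast
  qed
qed

end

section \<open>Lipschitz test functions\<close>

text \<open>Averages are taken over cubes because the unit cube has volume one, so that no normalization is needed.\<close>

abbreviation unit_cube :: "'a::euclidean_space measure" where
  "unit_cube \<equiv> restrict_space lborel (cbox 0 One)"

definition cube_average ::
    "real \<Rightarrow> ('a::euclidean_space \<Rightarrow> 'b::euclidean_space) \<Rightarrow> 'a \<Rightarrow> 'b" where
  "cube_average h f x = (\<integral>y. f (x + h *\<^sub>R y) \<partial>unit_cube)"

lemma measure_unit_cube: "measure unit_cube (cbox 0 (One :: 'a::euclidean_space)) = 1"
  by (simp add: space_restrict_space measure_restrict_space)

lemma finite_measure_unit_cube: "finite_measure unit_cube"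
  by (intro finite_measureI) (simp add: space_restrict_space emeasure_restrict_space emeasure_lborel_cbox_eq)

lemma norm_unit_cube: "x \<in> space unit_cube \<Longrightarrow> norm (x::'a::euclidean_space) \<le> real DIM('a)"
proof -
  assume "x \<in> space unit_cube"
  then have x: "\<And>i. i \<in> Basis \<Longrightarrow> 0 \<le> x \<bullet> i \<and> x \<bullet> i \<le> 1"
    by (auto simp: space_restrict_space mem_box)
  have "norm x \<le> (\<Sum>i\<in>Basis. \<bar>x \<bullet> i\<bar>)" by (rule norm_le_l1)
  also have "\<dots> \<le> (\<Sum>i\<in>(Basis :: 'a set). 1)" by (rule sum_mono) (use x in force)
  finally show ?thesis by simp
qed

lemma AE_unit_cube_affine:
  fixes N :: "'a::euclidean_space set"
  assumes N: "negligible N" and h: "h \<noteq> 0"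
  shows "AE y in unit_cube. x + h *\<^sub>R y \<notin> N"
proof -
  have "{y. x + h *\<^sub>R y \<in> N} = (\<lambda>z. (1 / h) *\<^sub>R (z - x)) ` N"
  proof (intro equalityI subsetI)
    fix y assume "y \<in> {y. x + h *\<^sub>R y \<in> N}"
    then show "y \<in> (\<lambda>z. (1 / h) *\<^sub>R (z - x)) ` N"
      using h by (intro image_eqI[of _ _ "x + h *\<^sub>R y"]) auto
  qed (use h in auto)
  moreover have "negligible ((\<lambda>z. (1 / h) *\<^sub>R (z - x)) ` N)"
    by (rule negligible_differentiable_image_negligible[OF _ N])
      (auto simp: differentiable_on_def intro!: derivative_intros)
  ultimately have "{y. x + h *\<^sub>R y \<in> N} \<in> null_sets lebesgue" by (simp add: negligible_iff_null_sets)
  then have "AE y in lebesgue. x + h *\<^sub>R y \<notin> N" using AE_not_in by fastforce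
  then have "AE y in lborel. x + h *\<^sub>R y \<notin> N" by (simp add: AE_completion_iff)
  then show ?thesis by (subst AE_restrict_space_iff) auto
qed

lemma unit_cube_measurable:
  fixes f :: "'a::euclidean_space \<Rightarrow> 'b::euclidean_space"
  assumes "f \<in> borel_measurable borel" shows "(\<lambda>y. f (x + h *\<^sub>R y)) \<in> borel_measurable unit_cube"
proof -
  have "(\<lambda>y. x + h *\<^sub>R y) \<in> borel_measurable unit_cube"
    by (rule measurable_restrict_space1) simp
  then show ?thesis by (rule measurable_compose[OF _ assms])
qed

lemma unit_cube_integrable:
  fixes f :: "'a::euclidean_space \<Rightarrow> 'b::euclidean_space"
  assumes "f \<in> borel_measurable borel" "\<And>x. norm (f x) \<le> B"
  shows "integrable unit_cube (\<lambda>y. f (x + h *\<^sub>R y))"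
proof -
  interpret finite_measure "unit_cube :: 'a measure" by (rule finite_measure_unit_cube)
  show ?thesis
    by (rule integrable_const_bound[where B = B]) (use assms in \<open>auto intro: unit_cube_measurable\<close>)
qed

lemma norm_cube_average_le:
  fixes f :: "'a::euclidean_space \<Rightarrow> 'b::euclidean_space"
  assumes "f \<in> borel_measurable borel" "\<And>x. norm (f x) \<le> B"
  shows "norm (cube_average h f x) \<le> B"
proof -
  interpret finite_measure "unit_cube :: 'a measure" by (rule finite_measure_unit_cube)
  have "norm (cube_average h f x) \<le> (\<integral>y. norm (f (x + h *\<^sub>R y)) \<partial>unit_cube)"
    unfolding cube_average_def by (rule integral_norm_bound)
  also have "\<dots> \<le> (\<integral>y. B \<partial>(unit_cube :: 'a measure))"
    by (rule integral_mono) (use assms unit_cube_integrable[OF assms] in auto)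
  finally show ?thesis by (simp add: measure_unit_cube)
qed

lemma cube_average_tendsto:
  fixes f :: "'a::euclidean_space \<Rightarrow> 'b::euclidean_space"
  assumes f: "f \<in> borel_measurable borel" "\<And>x. norm (f x) \<le> B"
    and lim: "AE y in unit_cube. (\<lambda>n. f (x n + h n *\<^sub>R y)) \<longlonglongrightarrow> g y"
    and g: "g \<in> borel_measurable unit_cube"
  shows "(\<lambda>n. cube_average (h n) f (x n)) \<longlonglongrightarrow> (\<integral>y. g y \<partial>unit_cube)"
proof -
  interpret finite_measure "unit_cube :: 'a measure" by (rule finite_measure_unit_cube)
  show ?thesis unfolding cube_average_def
    by (rule integral_dominated_convergence[where w = "\<lambda>_. B"])
      (use lim f g unit_cube_measurable in auto)
qed

text \<open>Averaging a Lipschitz function over cubes gains one derivative when the gradient exists and is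
  continuous outside a null set: by dominated convergence the difference quotients, which are bounded
  by the Lipschitz constant, can be averaged instead.\<close>

locale lipschitz_ae_C1 =
  fixes f :: "'a::euclidean_space \<Rightarrow> real" and G :: "'a \<Rightarrow> 'a" and L B :: real and U :: "'a set"
  assumes lip: "L-lipschitz_on UNIV f" and f_bound: "\<And>x. \<bar>f x\<bar> \<le> B"
    and U: "open U" "negligible (- U)"
    and deriv: "\<And>x. x \<in> U \<Longrightarrow> (f has_derivative (\<lambda>v. v \<bullet> G x)) (at x)"
    and G_cont: "continuous_on U G" and G_outside: "\<And>x. x \<notin> U \<Longrightarrow> G x = 0"
begin

lemma L_nonneg: "0 \<le> L" using lip by (rule lipschitz_on_nonneg)

lemma f_continuous: "continuous_on UNIV f" using lip by (rule lipschitz_on_continuous_on)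

lemma f_measurable: "f \<in> borel_measurable borel"
  by (rule borel_measurable_continuous_onI[OF f_continuous])

lemma G_measurable: "G \<in> borel_measurable borel"
proof -
  have "(\<lambda>x. indicator U x *\<^sub>R G x) \<in> borel_measurable borel"
    by (rule borel_measurable_continuous_on_indicator) (use U G_cont in auto)
  moreover have "(\<lambda>x. indicator U x *\<^sub>R G x) = G"
    using G_outside by (auto simp: indicator_def fun_eq_iff)
  ultimately show ?thesis by simp
qed

lemma G_bound: "norm (G x) \<le> L"
proof (cases "x \<in> U")
  case True
  have lim: "(\<lambda>h. norm (f (x + h) - f x - h \<bullet> G x) / norm h) \<midarrow>0\<rightarrow> 0"
    using deriv[OF True] by (simp add: has_derivative_at)
  show ?thesis
  proof (cases "G x = 0")
    case True
    then show ?thesis using L_nonneg by simp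
  next
    case False
    define v where "v n = (1 / real (Suc n)) *\<^sub>R G x" for n
    have "v n \<noteq> 0" for n using False by (simp add: v_def)
    moreover have "v \<longlonglongrightarrow> 0"
      unfolding v_def using tendsto_scaleR[OF LIMSEQ_inverse_real_of_nat tendsto_const, of "G x"]
      by (simp add: inverse_eq_divide)
    ultimately have "(\<lambda>n. norm (f (x + v n) - f x - v n \<bullet> G x) / norm (v n)) \<longlonglongrightarrow> 0"
      using lim by (simp flip: LIMSEQ_SEQ_conv)
    then have "(\<lambda>n. L + norm (f (x + v n) - f x - v n \<bullet> G x) / norm (v n)) \<longlonglongrightarrow> L + 0"
      by (intro tendsto_intros)
    moreover have "norm (G x) \<le> L + norm (f (x + v n) - f x - v n \<bullet> G x) / norm (v n)" for n
    proof -
      have vn: "norm (v n) > 0" using False by (simp add: v_def)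
      have "v n \<bullet> G x = norm (v n) * norm (G x)"
        using False by (simp add: v_def dot_square_norm power2_eq_square)
      moreover have "\<bar>f (x + v n) - f x\<bar> \<le> L * norm (v n)"
        using lipschitz_onD[OF lip, of "x + v n" x] by (simp add: dist_norm)
      ultimately have "norm (v n) * norm (G x) \<le> L * norm (v n) + norm (f (x + v n) - f x - v n \<bullet> G x)"
        by simp
      then show ?thesis using vn by (simp add: field_simps)
    qed
    ultimately show ?thesis using LIMSEQ_le_const by fastforce
  qed
qed (simp add: G_outside L_nonneg)

lemma AE_cube_U: "h \<noteq> 0 \<Longrightarrow> AE y in unit_cube. x + h *\<^sub>R y \<in> U"
  using AE_unit_cube_affine[OF U(2), of h x] by simp

lemma cube_average_has_derivative:
  assumes h: "h \<noteq> 0"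
  shows "(cube_average h f has_derivative (\<lambda>v. v \<bullet> cube_average h G x)) (at x)"
  unfolding has_derivative_at
proof
  show "bounded_linear (\<lambda>v. v \<bullet> cube_average h G x)" by (rule bounded_linear_inner_left)
  let ?A = "cube_average h f" and ?AG = "cube_average h G"
  note intf = unit_cube_integrable[OF f_measurable, of B, unfolded real_norm_def, OF f_bound]
    and intG = unit_cube_integrable[OF G_measurable G_bound]
  have "(\<lambda>n. norm (?A (x + v n) - ?A x - v n \<bullet> ?AG x) / norm (v n)) \<longlonglongrightarrow> 0"
    if v0: "\<And>n. v n \<noteq> 0" and v: "v \<longlonglongrightarrow> 0" for v
  proof -
    define q where
      "q n y = (f (x + h *\<^sub>R y + v n) - f (x + h *\<^sub>R y) - v n \<bullet> G (x + h *\<^sub>R y)) / norm (v n)" for n y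
    have int: "integrable unit_cube (\<lambda>y. f (x + h *\<^sub>R y + v n))" for n
      using intf[where x = "x + v n" and h = h] by (simp add: algebra_simps)
    have "(\<integral>y. q n y \<partial>unit_cube) = (?A (x + v n) - ?A x - v n \<bullet> ?AG x) / norm (v n)" for n
      unfolding q_def cube_average_def using int[of n] intf[where h = h] intG[where h = h]
      by (simp add: algebra_simps)
    moreover have "(\<lambda>n. \<integral>y. q n y \<partial>unit_cube) \<longlonglongrightarrow> (\<integral>y. 0 \<partial>(unit_cube :: 'a measure))"
    proof (rule integral_dominated_convergence[where w = "\<lambda>_. 2 * L"])
      interpret finite_measure "unit_cube :: 'a measure" by (rule finite_measure_unit_cube)
      show "integrable unit_cube (\<lambda>_ :: 'a. 2 * L)" by simp
      show "q n \<in> borel_measurable unit_cube" for n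
        unfolding q_def using int[of n] intf[where h = h] intG[where h = h]
        by (intro borel_measurable_integrable) simp
      show "AE y in unit_cube. (\<lambda>n. q n y) \<longlonglongrightarrow> 0"
        using AE_cube_U[OF h, of x]
      proof eventually_elim
        case (elim y)
        have "(\<lambda>w. norm (f (x + h *\<^sub>R y + w) - f (x + h *\<^sub>R y) - w \<bullet> G (x + h *\<^sub>R y)) / norm w) \<midarrow>0\<rightarrow> 0"
          using deriv[OF elim] by (simp add: has_derivative_at)
        then have "(\<lambda>n. norm (q n y)) \<longlonglongrightarrow> 0"
          using v0 v unfolding q_def by (simp flip: LIMSEQ_SEQ_conv)
        then show ?case by (rule tendsto_norm_zero_cancel)
      qed
      show "AE y in unit_cube. norm (q n y) \<le> 2 * L" for n
      proof (rule AE_I2)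
        fix y :: 'a
        have "\<bar>f (x + h *\<^sub>R y + v n) - f (x + h *\<^sub>R y)\<bar> \<le> L * norm (v n)"
          using lipschitz_onD[OF lip, of "x + h *\<^sub>R y + v n" "x + h *\<^sub>R y"] by (simp add: dist_norm)
        moreover have "\<bar>v n \<bullet> G (x + h *\<^sub>R y)\<bar> \<le> norm (v n) * norm (G (x + h *\<^sub>R y))"
          by (rule Cauchy_Schwarz_ineq2)
        moreover have "norm (v n) * norm (G (x + h *\<^sub>R y)) \<le> norm (v n) * L"
          by (intro mult_left_mono G_bound) simp
        ultimately have "\<bar>f (x + h *\<^sub>R y + v n) - f (x + h *\<^sub>R y) - v n \<bullet> G (x + h *\<^sub>R y)\<bar> \<le> 2 * L * norm (v n)"
          by (simp only: mult.commute[of "norm (v n)"])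
        then show "norm (q n y) \<le> 2 * L"
          using v0[of n] by (simp add: q_def divide_le_eq)
      qed
    qed simp
    ultimately have "(\<lambda>n. (?A (x + v n) - ?A x - v n \<bullet> ?AG x) / norm (v n)) \<longlonglongrightarrow> 0" by simp
    then show ?thesis using tendsto_norm_zero by fastforce
  qed
  then show "(\<lambda>v. norm (?A (x + v) - ?A x - v \<bullet> ?AG x) / norm v) \<midarrow>0\<rightarrow> 0"
    unfolding LIMSEQ_SEQ_conv[symmetric] by blast
qed

lemma cube_average_grad_continuous:
  assumes h: "h \<noteq> 0" shows "continuous_on UNIV (cube_average h G)"
  unfolding continuous_on_sequentially
proof (intro allI ballI impI)
  fix z and x :: 'a assume z: "(\<forall>n. z n \<in> UNIV) \<and> z \<longlonglongrightarrow> x"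
  show "(cube_average h G \<circ> z) \<longlonglongrightarrow> cube_average h G x"
    unfolding comp_def cube_average_def[of h G x]
  proof (rule cube_average_tendsto[OF G_measurable G_bound])
    show "(\<lambda>y. G (x + h *\<^sub>R y)) \<in> borel_measurable unit_cube" by (rule unit_cube_measurable[OF G_measurable])
    show "AE y in unit_cube. (\<lambda>n. G (z n + h *\<^sub>R y)) \<longlonglongrightarrow> G (x + h *\<^sub>R y)"
      using AE_cube_U[OF h, of x]
    proof eventually_elim
      case (elim y)
      have "isCont G (x + h *\<^sub>R y)" using G_cont U(1) elim by (simp add: continuous_on_eq_continuous_at)
      moreover have "(\<lambda>n. z n + h *\<^sub>R y) \<longlonglongrightarrow> x + h *\<^sub>R y" using z by (intro tendsto_intros) simp
      ultimately show ?case by (rule isCont_tendsto_compose)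
    qed
  qed
qed

lemma cube_average_C1: "h \<noteq> 0 \<Longrightarrow> C1 (cube_average h f)"
  by (rule C1I[OF cube_average_has_derivative cube_average_grad_continuous])

lemma grad_cube_average: "h \<noteq> 0 \<Longrightarrow> grad (cube_average h f) x = cube_average h G x"
  by (rule grad_eqI[OF cube_average_has_derivative])

end

lemma C1_Ck_on: assumes "C1 \<eta>" shows "Ck_on 1 \<eta> UNIV"
proof -
  have "frechet_derivative \<eta> (at x) i = i \<bullet> grad \<eta> x" for x i
    using frechet_derivative_at[OF C1_has_derivative[OF assms, of x]] by metis
  then show ?thesis
    using assms C1_continuous_grad[OF assms]
    by (auto simp: C1_def intro!: continuous_intros)
qed

lemma cube_average_of_limit:
  fixes f :: "'a::euclidean_space \<Rightarrow> 'b::euclidean_space"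
  assumes f: "f \<in> borel_measurable borel" "\<And>x. norm (f x) \<le> B" and x: "isCont f x" and h: "h \<longlonglongrightarrow> 0"
  shows "(\<lambda>n. cube_average (h n) f x) \<longlonglongrightarrow> f x"
proof -
  have "(\<lambda>n. f (x + h n *\<^sub>R y)) \<longlonglongrightarrow> f x" for y
  proof (rule isCont_tendsto_compose[OF x])
    have "(\<lambda>n. x + h n *\<^sub>R y) \<longlonglongrightarrow> x + 0 *\<^sub>R y" by (intro tendsto_intros h)
    then show "(\<lambda>n. x + h n *\<^sub>R y) \<longlonglongrightarrow> x" by simp
  qed
  then have "(\<lambda>n. cube_average (h n) f x) \<longlonglongrightarrow> (\<integral>y. f x \<partial>(unit_cube :: 'a measure))"
    by (intro cube_average_tendsto[OF f]) auto
  then show ?thesis by (simp add: measure_unit_cube)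
qed

text \<open>The cube averages of \<open>f\<close> are admissible test functions; their gradients are bounded by the Lipschitz
  constant and converge to \<open>G\<close> at every point of \<open>U\<close>, so both sides pass to the limit.\<close>

lemma (in lipschitz_ae_C1) weak_divergence_test:
  assumes div: "has_weak_divergence \<Omega> \<psi> q" and \<Omega>: "open \<Omega>"
    and \<psi>: "integrable (lebesgue_on \<Omega>) \<psi>" and q: "integrable (lebesgue_on \<Omega>) q"
    and K: "compact K" "K \<subseteq> \<Omega>" and f0: "\<And>x. x \<notin> K \<Longrightarrow> f x = 0"
  shows "(\<integral>x. \<psi> x \<bullet> G x \<partial>lebesgue_on \<Omega>) = - ip (lebesgue_on \<Omega>) q f"
proof -
  obtain \<delta> where \<delta>: "\<delta> > 0" "(\<Union>x\<in>K. cball x \<delta>) \<subseteq> \<Omega>"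
    using compact_subset_open_imp_cball_epsilon_subset[OF K(1) \<Omega> K(2)] by blast
  define h where "h n = \<delta> / real DIM('a) * (1 / real (Suc n))" for n
  have h0: "h n > 0" for n using \<delta> by (simp add: h_def)
  have "h \<longlonglongrightarrow> \<delta> / real DIM('a) * 0"
    unfolding h_def using LIMSEQ_inverse_real_of_nat
    by (intro tendsto_mult_left) (simp add: inverse_eq_divide)
  then have h: "h \<longlonglongrightarrow> 0" by simp
  have h_nz: "h n \<noteq> 0" for n using h0[of n] by simp
  have h_le: "h n * real DIM('a) \<le> \<delta>" for n
    using \<delta>(1) by (simp add: h_def divide_le_eq)
  define \<eta> where "\<eta> n = cube_average (h n) f" for n
  have \<eta>: "C1 (\<eta> n)" for n unfolding \<eta>_def using h0[of n] by (intro cube_average_C1) simp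
  have grad_\<eta>: "grad (\<eta> n) x = cube_average (h n) G x" for n x
    unfolding \<eta>_def using h0[of n] by (intro grad_cube_average) simp
  define K' where "K' = (\<Union>x\<in>K. cball x \<delta>)"
  have K': "compact K'"
  proof -
    have "K' = (\<Union>x\<in>K. \<Union>y\<in>cball 0 \<delta>. {x + y})"
    proof (intro equalityI subsetI)
      fix z assume "z \<in> K'"
      then obtain x where "x \<in> K" "dist x z \<le> \<delta>" by (auto simp: K'_def)
      then show "z \<in> (\<Union>x\<in>K. \<Union>y\<in>cball 0 \<delta>. {x + y})"
        by (intro UN_I[of x] UN_I[of "z - x"]) (auto simp: dist_norm norm_minus_commute)
    next
      fix z assume "z \<in> (\<Union>x\<in>K. \<Union>y\<in>cball 0 \<delta>. {x + y})"
      then obtain x y where "x \<in> K" "norm y \<le> \<delta>" "z = x + y" by auto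
      then show "z \<in> K'" by (auto simp: K'_def dist_norm intro!: bexI[of _ x])
    qed
    then show ?thesis using compact_sums'[OF K(1) compact_cball] by simp
  qed
  have "\<eta> n x = 0" if x: "x \<notin> K'" for n x
  proof -
    have "f (x + h n *\<^sub>R y) = 0" if y: "y \<in> space unit_cube" for y
    proof (rule f0, rule notI)
      assume "x + h n *\<^sub>R y \<in> K"
      moreover have "norm (h n *\<^sub>R y) \<le> h n * real DIM('a)"
        using h0[of n] norm_unit_cube[OF y] by (simp add: mult_left_mono)
      ultimately have "x \<in> K'" using h_le[of n] by (force simp: K'_def dist_norm)
      with x show False by simp
    qed
    then have "cube_average (h n) f x = (\<integral>y. 0 \<partial>(unit_cube :: 'a measure))"
      unfolding cube_average_def by (intro Bochner_Integration.integral_cong refl)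
    then show ?thesis by (simp add: \<eta>_def)
  qed
  then have "compactly_supported_in \<Omega> (\<eta> n)" for n
    using K' \<delta>(2) unfolding compactly_supported_in_def K'_def by blast
  then have test: "(\<integral>x. \<psi> x \<bullet> cube_average (h n) G x \<partial>lebesgue_on \<Omega>) = - ip (lebesgue_on \<Omega>) q (\<eta> n)" for n
    using div C1_Ck_on[OF \<eta>[of n]] unfolding has_weak_divergence_def grad_\<eta>[symmetric] by blast
  have \<Omega>s: "\<Omega> \<in> sets lebesgue" using \<Omega> by auto
  have G_leb: "g \<in> borel_measurable (lebesgue_on \<Omega>)" if "g \<in> borel_measurable borel"
    for g :: "'a \<Rightarrow> 'c::euclidean_space"
    by (rule measurable_restrict_space1, rule measurable_completion) (use that in simp)
  have "(\<lambda>n. \<integral>x. \<psi> x \<bullet> cube_average (h n) G x \<partial>lebesgue_on \<Omega>) \<longlonglongrightarrow> (\<integral>x. \<psi> x \<bullet> G x \<partial>lebesgue_on \<Omega>)"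
  proof (rule integral_dominated_convergence[where w = "\<lambda>x. norm (\<psi> x) * L"])
    show "(\<lambda>x. \<psi> x \<bullet> G x) \<in> borel_measurable (lebesgue_on \<Omega>)"
      using \<psi> G_leb[OF G_measurable] by measurable
    show "(\<lambda>x. \<psi> x \<bullet> cube_average (h n) G x) \<in> borel_measurable (lebesgue_on \<Omega>)" for n
      using \<psi> G_leb[OF borel_measurable_continuous_onI[OF cube_average_grad_continuous[OF h_nz[of n]]]]
      by measurable
    show "integrable (lebesgue_on \<Omega>) (\<lambda>x. norm (\<psi> x) * L)" using \<psi> by simp
    show "AE x in lebesgue_on \<Omega>. (\<lambda>n. \<psi> x \<bullet> cube_average (h n) G x) \<longlonglongrightarrow> \<psi> x \<bullet> G x"
    proof -
      have "AE x in lebesgue. x \<notin> - U" using U(2) by (intro AE_not_in) (simp add: negligible_iff_null_sets)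
      then have "AE x in lebesgue_on \<Omega>. x \<in> U"
        by (subst AE_restrict_space_iff) (use \<Omega>s in auto)
      then show ?thesis
      proof eventually_elim
        case (elim x)
        have "isCont G x" using G_cont U(1) elim by (simp add: continuous_on_eq_continuous_at)
        then show ?case by (intro tendsto_intros cube_average_of_limit[OF G_measurable G_bound _ h])
      qed
    qed
    show "AE x in lebesgue_on \<Omega>. norm (\<psi> x \<bullet> cube_average (h n) G x) \<le> norm (\<psi> x) * L" for n
      using norm_cube_average_le[OF G_measurable G_bound, of "h n"]
      by (intro AE_I2) (auto intro!: order_trans[OF Cauchy_Schwarz_ineq2] mult_left_mono)
  qed
  moreover have "(\<lambda>n. \<integral>x. q x * \<eta> n x \<partial>lebesgue_on \<Omega>) \<longlonglongrightarrow> (\<integral>x. q x * f x \<partial>lebesgue_on \<Omega>)"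
  proof (rule integral_dominated_convergence[where w = "\<lambda>x. \<bar>q x\<bar> * B"])
    show "(\<lambda>x. q x * f x) \<in> borel_measurable (lebesgue_on \<Omega>)"
      using q G_leb[OF f_measurable] by measurable
    show "(\<lambda>x. q x * \<eta> n x) \<in> borel_measurable (lebesgue_on \<Omega>)" for n
      using q G_leb[OF borel_measurable_continuous_onI[OF C1_continuous[OF \<eta>[of n]]]] by measurable
    show "integrable (lebesgue_on \<Omega>) (\<lambda>x. \<bar>q x\<bar> * B)" using q by simp
    have "isCont f x" for x using f_continuous by (simp add: continuous_on_eq_continuous_at)
    then show "AE x in lebesgue_on \<Omega>. (\<lambda>n. q x * \<eta> n x) \<longlonglongrightarrow> q x * f x"
      unfolding \<eta>_def
      by (intro AE_I2 tendsto_intros cube_average_of_limit[OF f_measurable _ _ h, of B]) (use f_bound in auto)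
    show "AE x in lebesgue_on \<Omega>. norm (q x * \<eta> n x) \<le> \<bar>q x\<bar> * B" for n
      using norm_cube_average_le[OF f_measurable, of B "h n"] f_bound
      by (intro AE_I2) (auto simp: abs_mult \<eta>_def intro!: mult_left_mono)
  qed
  then have "(\<lambda>n. - ip (lebesgue_on \<Omega>) q (\<eta> n)) \<longlonglongrightarrow> - ip (lebesgue_on \<Omega>) q f"
    unfolding ip_def by (rule tendsto_minus)
  ultimately show ?thesis unfolding test by (rule LIMSEQ_unique)
qed

section \<open>Cutoff functions and gluing of Lipschitz pieces\<close>

lemma C1_compose:
  assumes f: "C1 f" and g: "\<And>t. (g has_real_derivative g' t) (at t)" and g': "continuous_on UNIV g'"
  shows "C1 (\<lambda>x. g (f x))"
proof (rule C1I)
  show "((\<lambda>x. g (f x)) has_derivative (\<lambda>v. v \<bullet> (g' (f x) *\<^sub>R grad f x))) (at x)" for x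
    using has_derivative_compose[OF C1_has_derivative[OF f] g[of "f x", unfolded has_field_derivative_def]]
    by simp
  show "continuous_on UNIV (\<lambda>x. g' (f x) *\<^sub>R grad f x)"
    by (intro continuous_on_scaleR C1_continuous_grad f continuous_on_compose2[OF g' C1_continuous[OF f]]) simp
qed

text \<open>The square of the positive part is continuously differentiable; composing it with itself gives all
  cutoff functions below.\<close>

definition sq_pos :: "real \<Rightarrow> real" where "sq_pos t = (max 0 t)\<^sup>2"

lemma sq_pos_deriv: "(sq_pos has_real_derivative 2 * max 0 t) (at t)"
  unfolding has_field_derivative_def
proof (rule has_derivativeI_sandwich[where e = 1 and H = "\<lambda>y. \<bar>y - t\<bar>"])
  show "bounded_linear ((*) (2 * max 0 t))" by (rule bounded_linear_mult_right)
  have "((\<lambda>y. \<bar>y - t\<bar>) \<longlongrightarrow> \<bar>t - t\<bar>) (at t)" by (intro tendsto_intros)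
  then show "((\<lambda>y. \<bar>y - t\<bar>) \<longlongrightarrow> 0) (at t)" by simp
  show "norm (sq_pos y - sq_pos t - 2 * max 0 t * (y - t)) / norm (y - t) \<le> \<bar>y - t\<bar>" if "y \<noteq> t" for y
  proof -
    have "\<bar>sq_pos y - sq_pos t - 2 * max 0 t * (y - t)\<bar> \<le> (y - t)\<^sup>2"
    proof (cases "0 \<le> t")
      case t: True
      show ?thesis
      proof (cases "0 \<le> y")
        case True
        then have "sq_pos y - sq_pos t - 2 * max 0 t * (y - t) = (y - t)\<^sup>2"
          using t by (simp add: sq_pos_def power2_eq_square algebra_simps)
        then show ?thesis by simp
      next
        case False
        have "sq_pos y - sq_pos t - 2 * max 0 t * (y - t) = t * (t - 2 * y)"
          using False t by (simp add: sq_pos_def power2_eq_square algebra_simps)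
        moreover have "0 \<le> t * (t - 2 * y)" using False t by (intro mult_nonneg_nonneg) auto
        moreover have "t * (t - 2 * y) \<le> (y - t)\<^sup>2" by (simp add: power2_eq_square algebra_simps)
        ultimately show ?thesis by simp
      qed
    next
      case t: False
      show ?thesis
      proof (cases "0 \<le> y")
        case True
        then have "y\<^sup>2 \<le> (y - t)\<^sup>2" using t by (intro power_mono) auto
        then show ?thesis using t True by (simp add: sq_pos_def)
      qed (use t in \<open>simp add: sq_pos_def\<close>)
    qed
    then show ?thesis using that by (simp add: divide_le_eq power2_eq_square abs_mult[symmetric])
  qed
qed simp

lemma C1_sq_pos: "C1 f \<Longrightarrow> C1 (\<lambda>x. sq_pos (f x))"
  by (rule C1_compose[OF _ sq_pos_deriv]) (auto intro!: continuous_intros)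

lemma sq_pos_bounds: "0 \<le> sq_pos t" "t \<le> 1 \<Longrightarrow> sq_pos t \<le> 1" "t \<le> 0 \<Longrightarrow> sq_pos t = 0" "1 \<le> t \<Longrightarrow> 1 \<le> sq_pos t"
  by (auto simp: sq_pos_def power_le_one)

text \<open>Equal to 1 for \<open>\<bar>x - a\<bar> \<le> r\<close>, where the inner \<open>sq_pos\<close> vanishes, and to 0 for \<open>\<bar>x - a\<bar> \<ge> 2 r\<close>, where it is
  at least 1.\<close>

definition bump :: "'a::euclidean_space \<Rightarrow> real \<Rightarrow> 'a \<Rightarrow> real" where
  "bump a r x = sq_pos (1 - sq_pos ((x - a) \<bullet> (x - a) / r\<^sup>2 - 1))"

lemma bump_C1: "C1 (bump a r)"
proof -
  have "C1 (\<lambda>x :: 'a. (x - a) \<bullet> (x - a))"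
    by (rule C1I[where G = "\<lambda>x. 2 *\<^sub>R (x - a)"])
      (auto intro!: derivative_eq_intros continuous_intros simp: inner_commute)
  then have "C1 (\<lambda>x :: 'a. (x - a) \<bullet> (x - a) * (1 / r\<^sup>2) + -1)"
    by (intro C1_add C1_mult C1_const)
  then have "C1 (\<lambda>x :: 'a. 1 + -1 * sq_pos ((x - a) \<bullet> (x - a) * (1 / r\<^sup>2) + -1))"
    by (intro C1_add[OF C1_const] C1_mult[OF C1_const] C1_sq_pos)
  then show ?thesis unfolding bump_def using C1_sq_pos by fastforce
qed

lemma bump_range: "0 \<le> bump a r x" "bump a r x \<le> 1"
  using sq_pos_bounds by (auto simp: bump_def)

lemma bump_inside:
  assumes "r > 0" "dist a x \<le> r" shows "bump a r x = 1"
proof -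
  have "(x - a) \<bullet> (x - a) \<le> r\<^sup>2"
    using assms by (simp add: dot_square_norm dist_norm norm_minus_commute power_mono)
  then have "sq_pos ((x - a) \<bullet> (x - a) / r\<^sup>2 - 1) = 0"
    using assms by (intro sq_pos_bounds(3)) (simp add: divide_le_eq)
  then show ?thesis by (simp add: bump_def sq_pos_def)
qed

lemma bump_outside:
  assumes "r > 0" "dist a x \<ge> 2 * r" shows "bump a r x = 0"
proof -
  have "(2 * r)\<^sup>2 \<le> (x - a) \<bullet> (x - a)"
    using power_mono[of "2 * r" "norm (x - a)" 2] assms
    by (simp add: dot_square_norm dist_norm norm_minus_commute)
  moreover have "(2 * r)\<^sup>2 = 4 * r\<^sup>2" "0 \<le> r\<^sup>2" by (simp_all add: power_mult_distrib)
  ultimately have "2 * r\<^sup>2 \<le> (x - a) \<bullet> (x - a)" by linarith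
  then have "1 \<le> sq_pos ((x - a) \<bullet> (x - a) / r\<^sup>2 - 1)"
    using assms by (intro sq_pos_bounds(4)) (simp add: le_divide_eq)
  then show ?thesis unfolding bump_def by (intro sq_pos_bounds(3)) simp
qed

lemma C1_cutoff_exists:
  fixes K :: "'a::euclidean_space set"
  assumes K: "compact K" "K \<subseteq> \<Omega>" and \<Omega>: "open \<Omega>"
  shows "\<exists>\<zeta> K'. C1 \<zeta> \<and> (\<forall>x. 0 \<le> \<zeta> x \<and> \<zeta> x \<le> 1) \<and> (\<forall>x\<in>K. \<zeta> x = 1) \<and>
    compact K' \<and> K' \<subseteq> \<Omega> \<and> (\<forall>x. x \<notin> K' \<longrightarrow> \<zeta> x = 0)"
proof -
  obtain \<epsilon> where \<epsilon>: "\<epsilon> > 0" "(\<Union>x\<in>K. cball x \<epsilon>) \<subseteq> \<Omega>"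
    using compact_subset_open_imp_cball_epsilon_subset[OF K(1) \<Omega> K(2)] by blast
  define r where "r = \<epsilon> / 2"
  have r: "r > 0" using \<epsilon> by (simp add: r_def)
  obtain S where S: "S \<subseteq> K" "finite S" "K \<subseteq> (\<Union>a\<in>S. ball a r)"
  proof (rule compactE_image[OF K(1), of K "\<lambda>a. ball a r"])
    show "K \<subseteq> (\<Union>a\<in>K. ball a r)" using r by auto
  qed auto
  \<comment> \<open>equal to 1 wherever at least one of the bumps is\<close>
  define \<zeta> where "\<zeta> x = 1 + -1 * (\<Prod>a\<in>S. 1 + -1 * bump a r x)" for x
  define K' where "K' = (\<Union>a\<in>S. cball a (2 * r))"
  have p: "0 \<le> (\<Prod>a\<in>S. 1 + -1 * bump a r x)" "(\<Prod>a\<in>S. 1 + -1 * bump a r x) \<le> 1" for x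
    using bump_range[of _ r x] by (auto intro!: prod_nonneg prod_le_1)
  have "C1 \<zeta>" unfolding \<zeta>_def by (intro C1_add C1_mult C1_const C1_prod bump_C1)
  moreover have "0 \<le> \<zeta> x \<and> \<zeta> x \<le> 1" for x using p[of x] by (simp add: \<zeta>_def)
  moreover have "\<zeta> x = 1" if x: "x \<in> K" for x
  proof -
    obtain a where a: "a \<in> S" "dist a x < r" using S(3) x by auto
    then have "1 + -1 * bump a r x = 0" using bump_inside[OF r, of a x] by simp
    then show ?thesis using a(1) S(2) by (auto simp: \<zeta>_def intro!: prod_zero bexI[of _ a])
  qed
  moreover have "compact K'" unfolding K'_def using S(2) by (intro compact_UN) auto
  moreover have "K' \<subseteq> \<Omega>" using \<epsilon>(2) S(1) by (auto simp: K'_def r_def)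
  moreover have "\<zeta> x = 0" if x: "x \<notin> K'" for x
  proof -
    have "bump a r x = 0" if "a \<in> S" for a
      using that x by (intro bump_outside r) (force simp: K'_def)
    then show ?thesis by (simp add: \<zeta>_def)
  qed
  ultimately show ?thesis by blast
qed

lemma C1_compact_support_lipschitz:
  fixes f :: "'a::euclidean_space \<Rightarrow> real"
  assumes f: "C1 f" and K: "compact K" and f0: "\<And>x. x \<notin> K \<Longrightarrow> f x = 0"
  shows "\<exists>L. L-lipschitz_on UNIV f"
proof -
  obtain M where M: "\<And>x. x \<in> K \<Longrightarrow> norm (grad f x) \<le> M"
    using compact_imp_bounded[OF compact_continuous_image[OF C1_continuous_grad[OF f] K]]
    by (auto simp: bounded_iff)
  have out: "grad f x = 0" if x: "x \<notin> K" for x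
  proof (rule grad_eqI)
    show "(f has_derivative (\<lambda>v. v \<bullet> 0)) (at x)"
      using has_derivative_transform_within_open[of "\<lambda>_. 0" "\<lambda>_. 0" x UNIV "- K" f] x f0
        compact_imp_closed[OF K] by (simp add: open_Compl)
  qed
  have "norm (grad f x) \<le> max 0 M" for x using M[of x] out[of x] by (cases "x \<in> K") auto
  then have "onorm (\<lambda>v. v \<bullet> grad f x) \<le> max 0 M" for x
    by (intro onorm_le order_trans[OF Cauchy_Schwarz_ineq2[folded real_norm_def]])
      (auto simp: mult.commute[of "max 0 M"] intro!: mult_left_mono)
  then have "(max 0 M)-lipschitz_on UNIV f"
    by (intro bounded_derivative_imp_lipschitz[OF C1_has_derivative[OF f]]) auto
  then show ?thesis by blast
qed

text \<open>On a segment, the pieces are finitely many closed sets of parameters covering an interval, for which the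
  one-dimensional statement \<open>lipschitz_on_closed_Union\<close> is available.\<close>

lemma lipschitz_on_finite_closed_cover:
  fixes f :: "'a::real_normed_vector \<Rightarrow> 'b::metric_space"
  assumes I: "finite I" and U: "\<And>i. i \<in> I \<Longrightarrow> closed (U i)" "(\<Union>i\<in>I. U i) = UNIV"
    and lip: "\<And>i. i \<in> I \<Longrightarrow> \<exists>L. L-lipschitz_on (U i) f"
  shows "\<exists>L. L-lipschitz_on UNIV f"
proof -
  obtain L where L: "\<And>i. i \<in> I \<Longrightarrow> (L i)-lipschitz_on (U i) f" using lip by metis
  define M where "M = (\<Sum>i\<in>I. L i)"
  have Lpos: "0 \<le> L i" if "i \<in> I" for i using L[OF that] by (rule lipschitz_on_nonneg)
  then have M0: "0 \<le> M" unfolding M_def by (rule sum_nonneg)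
  have M: "M-lipschitz_on (U i) f" if "i \<in> I" for i
  proof (rule lipschitz_on_mono[OF L[OF that] order_refl])
    show "L i \<le> M" unfolding M_def by (rule member_le_sum[OF that _ I]) (use Lpos in auto)
  qed
  have "dist (f x) (f y) \<le> M * dist x y" for x y
  proof -
    define \<gamma> where "\<gamma> t = x + t *\<^sub>R (y - x)" for t :: real
    have \<gamma>: "continuous_on UNIV \<gamma>" unfolding \<gamma>_def by (intro continuous_intros)
    have "(M * dist x y)-lipschitz_on {0..1} (f \<circ> \<gamma>)"
    proof (rule lipschitz_on_closed_Union[where U = "\<lambda>i. \<gamma> -` U i" and I = I])
      show "(M * dist x y)-lipschitz_on (\<gamma> -` U i) (f \<circ> \<gamma>)" if "i \<in> I" for i
      proof (rule lipschitz_onI)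
        fix s t assume "s \<in> \<gamma> -` U i" "t \<in> \<gamma> -` U i"
        then have "dist (f (\<gamma> s)) (f (\<gamma> t)) \<le> M * dist (\<gamma> s) (\<gamma> t)"
          using lipschitz_onD[OF M[OF that]] by simp
        also have "dist (\<gamma> s) (\<gamma> t) = dist x y * dist s t"
          by (simp add: \<gamma>_def dist_norm norm_minus_commute[of x] flip: scaleR_diff_left)
        finally show "dist ((f \<circ> \<gamma>) s) ((f \<circ> \<gamma>) t) \<le> M * dist x y * dist s t" by simp
      qed (use M0 in simp)
      show "closed (\<gamma> -` U i)" if "i \<in> I" for i by (rule closed_vimage[OF U(1)[OF that] \<gamma>])
      show "{0..1} \<subseteq> (\<Union>i\<in>I. \<gamma> -` U i)" using U(2) by (auto simp flip: vimage_UN)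
    qed (use I M0 in auto)
    from lipschitz_onD[OF this, of 0 1] show ?thesis by (simp add: \<gamma>_def)
  qed
  then show ?thesis using M0 by (auto intro: lipschitz_onI)
qed

section \<open>Discrete functions of zero energy solve the homogeneous continuous problem\<close>

lemma Linf_mult:
  fixes f g :: "'a \<Rightarrow> real"
  assumes "f \<in> Linf M" "g \<in> Linf M" shows "(\<lambda>x. f x * g x) \<in> Linf M"
proof -
  obtain C D where C: "AE x in M. norm (f x) \<le> C" and D: "AE x in M. norm (g x) \<le> D"
    and m: "f \<in> borel_measurable M" "g \<in> borel_measurable M"
    using assms by (auto simp: Linf_def)
  have "AE x in M. norm (f x * g x) \<le> C * D"
    using C D by eventually_elim (simp add: abs_mult mult_mono)
  then show ?thesis using m by (auto simp: Linf_def)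
qed

lemma integrable_lebesgue_on_subset:
  fixes f :: "'a::euclidean_space \<Rightarrow> 'b::euclidean_space"
  assumes "integrable (lebesgue_on S) f" "S \<in> sets lebesgue" "T \<in> sets lebesgue" "T \<subseteq> S"
  shows "integrable (lebesgue_on T) f"
proof -
  have "set_integrable lebesgue S f"
    using assms(1,2) by (simp add: integrable_restrict_space set_integrable_def)
  then have "set_integrable lebesgue T f" by (rule set_integrable_subset) (use assms in auto)
  then show ?thesis using assms(3) by (simp add: integrable_restrict_space set_integrable_def)
qed

locale glued_polynomials = wg_mesh +
  fixes P :: "'a set \<Rightarrow> 'a \<Rightarrow> real" and r :: nat
  assumes P: "\<And>T. T \<in> \<T> \<Longrightarrow> P T \<in> polys r"
    and glue: "\<And>S T e y. S \<in> \<T> \<Longrightarrow> T \<in> \<T> \<Longrightarrow> e \<in> faces_of \<E> S \<Longrightarrow> e \<in> faces_of \<E> T \<Longrightarrow> y \<in> e \<Longrightarrow>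
      P S y = P T y"
begin

abbreviation \<mu> where "\<mu> \<equiv> lebesgue_on \<Omega>"

text \<open>On \<open>\<Omega>\<close> the choice of the element does not matter; at boundary points of \<open>\<Omega>\<close> the value may depend on it.\<close>

definition w :: "'a \<Rightarrow> real" where "w x = P (SOME T. T \<in> \<T> \<and> x \<in> T) x"

lemma w_eq_some: assumes "x \<in> closure \<Omega>" shows "\<exists>T\<in>\<T>. x \<in> T \<and> w x = P T x"
proof -
  have "\<exists>T. T \<in> \<T> \<and> x \<in> T" using assms elements_cover by blast
  then show ?thesis unfolding w_def by (rule someI2_ex) blast
qed

lemma w_eq: assumes "x \<in> \<Omega>" "T \<in> \<T>" "x \<in> T" shows "w x = P T x"
proof -
  obtain S where S: "S \<in> \<T>" "x \<in> S" "w x = P S x" using w_eq_some assms(1) closure_subset by blast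
  have "P S x = P T x"
    by (rule single_valued[where P = P and r = r]) (use P glue S assms in blast)+
  then show ?thesis using S(3) by simp
qed

lemma P_C1: "T \<in> \<T> \<Longrightarrow> C1 (P T)" by (rule polys_C1[OF P])

lemma w_bounded: "\<exists>B\<ge>0. \<forall>x\<in>\<Omega>. \<bar>w x\<bar> \<le> B"
proof -
  have "\<exists>B. \<forall>x\<in>T. \<bar>P T x\<bar> \<le> B" if T: "T \<in> \<T>" for T
    using compact_imp_bounded[OF compact_continuous_image[OF C1_continuous[OF P_C1[OF T]] element(1)[OF T]]]
    by (simp add: bounded_real)
  then obtain B where B: "\<And>T x. T \<in> \<T> \<Longrightarrow> x \<in> T \<Longrightarrow> \<bar>P T x\<bar> \<le> B T" by metis
  have "\<bar>w x\<bar> \<le> (\<Sum>T\<in>\<T>. \<bar>B T\<bar>)" if x: "x \<in> \<Omega>" for x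
  proof -
    obtain T where T: "T \<in> \<T>" "x \<in> T" "w x = P T x" using w_eq_some x closure_subset by blast
    have "\<bar>w x\<bar> \<le> \<bar>B T\<bar>" using B[OF T(1,2)] T(3) by simp
    also have "\<dots> \<le> (\<Sum>T\<in>\<T>. \<bar>B T\<bar>)" using T(1) finite_mesh(1) by (intro member_le_sum) auto
    finally show ?thesis .
  qed
  then show ?thesis by (intro exI[of _ "\<Sum>T\<in>\<T>. \<bar>B T\<bar>"]) (auto intro: sum_nonneg)
qed

lemma domain_sets: "\<Omega> \<in> sets lebesgue" using open_domain by auto

lemma AE_domain_interior: "AE x in \<mu>. \<exists>T\<in>\<T>. x \<in> interior T"
proof -
  have "AE x in lebesgue. \<forall>T\<in>\<T>. x \<notin> frontier T"
    using finite_mesh(1) element(6)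
    by (intro AE_finite_allI) (auto simp: negligible_iff_null_sets AE_not_in)
  then have "AE x in lebesgue. x \<in> \<Omega> \<longrightarrow> (\<exists>T\<in>\<T>. x \<in> interior T)"
  proof eventually_elim
    case (elim x)
    show ?case
    proof
      assume "x \<in> \<Omega>"
      then obtain T where "T \<in> \<T>" "x \<in> T" using elements_cover closure_subset by blast
      then show "\<exists>T\<in>\<T>. x \<in> interior T"
        using elim closure_subset[of T] by (auto simp: frontier_def)
    qed
  qed
  then show ?thesis using domain_sets by (simp add: AE_restrict_space_iff)
qed

lemma w_measurable: "w \<in> borel_measurable \<mu>"
proof (rule measurable_lebesgue_on_AE[OF domain_sets])
  let ?W = "\<lambda>x. \<Sum>T\<in>\<T>. indicator (interior T) x *\<^sub>R P T x"
  have "?W \<in> borel_measurable borel"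
    by (intro borel_measurable_sum borel_measurable_continuous_on_indicator C1_continuous[OF P_C1]) auto
  then have "?W \<in> borel_measurable lebesgue" by (intro measurable_completion) simp
  then show "?W \<in> borel_measurable \<mu>" by (rule measurable_restrict_space1)
  have "AE x in \<mu>. x \<in> \<Omega>" using AE_space[of "\<mu>"] by simp
  with AE_domain_interior show "AE x in \<mu>. ?W x = w x"
  proof eventually_elim
    case (elim x)
    then obtain T where T: "T \<in> \<T>" "x \<in> interior T" by blast
    have "?W x = (\<Sum>S\<in>\<T>. if S = T then P T x else 0)"
      using T interiors_disjoint[of _ T] interior_subset by (intro sum.cong) (auto simp: indicator_def)
    also have "\<dots> = w x"
      using T(1) elim(2) finite_mesh(1) w_eq[of x T] subsetD[OF interior_subset T(2)] by simp
    finally show ?case .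
  qed
qed

lemma w_Linf: "w \<in> Linf \<mu>"
proof -
  obtain B where "\<And>x. x \<in> \<Omega> \<Longrightarrow> \<bar>w x\<bar> \<le> B" using w_bounded by blast
  then have "AE x in \<mu>. norm (w x) \<le> B" by (intro AE_I2) simp
  then show ?thesis using w_measurable by (auto simp: Linf_def)
qed

lemma finite_measure_domain: "finite_measure \<mu>"
  using open_domain bounded_domain by (intro finite_measure_lebesgue_on lmeasurable_open)

text \<open>The gradient of \<open>w \<zeta>\<close> inside the elements, extended by 0.\<close>

definition cut_grad :: "('a \<Rightarrow> real) \<Rightarrow> 'a \<Rightarrow> 'a" where
  "cut_grad \<zeta> x = (if \<exists>T\<in>\<T>. x \<in> interior T
     then grad (\<lambda>y. P (SOME T. T \<in> \<T> \<and> x \<in> T) y * \<zeta> y) x else 0)"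

lemma cut_grad_eq:
  assumes "T \<in> \<T>" "x \<in> interior T"
  shows "cut_grad \<zeta> x = grad (\<lambda>y. P T y * \<zeta> y) x"
proof -
  have "(SOME T. T \<in> \<T> \<and> x \<in> T) = T"
    using assms interiors_disjoint[OF assms(1)] interior_subset by (intro some_equality) blast+
  then show ?thesis using assms by (auto simp: cut_grad_def)
qed

text \<open>The product \<open>w \<zeta>\<close> is Lipschitz on each of the closed sets \<open>T \<inter> K\<close> and vanishes on the closed set where \<open>\<zeta>\<close> does;
  these sets cover the space. The exceptional null set consists of the element boundaries.\<close>

lemma cut_test_function:
  assumes \<zeta>: "C1 \<zeta>" "\<And>x. 0 \<le> \<zeta> x \<and> \<zeta> x \<le> 1" and K: "compact K" "K \<subseteq> \<Omega>"
    and \<zeta>0: "\<And>x. x \<notin> K \<Longrightarrow> \<zeta> x = 0"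
  shows "\<exists>L B. lipschitz_ae_C1 (\<lambda>x. w x * \<zeta> x) (cut_grad \<zeta>) L B ((\<Union>T\<in>\<T>. interior T) \<union> - closure \<Omega>)"
proof -
  let ?f = "\<lambda>x. w x * \<zeta> x" and ?U = "(\<Union>T\<in>\<T>. interior T) \<union> - closure \<Omega>"
  have C1P: "C1 (\<lambda>x. P T x * \<zeta> x)" if "T \<in> \<T>" for T by (rule C1_mult[OF P_C1[OF that] \<zeta>(1)])
  have "\<exists>L. L-lipschitz_on UNIV ?f"
  proof (rule lipschitz_on_finite_closed_cover[where U = "\<lambda>S. S" and I = "insert {x. \<zeta> x = 0} ((\<lambda>T. T \<inter> K) ` \<T>)"])
    show "finite (insert {x. \<zeta> x = 0} ((\<lambda>T. T \<inter> K) ` \<T>))" using finite_mesh by simp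
    have "closed {x. \<zeta> x = 0}" by (intro closed_Collect_eq C1_continuous[OF \<zeta>(1)] continuous_on_const)
    then show "closed S" if "S \<in> insert {x. \<zeta> x = 0} ((\<lambda>T. T \<inter> K) ` \<T>)" for S
      using that element(2) compact_imp_closed[OF K(1)] by auto
    have "x \<in> (\<Union>T\<in>\<T>. T \<inter> K)" if "\<zeta> x \<noteq> 0" for x
    proof -
      have "x \<in> K" using that \<zeta>0 by blast
      moreover from this obtain T where "T \<in> \<T>" "x \<in> T"
        using subsetD[OF K(2)] subsetD[OF closure_subset, of x \<Omega>] by (auto simp flip: elements_cover)
      ultimately show ?thesis by blast
    qed
    then show "(\<Union>S\<in>insert {x. \<zeta> x = 0} ((\<lambda>T. T \<inter> K) ` \<T>). S) = UNIV" by blast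
    show "\<exists>L. L-lipschitz_on S ?f" if "S \<in> insert {x. \<zeta> x = 0} ((\<lambda>T. T \<inter> K) ` \<T>)" for S
      using that
    proof (elim insertE imageE)
      assume "S = {x. \<zeta> x = 0}"
      then have "0-lipschitz_on S ?f" by (intro lipschitz_onI) auto
      then show ?thesis by blast
    next
      fix T assume T: "T \<in> \<T>" "S = T \<inter> K"
      obtain L where L: "L-lipschitz_on UNIV (\<lambda>x. P T x * \<zeta> x)"
        using C1_compact_support_lipschitz[OF C1P[OF T(1)] K(1)] \<zeta>0 by auto
      have "?f x = P T x * \<zeta> x" if "x \<in> S" for x using w_eq[of x T] that T K(2) by auto
      then have "L-lipschitz_on S ?f"
        using lipschitz_onD[OF L] lipschitz_on_nonneg[OF L] by (intro lipschitz_onI) (simp_all only: UNIV_I)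
      then show ?thesis by blast
    qed
  qed
  then obtain L where L: "L-lipschitz_on UNIV ?f" by blast
  obtain B where B: "B \<ge> 0" "\<And>x. x \<in> \<Omega> \<Longrightarrow> \<bar>w x\<bar> \<le> B" using w_bounded by blast
  have "lipschitz_ae_C1 ?f (cut_grad \<zeta>) L B ?U"
  proof
    show "L-lipschitz_on UNIV ?f" by (rule L)
    show "\<bar>?f x\<bar> \<le> B" for x
    proof (cases "x \<in> K")
      case True
      then have "\<bar>w x\<bar> * \<bar>\<zeta> x\<bar> \<le> B * 1" using B K(2) \<zeta>(2)[of x] by (intro mult_mono) auto
      then show ?thesis by (simp add: abs_mult)
    qed (use B \<zeta>0 in simp)
    show "open ?U" by (intro open_Un open_UN) auto
    have "- ?U \<subseteq> \<Union>(frontier ` \<T>)"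
    proof
      fix x assume x: "x \<in> - ?U"
      then have "x \<in> \<Union>\<T>" using elements_cover by auto
      then obtain T where T: "T \<in> \<T>" "x \<in> T" by blast
      then have "x \<in> frontier T" using x subsetD[OF closure_subset T(2)] by (auto simp: frontier_def)
      then show "x \<in> \<Union>(frontier ` \<T>)" using T(1) by blast
    qed
    moreover have "negligible (\<Union>(frontier ` \<T>))"
      using finite_mesh(1) element(6) by (intro negligible_Union) auto
    ultimately show "negligible (- ?U)" by (rule negligible_subset[rotated])
    have out: "cut_grad \<zeta> x = 0" if "x \<in> - closure \<Omega>" for x
      using that elements_cover interior_subset by (fastforce simp: cut_grad_def)
    show "(?f has_derivative (\<lambda>v. v \<bullet> cut_grad \<zeta> x)) (at x)" if "x \<in> ?U" for x
      using that
    proof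
      assume x: "x \<in> - closure \<Omega>"
      have "?f y = 0" if "y \<in> - closure \<Omega>" for y
        using \<zeta>0[of y] K(2) that closure_subset[of \<Omega>] by auto
      then have "(?f has_derivative (\<lambda>v. 0)) (at x)"
        using has_derivative_transform_within_open[of "\<lambda>_. 0" "\<lambda>_. 0" x UNIV "- closure \<Omega>" ?f] x
        by (simp add: open_Compl)
      then show ?thesis by (simp add: out[OF x])
    next
      assume "x \<in> (\<Union>T\<in>\<T>. interior T)"
      then obtain T where T: "T \<in> \<T>" "x \<in> interior T" by blast
      have "P T y * \<zeta> y = ?f y" if "y \<in> interior T" for y
        using w_eq[of y T] T(1) subsetD[OF interior_element_subset[OF T(1)] that]
          subsetD[OF interior_subset that] by simp
      then show ?thesis
        using has_derivative_transform_within_open[OF C1_has_derivative[OF C1P[OF T(1)]] open_interior T(2), of ?f]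
        by (simp add: cut_grad_eq[OF T])
    qed
    have "continuous_on (interior T) (cut_grad \<zeta>)" if T: "T \<in> \<T>" for T
      by (rule continuous_on_eq[OF C1_continuous_grad[OF C1P[OF T]]]) (simp add: cut_grad_eq[OF T])
    moreover have "continuous_on (- closure \<Omega>) (cut_grad \<zeta>)"
      by (rule continuous_on_eq[OF continuous_on_const[of _ 0]]) (simp add: out)
    ultimately show "continuous_on ?U (cut_grad \<zeta>)"
      by (intro continuous_on_open_Un continuous_on_open_UN open_UN) (auto simp: open_Compl)
    show "cut_grad \<zeta> x = 0" if "x \<notin> ?U" for x using that by (auto simp: cut_grad_def)
  qed
  then show ?thesis by blast
qed

text \<open>There are no jumps, so \<open>w \<zeta>\<^sub>n\<close> can be used as a test function in \<open>div (\<phi> \<beta>) = q\<close>, with cutoffs \<open>\<zeta>\<^sub>n\<close> that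
  equal 1 on the support of \<open>\<phi>\<close> and tend to 1 on \<open>\<Omega>\<close>. The left side does not depend on \<open>n\<close>, and the limit \<open>n \<rightarrow> \<infinity>\<close> removes
  the cutoff from the right side.\<close>

lemma w_directional_deriv:
  assumes eq: "\<And>T. T \<in> \<T> \<Longrightarrow> AE x in lebesgue_on T. conv_op \<beta> c (P T) x = 0"
  shows "has_directional_deriv \<Omega> \<beta> w (\<lambda>x. c x * w x)"
  unfolding has_directional_deriv_def
proof (intro allI impI, elim conjE)
  fix \<phi> q
  assume \<phi>: "\<phi> \<in> Linf \<mu>" and cs: "compactly_supported_in \<Omega> \<phi>"
    and q: "q \<in> L2 \<mu>" and div: "has_weak_divergence \<Omega> (\<lambda>x. \<phi> x *\<^sub>R \<beta> x) q"
  interpret finite_measure "\<mu>" by (rule finite_measure_domain)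
  obtain K where K: "compact K" "K \<subseteq> \<Omega>" "\<And>x. x \<notin> K \<Longrightarrow> \<phi> x = 0"
    using cs by (auto simp: compactly_supported_in_def)
  have qi: "integrable \<mu> q" by (rule L2_integrable[OF finite_measure_domain q])
  have \<psi>i: "integrable \<mu> (\<lambda>x. \<phi> x *\<^sub>R \<beta> x)"
  proof -
    obtain C D where C: "AE x in \<mu>. norm (\<phi> x) \<le> C" and D: "AE x in \<mu>. norm (\<beta> x) \<le> D"
      and m: "\<phi> \<in> borel_measurable \<mu>" "\<beta> \<in> borel_measurable \<mu>"
      using \<phi> bounded_\<beta> by (auto simp: Linf_def)
    have "AE x in \<mu>. norm (\<phi> x *\<^sub>R \<beta> x) \<le> C * D"
      using C D by eventually_elim (simp add: mult_mono)
    then show ?thesis using m by (intro integrable_const_bound) auto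
  qed
  obtain C where "\<And>n. compact (C n)" "\<And>n. C n \<subseteq> \<Omega>" "\<And>n. C n \<subseteq> interior (C (Suc n))" "\<Union>(range C) = \<Omega>"
    "\<And>S. compact S \<Longrightarrow> S \<subseteq> \<Omega> \<Longrightarrow> \<exists>N. \<forall>n\<ge>N. S \<subseteq> C n"
    using that by (rule open_Union_compact_subsets[OF open_domain])
  note C = this(1,2,5)
  have "\<exists>\<zeta> K'. C1 \<zeta> \<and> (\<forall>x. 0 \<le> \<zeta> x \<and> \<zeta> x \<le> 1) \<and> (\<forall>x\<in>K \<union> C n. \<zeta> x = 1) \<and>
    compact K' \<and> K' \<subseteq> \<Omega> \<and> (\<forall>x. x \<notin> K' \<longrightarrow> \<zeta> x = 0)" for n
    by (rule C1_cutoff_exists) (use K C open_domain in auto)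
  then obtain \<zeta> K' where \<zeta>: "\<And>n. C1 (\<zeta> n)" "\<And>n x. 0 \<le> \<zeta> n x \<and> \<zeta> n x \<le> 1"
      "\<And>n x. x \<in> K \<union> C n \<Longrightarrow> \<zeta> n x = 1"
    and K': "\<And>n. compact (K' n)" "\<And>n. K' n \<subseteq> \<Omega>" "\<And>n x. x \<notin> K' n \<Longrightarrow> \<zeta> n x = 0"
    by metis
  have eqae: "AE x in \<mu>. \<forall>T\<in>\<T>. x \<in> T \<longrightarrow> conv_op \<beta> c (P T) x = 0"
  proof -
    have "AE x in lebesgue. \<forall>T\<in>\<T>. x \<in> T \<longrightarrow> conv_op \<beta> c (P T) x = 0"
      using finite_mesh(1) eq element(7) by (intro AE_finite_allI) (auto simp: AE_restrict_space_iff)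
    then show ?thesis using domain_sets by (subst AE_restrict_space_iff) auto
  qed
  have const: "ip \<mu> (\<lambda>x. c x * w x) \<phi> = - ip \<mu> q (\<lambda>x. w x * \<zeta> n x)" for n
  proof -
    obtain L B where "lipschitz_ae_C1 (\<lambda>x. w x * \<zeta> n x) (cut_grad (\<zeta> n)) L B ((\<Union>T\<in>\<T>. interior T) \<union> - closure \<Omega>)"
      using cut_test_function[OF \<zeta>(1,2) K'] by blast
    then interpret lipschitz_ae_C1 "\<lambda>x. w x * \<zeta> n x" "cut_grad (\<zeta> n)" L B "(\<Union>T\<in>\<T>. interior T) \<union> - closure \<Omega>" .
    have test: "(\<integral>x. (\<phi> x *\<^sub>R \<beta> x) \<bullet> cut_grad (\<zeta> n) x \<partial>\<mu>) = - ip \<mu> q (\<lambda>x. w x * \<zeta> n x)"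
      by (rule weak_divergence_test[OF div open_domain \<psi>i qi K'(1)[of n] K'(2)[of n]]) (simp add: K'(3))
    have ae: "AE x in \<mu>. (\<phi> x *\<^sub>R \<beta> x) \<bullet> cut_grad (\<zeta> n) x = c x * w x * \<phi> x"
      using AE_domain_interior eqae
    proof eventually_elim
      case (elim x)
      show ?case
      proof (cases "x \<in> K")
        case True
        obtain T where T: "T \<in> \<T>" "x \<in> interior T" using elim(1) by blast
        then have xT: "x \<in> T" using interior_subset by blast
        \<comment> \<open>the cutoff attains its maximum at \<open>x\<close>\<close>
        have "(\<lambda>v. v \<bullet> grad (\<zeta> n) x) = (\<lambda>v. 0)"
          by (rule differential_zero_maxmin[OF _ open_UNIV C1_has_derivative[OF \<zeta>(1)]])
            (use \<zeta>(2) \<zeta>(3)[of x n] True in auto)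
        then have "grad (\<zeta> n) x \<bullet> grad (\<zeta> n) x = 0" by meson
        then have "cut_grad (\<zeta> n) x = grad (P T) x"
          using \<zeta>(3)[of x n] True by (simp add: cut_grad_eq[OF T] grad_mult P_C1 T(1) \<zeta>(1))
        moreover have "\<beta> x \<bullet> grad (P T) x = c x * P T x"
          using elim(2) T(1) xT by (auto simp: conv_op_def)
        moreover have "w x = P T x" using w_eq[OF _ T(1) xT] True K(2) by blast
        ultimately show ?thesis by simp
      qed (simp add: K(3))
    qed
    have m: "(\<lambda>x. (\<phi> x *\<^sub>R \<beta> x) \<bullet> cut_grad (\<zeta> n) x) \<in> borel_measurable \<mu>"
    proof -
      have "cut_grad (\<zeta> n) \<in> borel_measurable lebesgue" using G_measurable by (intro measurable_completion) simp
      then have "cut_grad (\<zeta> n) \<in> borel_measurable \<mu>" by (rule measurable_restrict_space1)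
      then show ?thesis using borel_measurable_integrable[OF \<psi>i] by (rule borel_measurable_inner[rotated])
    qed
    have "ip \<mu> (\<lambda>x. c x * w x) \<phi> = (\<integral>x. (\<phi> x *\<^sub>R \<beta> x) \<bullet> cut_grad (\<zeta> n) x \<partial>\<mu>)"
      unfolding ip_def
      by (rule integral_cong_AE[symmetric, OF m measurable_lebesgue_on_AE[OF domain_sets m ae] ae])
    then show ?thesis using test by simp
  qed
  obtain B where B: "B \<ge> 0" "\<And>x. x \<in> \<Omega> \<Longrightarrow> \<bar>w x\<bar> \<le> B" using w_bounded by blast
  have \<zeta>m: "\<zeta> n \<in> borel_measurable \<mu>" for n
    by (intro continuous_imp_measurable_on_sets_lebesgue C1_continuous[OF \<zeta>(1)] domain_sets)
  have "(\<lambda>n. \<integral>x. q x * (w x * \<zeta> n x) \<partial>\<mu>) \<longlonglongrightarrow> (\<integral>x. q x * w x \<partial>\<mu>)"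
  proof (rule integral_dominated_convergence[where w = "\<lambda>x. \<bar>q x\<bar> * B"])
    show "(\<lambda>x. q x * w x) \<in> borel_measurable \<mu>"
      "(\<lambda>x. q x * (w x * \<zeta> n x)) \<in> borel_measurable \<mu>" for n
      using borel_measurable_integrable[OF qi] w_measurable \<zeta>m[of n] by measurable
    show "integrable \<mu> (\<lambda>x. \<bar>q x\<bar> * B)" using qi by simp
    show "AE x in \<mu>. (\<lambda>n. q x * (w x * \<zeta> n x)) \<longlonglongrightarrow> q x * w x"
    proof (rule AE_I2)
      fix x assume "x \<in> space \<mu>"
      then obtain N where "\<forall>n\<ge>N. {x} \<subseteq> C n" using C(3)[of "{x}"] by auto
      then have "\<forall>\<^sub>F n in sequentially. q x * (w x * \<zeta> n x) = q x * w x"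
        unfolding eventually_sequentially using \<zeta>(3)[of x] by (intro exI[of _ N]) auto
      then show "(\<lambda>n. q x * (w x * \<zeta> n x)) \<longlonglongrightarrow> q x * w x" by (rule tendsto_eventually)
    qed
    show "AE x in \<mu>. norm (q x * (w x * \<zeta> n x)) \<le> \<bar>q x\<bar> * B" for n
    proof (rule AE_I2)
      fix x assume "x \<in> space \<mu>"
      then have "\<bar>w x\<bar> * \<bar>\<zeta> n x\<bar> \<le> B * 1" using B \<zeta>(2)[of n x] by (intro mult_mono) auto
      then show "norm (q x * (w x * \<zeta> n x)) \<le> \<bar>q x\<bar> * B" by (simp add: abs_mult mult_left_mono)
    qed
  qed
  moreover have "(\<integral>x. q x * (w x * \<zeta> n x) \<partial>\<mu>) = - ip \<mu> (\<lambda>x. c x * w x) \<phi>" for n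
    using const[of n] by (simp add: ip_def[of _ q])
  ultimately have "(\<lambda>n :: nat. - ip \<mu> (\<lambda>x. c x * w x) \<phi>) \<longlonglongrightarrow> ip \<mu> q w"
    by (simp add: ip_def[of _ q])
  then show "ip \<mu> (\<lambda>x. c x * w x) \<phi> = - ip \<mu> w q"
    using LIMSEQ_unique[OF tendsto_const] ip_commute by (metis minus_equation_iff)
qed

lemma w_small_near_zero:
  assumes 0: "\<And>T. T \<in> \<T> \<Longrightarrow> x \<in> T \<Longrightarrow> P T x = 0" and \<epsilon>: "\<epsilon> > 0"
  shows "\<exists>\<delta>>0. \<forall>y\<in>\<Omega> \<inter> ball x \<delta>. \<bar>w y\<bar> \<le> \<epsilon>"
proof -
  have "\<forall>\<^sub>F y in nhds x. y \<in> T \<longrightarrow> \<bar>P T y\<bar> \<le> \<epsilon>" if T: "T \<in> \<T>" for T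
  proof (cases "x \<in> T")
    case True
    have "isCont (P T) x" using C1_has_derivative[OF P_C1[OF T]] has_derivative_continuous by blast
    then have "(P T \<longlongrightarrow> P T x) (nhds x)"
      by (simp add: isCont_def tendsto_at_iff_tendsto_nhds)
    then have "\<forall>\<^sub>F y in nhds x. dist (P T y) 0 < \<epsilon>"
      using \<epsilon> 0[OF T True] by (auto dest: tendstoD)
    then show ?thesis by eventually_elim simp
  next
    case False
    then have "\<forall>\<^sub>F y in nhds x. y \<in> - T"
      using element(2)[OF T] by (intro eventually_nhds_in_open) auto
    then show ?thesis by eventually_elim simp
  qed
  then have "\<forall>\<^sub>F y in nhds x. \<forall>T\<in>\<T>. y \<in> T \<longrightarrow> \<bar>P T y\<bar> \<le> \<epsilon>"
    using finite_mesh(1) by (simp add: eventually_ball_finite_distrib)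
  then obtain \<delta> where \<delta>: "\<delta> > 0" "\<And>y T. dist y x < \<delta> \<Longrightarrow> T \<in> \<T> \<Longrightarrow> y \<in> T \<Longrightarrow> \<bar>P T y\<bar> \<le> \<epsilon>"
    unfolding eventually_nhds_metric by blast
  have "\<bar>w y\<bar> \<le> \<epsilon>" if y: "y \<in> \<Omega> \<inter> ball x \<delta>" for y
  proof -
    obtain T where T: "T \<in> \<T>" "y \<in> T" "w y = P T y" using w_eq_some y closure_subset by blast
    then show ?thesis using \<delta>(2)[of y T] y by (simp add: dist_commute)
  qed
  with \<delta>(1) show ?thesis by blast
qed

text \<open>At almost every point \<open>x\<close> of the face, all elements near \<open>x\<close> have the face, so \<open>w\<close> tends to 0 at \<open>x\<close> and so
  do its means.\<close>

lemma has_trace_add_w: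
  assumes e: "e \<in> faces_of \<E> \<Omega>" and w0: "w0 \<in> L2 \<mu>" and tr: "has_trace \<Omega> w0 g e"
    and 0: "\<And>T x. T \<in> \<T> \<Longrightarrow> e \<in> faces_of \<E> T \<Longrightarrow> x \<in> e \<Longrightarrow> P T x = 0"
  shows "has_trace \<Omega> (\<lambda>x. w0 x + w x) g e"
  unfolding has_trace_def
  using AE_boundary_face[OF e] tr[unfolded has_trace_def] AE_space
proof eventually_elim
  case (elim x)
  let ?A = "\<lambda>r. lebesgue_on (\<Omega> \<inter> ball x r)" and ?m = "\<lambda>r. measure lebesgue (\<Omega> \<inter> ball x r)"
  let ?H = "\<lambda>r. (\<integral>y. \<bar>w0 y - g x\<bar> \<partial>?A r) / ?m r" and ?F = "\<lambda>r. (\<integral>y. \<bar>w0 y + w y - g x\<bar> \<partial>?A r) / ?m r"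
  have xe: "x \<in> e" using elim(3) by (simp add: space_face_measure)
  have zero: "P T x = 0" if "T \<in> \<T>" "x \<in> T" for T using 0[OF that(1) _ xe] elim(1) that by blast
  have lm: "\<Omega> \<inter> ball x r \<in> lmeasurable" for r
    using open_domain bounded_domain by (intro lmeasurable_open open_Int bounded_Int) auto
  have sub: "integrable (?A r) f" if "integrable \<mu> f" for f :: "'a \<Rightarrow> real" and r
    by (rule integrable_lebesgue_on_subset[OF that domain_sets]) (use lm in auto)
  have int: "integrable (?A r) w0" "integrable (?A r) w" "integrable (?A r) (\<lambda>y. a)" for r and a :: real
    using sub L2_integrable[OF finite_measure_domain w0]
      L2_integrable[OF finite_measure_domain Linf_L2[OF finite_measure_domain w_Linf]]
      finite_measure.integrable_const[OF finite_measure_lebesgue_on[OF lm]] by auto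
  have F_nonneg: "0 \<le> ?F r" for r by (intro divide_nonneg_nonneg) auto
  show "(?F \<longlongrightarrow> 0) (at_right 0)"
  proof (rule tendstoI)
    fix \<epsilon> :: real assume \<epsilon>: "\<epsilon> > 0"
    obtain \<delta> where \<delta>: "\<delta> > 0" "\<And>y. y \<in> \<Omega> \<inter> ball x \<delta> \<Longrightarrow> \<bar>w y\<bar> \<le> \<epsilon> / 2"
      using w_small_near_zero[OF zero, of "\<epsilon> / 2"] \<epsilon> by auto
    have "\<forall>\<^sub>F r in at_right 0. dist (?H r) 0 < \<epsilon> / 2"
      using \<epsilon> by (intro tendstoD[OF elim(2)]) simp
    moreover have "\<forall>\<^sub>F r in at_right 0. r < \<delta>"
      using \<delta>(1) by (intro eventually_at_rightI[of 0 \<delta>]) auto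
    ultimately show "\<forall>\<^sub>F r in at_right 0. dist (?F r) 0 < \<epsilon>"
    proof eventually_elim
      case (elim r)
      have "(\<integral>y. \<bar>w0 y + w y - g x\<bar> \<partial>?A r) \<le> (\<integral>y. \<bar>w0 y - g x\<bar> + \<epsilon> / 2 \<partial>?A r)"
      proof (rule integral_mono)
        show "\<bar>w0 y + w y - g x\<bar> \<le> \<bar>w0 y - g x\<bar> + \<epsilon> / 2" if "y \<in> space (?A r)" for y
          using \<delta>(2)[of y] that elim(2) by (auto simp: abs_if split: if_splits)
      qed (use int in auto)
      also have "\<dots> = (\<integral>y. \<bar>w0 y - g x\<bar> \<partial>?A r) + \<epsilon> / 2 * ?m r"
        using int lm by (simp add: measure_restrict_space fmeasurableD)
      finally have "?F r \<le> ((\<integral>y. \<bar>w0 y - g x\<bar> \<partial>?A r) + \<epsilon> / 2 * ?m r) / ?m r"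
        by (rule divide_right_mono) simp
      also have "\<dots> \<le> ?H r + \<epsilon> / 2" using \<epsilon> by (simp add: add_divide_distrib)
      finally show ?case using elim(1) F_nonneg[of r] unfolding dist_real_def by linarith
    qed
  qed
qed

lemma cp_solution_add_w:
  assumes eq: "\<And>T. T \<in> \<T> \<Longrightarrow> AE x in lebesgue_on T. conv_op \<beta> c (P T) x = 0"
    and 0: "\<And>e T x. e \<in> inflow_faces \<Omega> \<beta> \<E> \<Longrightarrow> T \<in> \<T> \<Longrightarrow> e \<in> faces_of \<E> T \<Longrightarrow> x \<in> e \<Longrightarrow> P T x = 0"
    and w0: "cp_solution \<Omega> \<beta> c f g \<E> w0"
  shows "cp_solution \<Omega> \<beta> c f g \<E> (\<lambda>x. w0 x + w x)"
proof -
  note fin = finite_measure_domain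
  obtain r0 where r0: "r0 \<in> L2 \<mu>" "has_directional_deriv \<Omega> \<beta> w0 r0"
    "\<And>v. v \<in> L2 \<mu> \<Longrightarrow>
      ip \<mu> (\<lambda>x. r0 x - c x * w0 x) v = ip \<mu> f v"
    using w0 by (auto simp: cp_solution_def)
  have w0L: "w0 \<in> L2 \<mu>" using w0 by (auto simp: cp_solution_def H1_beta_def)
  have wL: "w \<in> L2 \<mu>" by (rule Linf_L2[OF fin w_Linf])
  have cwL: "(\<lambda>x. c x * w x) \<in> L2 \<mu>" by (rule Linf_L2[OF fin Linf_mult[OF bounded_c w_Linf]])
  let ?r = "\<lambda>x. r0 x + c x * w x"
  have rL: "?r \<in> L2 \<mu>" by (rule L2_add[OF r0(1) cwL])
  have dd: "has_directional_deriv \<Omega> \<beta> (\<lambda>x. w0 x + w x) ?r"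
    unfolding has_directional_deriv_def
  proof (intro allI impI)
    fix \<phi> q
    assume a: "\<phi> \<in> Linf \<mu> \<and> compactly_supported_in \<Omega> \<phi> \<and> q \<in> L2 \<mu> \<and>
        has_weak_divergence \<Omega> (\<lambda>x. \<phi> x *\<^sub>R \<beta> x) q"
    then have \<phi>: "\<phi> \<in> L2 \<mu>" and q: "q \<in> L2 \<mu>" using Linf_L2[OF fin] by auto
    have "ip \<mu> ?r \<phi> = 1 * ip \<mu> r0 \<phi> + ip \<mu> (\<lambda>x. c x * w x) \<phi>"
      by (rule ip_combination[OF L2_mult_integrable[OF r0(1) \<phi>] L2_mult_integrable[OF cwL \<phi>]]) simp
    moreover have "ip \<mu> (\<lambda>x. w0 x + w x) q = 1 * ip \<mu> w0 q + ip \<mu> w q"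
      by (rule ip_combination[OF L2_mult_integrable[OF w0L q] L2_mult_integrable[OF wL q]]) simp
    ultimately show "ip \<mu> ?r \<phi> = - ip \<mu> (\<lambda>x. w0 x + w x) q"
      using r0(2)[unfolded has_directional_deriv_def, rule_format, OF a]
        w_directional_deriv[OF eq, unfolded has_directional_deriv_def, rule_format, OF _ a] by simp
  qed
  have "has_trace \<Omega> (\<lambda>x. w0 x + w x) g e" if e: "e \<in> inflow_faces \<Omega> \<beta> \<E>" for e
    using w0 e 0[OF e] by (intro has_trace_add_w w0L) (auto simp: cp_solution_def inflow_faces_def)
  moreover have "(\<lambda>x. ?r x - c x * (w0 x + w x)) = (\<lambda>x. r0 x - c x * w0 x)"
    by (simp add: algebra_simps)
  ultimately show ?thesis
    using L2_add[OF w0L wL] rL dd r0(3) unfolding cp_solution_def H1_beta_def by auto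
qed

text \<open>Adding \<open>w\<close> to the solution of the continuous problem gives a second one.\<close>

lemma glued_zero_if_cp_unique:
  assumes eq: "\<And>T. T \<in> \<T> \<Longrightarrow> AE x in lebesgue_on T. conv_op \<beta> c (P T) x = 0"
    and 0: "\<And>e T x. e \<in> inflow_faces \<Omega> \<beta> \<E> \<Longrightarrow> T \<in> \<T> \<Longrightarrow> e \<in> faces_of \<E> T \<Longrightarrow> x \<in> e \<Longrightarrow> P T x = 0"
    and cp: "cp_uniquely_solvable \<Omega> \<beta> c f g \<E>" and T: "T \<in> \<T>"
  shows "P T = (\<lambda>x. 0)"
proof -
  obtain w0 where w0: "cp_solution \<Omega> \<beta> c f g \<E> w0" using cp by (auto simp: cp_uniquely_solvable_def)
  have sol: "cp_solution \<Omega> \<beta> c f g \<E> (\<lambda>x. w0 x + w x)"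
    by (rule cp_solution_add_w[OF eq 0 w0])
  have "AE x in \<mu>. w0 x = w0 x + w x"
    using cp[unfolded cp_uniquely_solvable_def, THEN conjunct2, rule_format, OF conjI[OF w0 sol]] .
  then have "AE x in lebesgue. x \<in> \<Omega> \<longrightarrow> w x = 0" using domain_sets by (simp add: AE_restrict_space_iff)
  then have "AE x in lebesgue_on T. x \<in> \<Omega> \<longrightarrow> w x = 0"
    using element(7)[OF T] by (subst AE_restrict_space_iff) auto
  with AE_lebesgue_on_interior[OF element(2,6)[OF T]]
  have "AE x in lebesgue_on T. P T x = 0"
  proof eventually_elim
    case (elim x)
    then show ?case using w_eq[of x T] T interior_element_subset[OF T] interior_subset by auto
  qed
  then show ?thesis by (rule polys_zero_if_AE[OF T P[OF T]])
qed

end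

section \<open>Existence and uniqueness for the scheme\<close>

lemma ip_zero_right: "(\<And>x. x \<in> space M \<Longrightarrow> h x = 0) \<Longrightarrow> ip M f h = 0"
  unfolding ip_def by (subst Bochner_Integration.integral_cong[of M M _ "\<lambda>_. 0"]) auto

lemma ip_self_nonneg: "0 \<le> ip M f f"
  unfolding ip_def by (rule integral_nonneg_AE) simp

lemma face_projection_in_face_polys:
  fixes e :: "'a::euclidean_space set"
  assumes e: "face_cell e" and g: "g \<in> L2 (face_measure e)"
  shows "face_projection k e g \<in> face_polys k e"
proof -
  let ?\<Phi> = "\<lambda>a. restrict (poly_fun k a) e"
  note fin = finite_measure_face_measure[OF e]
  have mem: "?\<Phi> a \<in> face_polys k e" for a by (auto simp: face_polys_def poly_fun_in_polys)
  have surj: "\<exists>a. q = ?\<Phi> a" if "q \<in> face_polys k e" for q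
    using that by (auto simp: face_polys_def polys_eq_range)
  have comb: "?\<Phi> (\<lambda>i. s * y i + z i) x = s * ?\<Phi> y x + ?\<Phi> z x" if "x \<in> e" for s y z x
    using that by (simp add: poly_fun_combination)
  have int: "integrable (face_measure e) (\<lambda>x. p x * q x)" if "p \<in> face_polys k e" "q \<in> face_polys k e" for p q
    by (intro face_measure_integrable[OF e] continuous_on_mult face_polys_continuous[OF that(1)]
        face_polys_continuous[OF that(2)])
  have intg: "integrable (face_measure e) (\<lambda>x. p x * g x)" if "p \<in> face_polys k e" for p
  proof (rule L2_mult_integrable[OF _ g])
    show "p \<in> L2 (face_measure e)"
      using face_measure_measurable[OF face_polys_continuous[OF that]] int[OF that that]
      by (simp add: L2_def power2_eq_square)
  qed
  have definite: "q x = 0" if "q \<in> face_polys k e" "ip (face_measure e) q q = 0" "x \<in> e" for q x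
  proof (rule face_measure_AE_continuous_eq[OF e face_polys_continuous[OF that(1)] _ that(3)])
    have "AE x in face_measure e. q x * q x = 0"
      using that(2) integral_nonneg_eq_0_iff_AE[OF int[OF that(1,1)]] by (simp add: ip_def)
    then show "AE x in face_measure e. q x = 0" by simp
  qed
  have F: "lin (\<lambda>y. ip (face_measure e) g (?\<Phi> y))"
    unfolding lin_def ip_commute[of _ g]
    by (intro allI ip_combination intg mem) (simp only: space_face_measure comb)
  have "\<exists>x. \<forall>y. ip (face_measure e) (?\<Phi> y) (?\<Phi> x) = ip (face_measure e) g (?\<Phi> y)"
  proof (rule fredholm_alternative[where I = "multi_indices k"])
    show "finite (multi_indices k :: ('a \<Rightarrow> nat) set)" by (rule finite_multi_indices)
    show "lin (\<lambda>y. ip (face_measure e) (?\<Phi> y) (?\<Phi> z))" for z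
      unfolding lin_def by (intro allI ip_combination int mem) (simp only: space_face_measure comb)
    then show "lin (\<lambda>y. ip (face_measure e) (?\<Phi> z) (?\<Phi> y))" for z
      by (subst ip_commute)
    show "lin (\<lambda>y. ip (face_measure e) g (?\<Phi> y))" by (rule F)
    show "ip (face_measure e) (?\<Phi> y) (?\<Phi> z) = 0" if "\<And>i. i \<in> multi_indices k \<Longrightarrow> z i = 0" for y z
    proof (rule ip_zero_right)
      show "?\<Phi> z x = 0" if "x \<in> space (face_measure e)" for x
        using \<open>\<And>i. i \<in> multi_indices k \<Longrightarrow> z i = 0\<close> that
        by (simp add: space_face_measure poly_fun_def)
    qed
    show "ip (face_measure e) g (?\<Phi> y) = 0" if "\<And>z. ip (face_measure e) (?\<Phi> y) (?\<Phi> z) = 0" for y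
      by (rule ip_zero_right, rule definite[OF mem that]) (simp add: space_face_measure)
  qed
  then obtain x where x: "\<And>y. ip (face_measure e) (?\<Phi> y) (?\<Phi> x) = ip (face_measure e) g (?\<Phi> y)" by blast
  let ?Q = "\<lambda>q. q \<in> face_polys k e \<and> (\<forall>p\<in>face_polys k e. ip (face_measure e) q p = ip (face_measure e) g p)"
  have "?Q (?\<Phi> x)"
    using mem surj x ip_commute[of "face_measure e" "?\<Phi> x"] by metis
  moreover have "q = ?\<Phi> x" if q: "?Q q" for q
  proof -
    obtain a where a: "q = ?\<Phi> a" using surj q by blast
    define d where "d = ?\<Phi> (\<lambda>i. (-1) * x i + a i)"
    have d: "d \<in> face_polys k e" unfolding d_def by (rule mem)
    have "ip (face_measure e) d d = (-1) * ip (face_measure e) (?\<Phi> x) d + ip (face_measure e) q d"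
      unfolding a
      by (rule ip_combination[OF int[OF mem d] int[OF mem d]])
        (simp only: d_def space_face_measure comb)
    also have "\<dots> = 0" using q \<open>?Q (?\<Phi> x)\<close> d by simp
    finally have d0: "d y = 0" if "y \<in> e" for y using definite[OF d _ that] by blast
    have "q y = ?\<Phi> x y" for y
    proof (cases "y \<in> e")
      case True
      then show ?thesis using d0[OF True] comb[OF True, of "-1" x a] by (simp add: d_def a)
    qed (simp add: a)
    then show ?thesis by blast
  qed
  ultimately have "face_projection k e g = ?\<Phi> x"
    unfolding face_projection_def by (rule the_equality)
  then show ?thesis using mem by simp
qed

datatype part = Element | Face | Multiplier

context wg_mesh
begin

abbreviation "is_solution \<equiv> pdwg_solution \<Omega> \<T> \<E> k \<beta> c"

definition mass :: "('a set \<Rightarrow> 'a \<Rightarrow> real) \<Rightarrow> ('a set \<Rightarrow> 'a \<Rightarrow> real) \<Rightarrow> real" where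
  "mass u v = (\<Sum>T\<in>\<T>. (diameter T)\<^sup>2 * ip (lebesgue_on T) (u T) (v T))"

definition load_W :: "('a \<Rightarrow> real) \<Rightarrow> real \<Rightarrow> 'a weak_fun \<Rightarrow> real" where
  "load_W f t1 \<sigma> = (\<Sum>T\<in>\<T>. t1 * ip (lebesgue_on T) f (conv_op \<beta> c (fst \<sigma> T)))"

definition load_M :: "('a \<Rightarrow> real) \<Rightarrow> ('a set \<Rightarrow> 'a \<Rightarrow> real) \<Rightarrow> real" where
  "load_M f v = (\<Sum>T\<in>\<T>. ip (lebesgue_on T) f (v T))"

definition M_combination ::
    "real \<Rightarrow> ('a set \<Rightarrow> 'a \<Rightarrow> real) \<Rightarrow> ('a set \<Rightarrow> 'a \<Rightarrow> real) \<Rightarrow> ('a set \<Rightarrow> 'a \<Rightarrow> real) \<Rightarrow> bool" where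
  "M_combination s v w u \<longleftrightarrow> v \<in> M \<and> w \<in> M \<and> u \<in> M \<and>
     (\<forall>T\<in>\<T>. \<forall>x. u T x = s * v T x + w T x)"

lemma mass_commute: "mass u v = mass v u"
  unfolding mass_def by (simp add: ip_commute)

lemma mass_combination:
  assumes c: "M_combination s v w u" and z: "z \<in> M"
  shows "mass z u = s * mass z v + mass z w"
proof -
  have "ip (lebesgue_on T) (z T) (u T) = s * ip (lebesgue_on T) (z T) (v T) + ip (lebesgue_on T) (z T) (w T)"
    if T: "T \<in> \<T>" for T
    using c T by (intro ip_M_combination[OF T] ae_continuous_integrable element(1) M_ae_continuous z)
      (auto simp: M_combination_def)
  then show ?thesis unfolding mass_def
    by (simp add: sum_distrib_left sum.distrib[symmetric] algebra_simps)
qed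

lemma load_M_combination:
  assumes c: "M_combination s v w u" and f: "f \<in> L2 (lebesgue_on \<Omega>)"
  shows "load_M f u = s * load_M f v + load_M f w"
proof -
  have "ip (lebesgue_on T) f (u T) = s * ip (lebesgue_on T) f (v T) + ip (lebesgue_on T) f (w T)"
    if T: "T \<in> \<T>" for T
    using c T by (intro ip_M_combination[OF T] L2_integrable_element[OF f])
      (auto simp: M_combination_def)
  then show ?thesis unfolding load_M_def by (simp add: sum_distrib_left sum.distrib[symmetric])
qed

lemma load_W_combination:
  assumes c: "W_combination s \<rho> \<sigma> \<tau>" and f: "f \<in> L2 (lebesgue_on \<Omega>)"
  shows "load_W f t1 \<tau> = s * load_W f t1 \<rho> + load_W f t1 \<sigma>"
proof -
  have W: "\<rho> \<in> W" "\<sigma> \<in> W" using c by (auto simp: W_combination_def)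
  have i: "integrable (lebesgue_on T) (\<lambda>x. conv_op \<beta> c (fst \<mu> T) x * f x)" if "T \<in> \<T>" "\<mu> \<in> W" for T \<mu>
    using integrable_mult_ae_continuous[OF element(1)[OF that(1)] L2_integrable_element[OF f that(1)]
        conv_op_ae_continuous[OF that(1) W_element[OF that(2,1)]]]
    by (simp add: mult.commute)
  have "ip (lebesgue_on T) f (conv_op \<beta> c (fst \<tau> T)) =
    s * ip (lebesgue_on T) f (conv_op \<beta> c (fst \<rho> T)) + ip (lebesgue_on T) f (conv_op \<beta> c (fst \<sigma> T))"
    if T: "T \<in> \<T>" for T
    unfolding ip_commute[of _ f]
    by (rule ip_combination[OF i[OF T W(1)] i[OF T W(2)] conv_op_combination[OF c T]])
  then show ?thesis unfolding load_W_def
    by (simp add: sum_distrib_left sum.distrib[symmetric] algebra_simps)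
qed

lemma b_form_M_combination:
  assumes "M_combination s v w u" "\<sigma> \<in> W"
  shows "bf \<sigma> u = s * bf \<sigma> v + bf \<sigma> w"
  by (rule b_form_test_combination[OF assms(2)]) (use assms(1) in \<open>auto simp: M_combination_def\<close>)

lemma s_form_W_combination:
  "W_combination s \<rho> \<sigma> \<tau> \<Longrightarrow> \<mu> \<in> W \<Longrightarrow>
    sf t1 \<mu> \<tau> = s * sf t1 \<mu> \<rho> + sf t1 \<mu> \<sigma>"
  using s_form_combination by (simp add: s_form_commute[of _ \<mu>])

abbreviation \<I> where "\<I> \<equiv> inflow_faces \<Omega> \<beta> \<E>"
abbreviation W0 where "W0 \<equiv> W0_space k \<T> \<E> \<I>"

lemma inflow_faces_mesh: "e \<in> \<I> \<Longrightarrow> e \<in> \<E>"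
  by (simp add: inflow_faces_def faces_of_def)

lemma W0_W: "\<sigma> \<in> W0 \<Longrightarrow> \<sigma> \<in> W" by (simp add: W0_space_def)

text \<open>The stabilizer is a sum of squares: it vanishes only if \<open>\<sigma>\<^sub>0 = \<sigma>\<^sub>b\<close> on all faces and the equation
  holds with \<open>f = 0\<close> in each element. The first property makes \<open>\<sigma>\<^sub>0\<close> single-valued across faces and
  carries the boundary condition from \<open>\<sigma>\<^sub>b\<close> to \<open>\<sigma>\<^sub>0\<close>.\<close>

lemma energy_zero_W:
  assumes cp: "cp_uniquely_solvable \<Omega> \<beta> c f g \<E>" and t1: "t1 > 0"
    and \<sigma>: "\<sigma> \<in> W0" and 0: "sf t1 \<sigma> \<sigma> = 0"
  shows "T \<in> \<T> \<Longrightarrow> fst \<sigma> T = (\<lambda>x. 0)" and "e \<in> \<E> \<Longrightarrow> x \<in> e \<Longrightarrow> snd \<sigma> e x = 0"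
proof -
  note W = W0_W[OF \<sigma>]
  let ?J = "\<lambda>T e. ip (face_measure e) (\<lambda>x. fst \<sigma> T x - snd \<sigma> e x) (\<lambda>x. fst \<sigma> T x - snd \<sigma> e x)"
  let ?C = "\<lambda>T. ip (lebesgue_on T) (conv_op \<beta> c (fst \<sigma> T)) (conv_op \<beta> c (fst \<sigma> T))"
  have Jn: "0 \<le> (\<Sum>e\<in>faces_of \<E> T. ?J T e)" for T by (intro sum_nonneg ip_self_nonneg)
  have fin: "finite (faces_of \<E> T)" for T using finite_mesh by (simp add: faces_of_def)
  have both: "?C T = 0 \<and> (\<forall>e\<in>faces_of \<E> T. ?J T e = 0)" if T: "T \<in> \<T>" for T
  proof -
    have h: "inverse (diameter S) > 0" if "S \<in> \<T>" for S using element(8)[OF that] by simp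
    have a: "0 \<le> inverse (diameter S) * (\<Sum>e\<in>faces_of \<E> S. ?J S e)" if "S \<in> \<T>" for S
      using h[OF that] Jn by simp
    have b: "0 \<le> t1 * ?C S" for S
      using t1 by (intro mult_nonneg_nonneg ip_self_nonneg) simp
    have "inverse (diameter T) * (\<Sum>e\<in>faces_of \<E> T. ?J T e) + t1 * ?C T = 0"
      using 0[unfolded s_form_def] a b T finite_mesh(1)
      by (subst (asm) sum_nonneg_eq_0_iff) auto
    then have "inverse (diameter T) * (\<Sum>e\<in>faces_of \<E> T. ?J T e) = 0" "t1 * ?C T = 0"
      using a[OF T] b[of T] by linarith+
    then have "(\<Sum>e\<in>faces_of \<E> T. ?J T e) = 0" "?C T = 0" using h[OF T] t1 by auto
    then show ?thesis
      using sum_nonneg_eq_0_iff[OF fin ip_self_nonneg, of face_measure "\<lambda>e x. fst \<sigma> T x - snd \<sigma> e x" T]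
      by simp
  qed
  have conv: "AE x in lebesgue_on T. conv_op \<beta> c (fst \<sigma> T) x = 0" if T: "T \<in> \<T>" for T
    using both[OF T] conv_op_ae_continuous[OF T W_element[OF W T]]
    by (intro ae_continuous_sq_zero[OF element(1)[OF T]]) auto
  have jump: "fst \<sigma> T x = snd \<sigma> e x" if T: "T \<in> \<T>" and e: "e \<in> faces_of \<E> T" and x: "x \<in> e" for T e x
  proof -
    have eE: "e \<in> \<E>" by (rule faces_of_mesh[OF e])
    have "AE x in face_measure e. (fst \<sigma> T x - snd \<sigma> e x) * (fst \<sigma> T x - snd \<sigma> e x) = 0"
      using both[OF T] e integral_nonneg_eq_0_iff_AE[OF jump_integrable[OF W W T e]] by (simp add: ip_def)
    then have ae: "AE x in face_measure e. fst \<sigma> T x - snd \<sigma> e x = 0" by simp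
    have "fst \<sigma> T x - snd \<sigma> e x = 0"
      by (rule face_measure_AE_continuous_eq[OF face[OF eE] _ ae x])
        (intro continuous_on_diff W_element_continuous[OF W T] W_face_continuous[OF W eE])
    then show ?thesis by simp
  qed
  interpret glued_polynomials \<Omega> \<T> \<E> \<beta> c k "fst \<sigma>" k
    by unfold_locales (use W_element[OF W] jump in metis)+
  have zero: "fst \<sigma> T = (\<lambda>x. 0)" if T: "T \<in> \<T>" for T
  proof (rule glued_zero_if_cp_unique[OF conv _ cp T])
    show "fst \<sigma> S x = 0" if "e \<in> \<I>" "S \<in> \<T>" "e \<in> faces_of \<E> S" "x \<in> e" for e S x
      using jump[OF that(2-4)] \<sigma> that by (simp add: W0_space_def)
  qed
  then show "fst \<sigma> T = (\<lambda>x. 0)" if "T \<in> \<T>" using that .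
  show "snd \<sigma> e x = 0" if e: "e \<in> \<E>" and x: "x \<in> e"
  proof -
    obtain T where "T \<in> \<T>" "e \<in> faces_of \<E> T" using face_of_element e by blast
    then have "snd \<sigma> e x = fst \<sigma> T x" using jump[of T e x] x by simp
    also have "\<dots> = 0" by (simp add: zero[OF \<open>T \<in> \<T>\<close>])
    finally show ?thesis .
  qed
qed

lemma s_form_nonneg: "t1 > 0 \<Longrightarrow> 0 \<le> sf t1 \<sigma> \<sigma>"
  unfolding s_form_def
  by (intro sum_nonneg add_nonneg_nonneg mult_nonneg_nonneg ip_self_nonneg)
    (auto simp: less_imp_le[OF element(8)])

lemma mass_nonneg: "0 \<le> mass u u"
  unfolding mass_def by (intro sum_nonneg mult_nonneg_nonneg ip_self_nonneg) auto

lemma mass_zero: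
  assumes u: "u \<in> M" and 0: "mass u u = 0" and T: "T \<in> \<T>"
  shows "u T = (\<lambda>x. 0)"
proof -
  have "(diameter T)\<^sup>2 * ip (lebesgue_on T) (u T) (u T) = 0"
    using 0[unfolded mass_def] T
      sum_nonneg_eq_0_iff[OF finite_mesh(1) mult_nonneg_nonneg[OF zero_le_power2 ip_self_nonneg],
        of diameter lebesgue_on u]
    by blast
  then have "ip (lebesgue_on T) (u T) (u T) = 0" using element(8)[OF T] by simp
  then show ?thesis
    by (intro polys_zero_if_AE[OF T M_element[OF u T]]
        ae_continuous_sq_zero[OF element(1)[OF T] M_ae_continuous[OF u T]])
qed

text \<open>Coefficients are real-valued functions on one index type, to which the Fredholm alternative applies. Those of
  \<open>\<sigma>\<^sub>b\<close> on inflow faces are ignored, which builds in the homogeneous boundary condition.\<close>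

definition W0_of :: "(part \<times> 'a set \<times> ('a \<Rightarrow> nat) \<Rightarrow> real) \<Rightarrow> 'a weak_fun" where
  "W0_of y = ((\<lambda>T\<in>\<T>. poly_fun k (\<lambda>\<alpha>. y (Element, T, \<alpha>))),
     (\<lambda>e\<in>\<E>. restrict (if e \<in> \<I> then (\<lambda>x. 0) else poly_fun k (\<lambda>\<alpha>. y (Face, e, \<alpha>))) e))"

definition M_of :: "(part \<times> 'a set \<times> ('a \<Rightarrow> nat) \<Rightarrow> real) \<Rightarrow> 'a set \<Rightarrow> 'a \<Rightarrow> real" where
  "M_of y = (\<lambda>T\<in>\<T>. poly_fun (k - 1) (\<lambda>\<alpha>. y (Multiplier, T, \<alpha>)))"

lemma W0_of_mem: "W0_of y \<in> W0"
  unfolding W0_of_def W0_space_def W_space_def face_polys_def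
  using inflow_faces_mesh by (auto simp: poly_fun_in_polys polys_zero)

lemma M_of_mem: "M_of y \<in> M"
  unfolding M_of_def M_space_def by (auto simp: poly_fun_in_polys)

lemma W0_of_combination: "W_combination s (W0_of y) (W0_of z) (W0_of (\<lambda>i. s * y i + z i))"
  unfolding W_combination_def using W0_W[OF W0_of_mem]
  by (auto simp: W0_of_def poly_fun_combination)

lemma M_of_combination: "M_combination s (M_of y) (M_of z) (M_of (\<lambda>i. s * y i + z i))"
  unfolding M_combination_def using M_of_mem by (auto simp: M_of_def poly_fun_combination)

lemma coordinates_exist:
  assumes \<sigma>: "\<sigma> \<in> W0" and v: "v \<in> M"
  shows "\<exists>y. W0_of y = \<sigma> \<and> M_of y = v"
proof -
  have W: "\<sigma> \<in> W" by (rule W0_W[OF \<sigma>])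
  have "\<forall>T\<in>\<T>. \<exists>a. fst \<sigma> T = poly_fun k a" using W_element[OF W] by (auto simp: polys_eq_range)
  then obtain a0 where a0: "\<And>T. T \<in> \<T> \<Longrightarrow> fst \<sigma> T = poly_fun k (a0 T)" by metis
  have "\<forall>e\<in>\<E>. \<exists>a. snd \<sigma> e = restrict (poly_fun k a) e"
    using W_face[OF W] by (auto simp: polys_eq_range face_polys_def)
  then obtain a1 where a1: "\<And>e. e \<in> \<E> \<Longrightarrow> snd \<sigma> e = restrict (poly_fun k (a1 e)) e" by metis
  have "\<forall>T\<in>\<T>. \<exists>a. v T = poly_fun (k - 1) a" using M_element[OF v] by (auto simp: polys_eq_range)
  then obtain a2 where a2: "\<And>T. T \<in> \<T> \<Longrightarrow> v T = poly_fun (k - 1) (a2 T)" by metis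
  define y where "y i = (case i of (t, S, \<alpha>) \<Rightarrow>
      case t of Element \<Rightarrow> a0 S \<alpha> | Face \<Rightarrow> a1 S \<alpha> | Multiplier \<Rightarrow> a2 S \<alpha>)" for i
  have y: "(\<lambda>\<alpha>. y (Element, T, \<alpha>)) = a0 T" "(\<lambda>\<alpha>. y (Face, T, \<alpha>)) = a1 T" "(\<lambda>\<alpha>. y (Multiplier, T, \<alpha>)) = a2 T" for T
    by (simp_all add: y_def)
  have "fst (W0_of y) = fst \<sigma>"
  proof (rule extensionalityI[of _ \<T>])
    show "fst \<sigma> \<in> extensional \<T>" using W by (auto simp: W_space_def PiE_def mem_Times_iff)
  qed (simp_all add: W0_of_def y a0)
  moreover have "snd (W0_of y) = snd \<sigma>"
  proof (rule extensionalityI[of _ \<E>])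
    show "snd \<sigma> \<in> extensional \<E>" using W by (auto simp: W_space_def PiE_def mem_Times_iff)
    fix e assume e: "e \<in> \<E>"
    show "snd (W0_of y) e = snd \<sigma> e"
    proof (cases "e \<in> \<I>")
      case True
      then have "snd \<sigma> e x = 0" if "x \<in> e" for x using \<sigma> that by (simp add: W0_space_def)
      then show ?thesis using True e a1[OF e] by (auto simp: W0_of_def fun_eq_iff restrict_def)
    qed (simp add: W0_of_def e y(2) a1[OF e])
  qed (simp add: W0_of_def)
  moreover have "M_of y = v"
  proof (rule extensionalityI[of _ \<T>])
    show "v \<in> extensional \<T>" using v by (auto simp: M_space_def PiE_def)
  qed (simp_all add: M_of_def y a2)
  ultimately show ?thesis by (auto simp: prod_eq_iff)
qed

lemma W0_of_eq_zero:
  assumes "\<And>T. T \<in> \<T> \<Longrightarrow> fst (W0_of y) T = (\<lambda>x. 0)" "\<And>e x. e \<in> \<E> \<Longrightarrow> x \<in> e \<Longrightarrow> snd (W0_of y) e x = 0"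
  shows "W0_of y = W0_of (\<lambda>i. 0)"
proof (rule prod_eqI)
  show "fst (W0_of y) = fst (W0_of (\<lambda>i. 0))"
    using assms(1) by (auto simp: W0_of_def poly_fun_zero fun_eq_iff restrict_def)
  show "snd (W0_of y) = snd (W0_of (\<lambda>i. 0))"
  proof (intro ext)
    fix e x
    show "snd (W0_of y) e x = snd (W0_of (\<lambda>i. 0)) e x"
      using assms(2)[of e x] by (cases "e \<in> \<E>"; cases "x \<in> e") (auto simp: W0_of_def poly_fun_zero)
  qed
qed

lemma M_of_eq_zero:
  assumes "\<And>T. T \<in> \<T> \<Longrightarrow> M_of y T = (\<lambda>x. 0)" shows "M_of y = M_of (\<lambda>i. 0)"
  using assms by (auto simp: M_of_def poly_fun_zero fun_eq_iff restrict_def)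

abbreviation coords :: "(part \<times> 'a set \<times> ('a \<Rightarrow> nat)) set" where
  "coords \<equiv> {Element, Face, Multiplier} \<times> (\<T> \<union> \<E>) \<times> multi_indices k"

lemma coordinates_local:
  assumes "\<And>i. i \<in> coords \<Longrightarrow> y i = 0"
  shows "W0_of y = W0_of (\<lambda>i. 0)" "M_of y = M_of (\<lambda>i. 0)"
proof -
  have "poly_fun k (\<lambda>\<alpha>. y (Element, T, \<alpha>)) = poly_fun k (\<lambda>\<alpha>. 0)"
    "poly_fun (k - 1) (\<lambda>\<alpha>. y (Multiplier, T, \<alpha>)) = poly_fun (k - 1) (\<lambda>\<alpha>. 0)" if "T \<in> \<T>" for T
    using that multi_indices_mono[of "k - 1" k] by (auto intro!: poly_fun_cong assms)
  moreover have "poly_fun k (\<lambda>\<alpha>. y (Face, e, \<alpha>)) = poly_fun k (\<lambda>\<alpha>. 0)" if "e \<in> \<E>" for e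
    using that by (intro poly_fun_cong assms) auto
  ultimately show "W0_of y = W0_of (\<lambda>i. 0)" "M_of y = M_of (\<lambda>i. 0)"
    by (auto simp: W0_of_def M_of_def fun_eq_iff restrict_def)
qed

lemma pdwg_solution_iff:
  "is_solution f g t1 t2 lam u \<longleftrightarrow>
     lam \<in> W \<and> u \<in> M \<and> (\<forall>e\<in>\<I>. snd lam e = face_projection k e g) \<and>
     (\<forall>\<sigma>\<in>W0. sf t1 lam \<sigma> + bf \<sigma> u = load_W f t1 \<sigma>) \<and>
     (\<forall>v\<in>M. - t2 * mass u v + bf lam v = load_M f v)"
  unfolding pdwg_solution_def load_W_def load_M_def mass_def by simp

lemma W_diff_exists:
  assumes "\<rho> \<in> W" "\<sigma> \<in> W" shows "\<exists>\<tau>. W_combination (-1) \<sigma> \<rho> \<tau>"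
proof -
  let ?\<tau> = "((\<lambda>T\<in>\<T>. \<lambda>x. -1 * fst \<sigma> T x + fst \<rho> T x), (\<lambda>e\<in>\<E>. \<lambda>x\<in>e. -1 * snd \<sigma> e x + snd \<rho> e x))"
  have "(\<lambda>x\<in>e. -1 * snd \<sigma> e x + snd \<rho> e x) \<in> face_polys k e" if e: "e \<in> \<E>" for e
  proof -
    obtain p q where pq: "p \<in> polys k" "snd \<sigma> e = restrict p e" "q \<in> polys k" "snd \<rho> e = restrict q e"
      using W_face[OF assms(1) e] W_face[OF assms(2) e] by (auto simp: face_polys_def)
    have "(\<lambda>x\<in>e. -1 * snd \<sigma> e x + snd \<rho> e x) = restrict (\<lambda>x. -1 * p x + q x) e"
      by (auto simp: pq fun_eq_iff)
    then show ?thesis using polys_combination[OF pq(1,3), of "-1"] by (auto simp: face_polys_def)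
  qed
  moreover have "(\<lambda>x. -1 * fst \<sigma> T x + fst \<rho> T x) \<in> polys k" if "T \<in> \<T>" for T
    by (rule polys_combination[OF W_element[OF assms(2) that] W_element[OF assms(1) that]])
  ultimately have "?\<tau> \<in> W" unfolding W_space_def by (auto intro!: restrict_PiE_iff[THEN iffD2])
  then have "W_combination (-1) \<sigma> \<rho> ?\<tau>" using assms by (simp add: W_combination_def)
  then show ?thesis by blast
qed

lemma M_diff_exists:
  assumes "u \<in> M" "v \<in> M" shows "\<exists>d. M_combination (-1) v u d"
proof -
  have "(\<lambda>T\<in>\<T>. \<lambda>x. -1 * v T x + u T x) \<in> M"
    using polys_combination[OF M_element[OF assms(2)] M_element[OF assms(1)], of _ _ "-1"]
    unfolding M_space_def by (intro restrict_PiE_iff[THEN iffD2]) blast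
  then show ?thesis using assms
    by (intro exI[of _ "\<lambda>T\<in>\<T>. \<lambda>x. -1 * v T x + u T x"]) (simp add: M_combination_def)
qed

text \<open>Test the equations for the difference \<open>(d, v)\<close> of two solutions with \<open>d\<close> and \<open>v\<close>. The terms \<open>b(d, v)\<close> cancel,
  and \<open>s(d, d) + t2 mass(v, v) = 0\<close> remains.\<close>

lemma pdwg_unique:
  assumes cp: "cp_uniquely_solvable \<Omega> \<beta> c f g \<E>" and \<tau>: "t1 > 0" "t2 > 0"
    and 1: "is_solution f g t1 t2 l u"
    and 2: "is_solution f g t1 t2 l' u'"
  shows "l = l' \<and> u = u'"
proof -
  note 1 = 1[unfolded pdwg_solution_iff] and 2 = 2[unfolded pdwg_solution_iff]
  have W: "l \<in> W" "l' \<in> W" and M: "u \<in> M" "u' \<in> M" using 1 2 by auto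
  obtain d where d: "W_combination (-1) l' l d" using W_diff_exists W by blast
  obtain v where v: "M_combination (-1) u' u v" using M_diff_exists M by blast
  have dW: "d \<in> W" using d by (simp add: W_combination_def)
  have vM: "v \<in> M" using v by (simp add: M_combination_def)
  have "snd d e x = 0" if "e \<in> \<I>" "x \<in> e" for e x
    using d 1 2 that inflow_faces_mesh[OF that(1)] by (simp add: W_combination_def)
  then have d0: "d \<in> W0" using dW by (simp add: W0_space_def)
  have "sf t1 l d + bf d u = load_W f t1 d"
    "sf t1 l' d + bf d u' = load_W f t1 d"
    using 1 2 d0 by blast+
  then have "sf t1 d d + bf d v = 0"
    unfolding s_form_combination[OF d dW] b_form_M_combination[OF v dW] by linarith
  moreover have "- t2 * mass v v + bf d v = 0"
  proof -
    have "mass v v = - mass u' v + mass u v"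
      using mass_combination[OF v vM] by (simp add: mass_commute[of v u] mass_commute[of v u'])
    moreover have "- t2 * mass u v + bf l v = - t2 * mass u' v + bf l' v"
      using 1 2 vM by simp
    ultimately have "- t2 * (- mass u' v + mass u v) + (-1 * bf l' v + bf l v) = 0"
      by (simp add: right_diff_distrib)
    then show ?thesis unfolding b_form_combination[OF d vM] \<open>mass v v = _\<close> .
  qed
  ultimately have "sf t1 d d + t2 * mass v v = 0" by simp
  moreover have "0 \<le> t2 * mass v v" using \<tau> mass_nonneg by simp
  ultimately have s0: "sf t1 d d = 0" and "t2 * mass v v = 0"
    using s_form_nonneg[OF \<tau>(1), of d] by linarith+
  then have m0: "mass v v = 0" using \<tau> by simp
  note z = energy_zero_W[OF cp \<tau>(1) d0 s0]
  have "fst l = fst l'"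
  proof (rule PiE_ext[where k = \<T> and s = "\<lambda>_. polys k"])
    show "fst l T = fst l' T" if "T \<in> \<T>" for T
      using z(1)[OF that] d that by (auto simp: W_combination_def fun_eq_iff)
  qed (use W in \<open>auto simp: W_space_def mem_Times_iff\<close>)
  moreover have "snd l = snd l'"
  proof (rule PiE_ext[where k = \<E> and s = "face_polys k"])
    show "snd l e = snd l' e" if e: "e \<in> \<E>" for e
    proof
      fix x
      show "snd l e x = snd l' e x"
      proof (cases "x \<in> e")
        case True
        then show ?thesis using z(2)[OF e True] d e by (simp add: W_combination_def)
      next
        case False
        then show ?thesis using W_face[OF W(1) e] W_face[OF W(2) e] by (auto simp: face_polys_def)
      qed
    qed
  qed (use W in \<open>auto simp: W_space_def mem_Times_iff\<close>)
  moreover have "u = u'"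
  proof (rule PiE_ext[where k = \<T> and s = "\<lambda>_. polys (k - 1)"])
    show "u T = u' T" if "T \<in> \<T>" for T
      using mass_zero[OF vM m0 that] v that by (auto simp: M_combination_def fun_eq_iff)
  qed (use M in \<open>auto simp: M_space_def\<close>)
  ultimately show ?thesis by (simp add: prod_eq_iff)
qed

text \<open>The inflow data are lifted by a function supported on inflow faces, and the remaining square system is
  solvable because its kernel is trivial by the same energy argument as for uniqueness.\<close>

lemma pdwg_exists:
  assumes f: "f \<in> L2 (lebesgue_on \<Omega>)" and g: "\<And>e. e \<in> \<I> \<Longrightarrow> g \<in> L2 (face_measure e)"
    and cp: "cp_uniquely_solvable \<Omega> \<beta> c f g \<E>" and \<tau>: "t1 > 0" "t2 > 0"
  shows "\<exists>l u. is_solution f g t1 t2 l u"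
proof -
  define lg :: "'a weak_fun" where
    "lg = ((\<lambda>T\<in>\<T>. \<lambda>x. 0), (\<lambda>e\<in>\<E>. if e \<in> \<I> then face_projection k e g else restrict (\<lambda>x. 0) e))"
  have lgW: "lg \<in> W"
    unfolding lg_def W_space_def
    using face_projection_in_face_polys[OF face g] inflow_faces_mesh
    by (auto simp: polys_zero face_polys_def)
  have WW: "W0_of y \<in> W" for y by (rule W0_W[OF W0_of_mem])
  \<comment> \<open>the sign of the second equation is changed, so that \<open>B y y\<close> is the energy\<close>
  define B where "B y z = sf t1 (W0_of z) (W0_of y) + bf (W0_of y) (M_of z) +
      t2 * mass (M_of z) (M_of y) - bf (W0_of z) (M_of y)" for y z
  define F where "F y = (load_W f t1 (W0_of y) - sf t1 lg (W0_of y)) - (load_M f (M_of y) - bf lg (M_of y))" for y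
  note comb = s_form_combination[OF W0_of_combination WW] s_form_W_combination[OF W0_of_combination WW]
    b_form_combination[OF W0_of_combination M_of_mem] b_form_M_combination[OF M_of_combination WW]
    mass_combination[OF M_of_combination M_of_mem]
    s_form_W_combination[OF W0_of_combination lgW] b_form_M_combination[OF M_of_combination lgW]
    load_W_combination[OF W0_of_combination f] load_M_combination[OF M_of_combination f]
  have linF: "lin F"
    unfolding lin_def F_def by (intro allI) (simp only: comb, simp add: algebra_simps)
  have linB1: "lin (\<lambda>y. B y z)" for z
    unfolding lin_def B_def by (intro allI) (simp only: comb, simp add: algebra_simps)
  have linB2: "lin (B y)" for y
    unfolding lin_def B_def mass_commute[of _ "M_of y"]
    by (intro allI) (simp only: comb, simp add: algebra_simps)
  have "\<exists>x. \<forall>y. B y x = F y"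
  proof (rule fredholm_alternative[where I = "coords"])
    show "finite coords"
      by (intro finite_cartesian_product finite_UnI finite_mesh finite_multi_indices) simp
    show "B y z = 0" if "\<And>i. i \<in> coords \<Longrightarrow> z i = 0" for y z
    proof -
      have "B y z = B y (\<lambda>i. 0)" using coordinates_local[OF that] by (simp add: B_def)
      then show ?thesis using lin_zero[OF linB2] by simp
    qed
    show "F y = 0" if "\<And>z. B y z = 0" for y
    proof -
      have "sf t1 (W0_of y) (W0_of y) + t2 * mass (M_of y) (M_of y) = 0" using that[of y] by (simp add: B_def)
      moreover have "0 \<le> t2 * mass (M_of y) (M_of y)" using \<tau> mass_nonneg by simp
      ultimately have s0: "sf t1 (W0_of y) (W0_of y) = 0" and "t2 * mass (M_of y) (M_of y) = 0"
        using s_form_nonneg[OF \<tau>(1), of "W0_of y"] by linarith+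
      then have m0: "mass (M_of y) (M_of y) = 0" using \<tau> by simp
      have "W0_of y = W0_of (\<lambda>i. 0)"
        by (rule W0_of_eq_zero) (rule energy_zero_W[OF cp \<tau>(1) W0_of_mem s0], assumption+)+
      moreover have "M_of y = M_of (\<lambda>i. 0)"
        by (rule M_of_eq_zero) (rule mass_zero[OF M_of_mem m0])
      ultimately have "F y = F (\<lambda>i. 0)" by (simp add: F_def)
      then show ?thesis using lin_zero[OF linF] by simp
    qed
  qed (rule linB1 linB2 linF)+
  then obtain x where x: "\<And>y. B y x = F y" by blast
  define l :: "'a weak_fun" where
    "l = (fst (W0_of x), (\<lambda>e\<in>\<E>. if e \<in> \<I> then face_projection k e g else snd (W0_of x) e))"
  have "l \<in> W"
    unfolding l_def W_space_def
    using face_projection_in_face_polys[OF face g] inflow_faces_mesh W_face[OF WW] WW[of x]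
    by (auto simp: W_space_def mem_Times_iff)
  then have l: "W_combination 1 (W0_of x) lg l"
    using lgW WW W0_of_mem[of x] by (auto simp: W_combination_def l_def lg_def W0_space_def)
  have eqs: "sf t1 l (W0_of y) + bf (W0_of y) (M_of x) - load_W f t1 (W0_of y) =
      - t2 * mass (M_of x) (M_of y) + bf l (M_of y) - load_M f (M_of y)" for y
    using x[of y] by (simp add: B_def F_def s_form_combination[OF l WW] b_form_combination[OF l M_of_mem])
  \<comment> \<open>the two sides depend linearly on the independent components of \<open>y\<close>, so both vanish\<close>
  note zW = W0_of_combination[of 1 "\<lambda>i. 0" "\<lambda>i. 0"] and zM = M_of_combination[of 1 "\<lambda>i. 0" "\<lambda>i. 0"]
  have lhs0: "sf t1 l (W0_of (\<lambda>i. 0)) = 0" "bf (W0_of (\<lambda>i. 0)) (M_of x) = 0" "load_W f t1 (W0_of (\<lambda>i. 0)) = 0"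
    using s_form_W_combination[OF zW \<open>l \<in> W\<close>, of t1]
      b_form_combination[OF zW M_of_mem[of x]]
      load_W_combination[OF zW f, of t1]
    by simp_all
  have rhs0: "mass (M_of x) (M_of (\<lambda>i. 0)) = 0" "bf l (M_of (\<lambda>i. 0)) = 0" "load_M f (M_of (\<lambda>i. 0)) = 0"
    using mass_combination[OF zM M_of_mem[of x]]
      b_form_M_combination[OF zM \<open>l \<in> W\<close>]
      load_M_combination[OF zM f]
    by simp_all
  have "is_solution f g t1 t2 l (M_of x)"
    unfolding pdwg_solution_iff
  proof (intro conjI ballI)
    show "l \<in> W" by fact
    show "M_of x \<in> M" by (rule M_of_mem)
    show "snd l e = face_projection k e g" if "e \<in> \<I>" for e
      using that inflow_faces_mesh[OF that] by (simp add: l_def)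
    show "sf t1 l \<sigma> + bf \<sigma> (M_of x) = load_W f t1 \<sigma>" if \<sigma>: "\<sigma> \<in> W0" for \<sigma>
    proof -
      obtain y where "W0_of y = \<sigma>" "M_of y = M_of (\<lambda>i. 0)" using coordinates_exist[OF \<sigma> M_of_mem] by blast
      then show ?thesis using eqs[of y] rhs0 by simp
    qed
    show "- t2 * mass (M_of x) v + bf l v = load_M f v" if v: "v \<in> M" for v
    proof -
      obtain y where "W0_of y = W0_of (\<lambda>i. 0)" "M_of y = v" using coordinates_exist[OF W0_of_mem v] by blast
      then show ?thesis using eqs[of y] lhs0 by simp
    qed
  qed
  then show ?thesis by blast
qed

end

theorem theorem3p2:
  fixes \<Omega> :: "'a::euclidean_space set"
    and \<T> \<E> :: "'a set set"
    and \<beta> :: "'a \<Rightarrow> 'a"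
    and c f g :: "'a \<Rightarrow> real"
    and \<rho>\<^sub>v \<rho>\<^sub>e \<kappa> \<sigma>\<^sub>s \<theta>\<^sub>0 \<gamma>\<^sub>s \<rho>\<^sub>S \<tau>\<^sub>1 \<tau>\<^sub>2 :: real
    and N k :: nat
  assumes "DIM('a) \<in> {2, 3}"
    and "open \<Omega>" and "bounded \<Omega>" and "connected \<Omega>" and "\<Omega> \<noteq> {}" and "lipschitz_boundary \<Omega>"
    and "\<rho>\<^sub>v > 0" and "\<rho>\<^sub>e > 0" and "\<kappa> > 0" and "\<sigma>\<^sub>s > 0" and "\<theta>\<^sub>0 < pi / 2" and "\<gamma>\<^sub>s > 0" and "\<rho>\<^sub>S > 0"
    and "polyhedral_mesh \<Omega> \<T> \<E>"
    and "shape_regular \<rho>\<^sub>v \<rho>\<^sub>e \<kappa> \<sigma>\<^sub>s \<theta>\<^sub>0 \<gamma>\<^sub>s \<rho>\<^sub>S N \<T> \<E>"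
    and "\<beta> \<in> Linf (lebesgue_on \<Omega>)" and "piecewise_smooth \<T> \<beta>"
    and "c \<in> Linf (lebesgue_on \<Omega>)" and "piecewise_smooth \<T> c"
    and "f \<in> L2 (lebesgue_on \<Omega>)"
    and "inflow_resolved \<Omega> \<beta> \<E>"
    and "\<forall>e\<in>inflow_faces \<Omega> \<beta> \<E>. g \<in> L2 (face_measure e)"
    and "k \<ge> 1"
    and "cp_uniquely_solvable \<Omega> \<beta> c f g \<E>"
    and "\<tau>\<^sub>1 > 0" and "\<tau>\<^sub>2 > 0"
  shows "\<exists>!(lam, u). pdwg_solution \<Omega> \<T> \<E> k \<beta> c f g \<tau>\<^sub>1 \<tau>\<^sub>2 lam u"
proof -
  interpret wg_mesh \<Omega> \<T> \<E> \<beta> c k by unfold_locales fact+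
  obtain l u where lu: "pdwg_solution \<Omega> \<T> \<E> k \<beta> c f g \<tau>\<^sub>1 \<tau>\<^sub>2 l u"
    using pdwg_exists assms by blast
  show ?thesis
  proof (rule ex1I[of _ "(l, u)"])
    show "case (l, u) of (lam, u) \<Rightarrow> pdwg_solution \<Omega> \<T> \<E> k \<beta> c f g \<tau>\<^sub>1 \<tau>\<^sub>2 lam u" using lu by simp
    fix p assume "case p of (lam, u) \<Rightarrow> pdwg_solution \<Omega> \<T> \<E> k \<beta> c f g \<tau>\<^sub>1 \<tau>\<^sub>2 lam u"
    then show "p = (l, u)" using pdwg_unique[OF assms(24,25,26) _ lu] by (cases p) simp
  qed
qed

end
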